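(* Let $f:\mathbb{D}^2\to\mathbb{D}$ be holomorphic. Then there exist positive semi-definite kernels $K_1,K_2:\mathbb{D}^2\times\mathbb{D}^2\to\mathbb{C}$ and holomorphic functions $L_1,L_2:\mathbb{D}^2\times\mathbb{D}^2\to\mathbb{C}$ such that for all $z=(z_1,z_2)\in\mathbb{D}^2$ and $\zeta=(\zeta_1,\zeta_2)\in\mathbb{D}^2$, \[ 1-f(z)\overline{f(\zeta)}=(1-z_1\bar\zeta_1)K_1(z,\zeta)+(1-z_2\bar\zeta_2)K_2(z,\zeta) \] and \[ f(z)-f(\zeta)=(z_1-\zeta_1)L_1(z,\zeta)+(z_2-\zeta_2)L_2(z,\zeta), \] and in addition, for $j=1,2$ and all $z,\zeta\in\mathbb{D}^2$, \[ |L_j(z,\zeta)|^2\le K_j(z,z)\,K_j(\zeta,\zeta). \]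
   Context: $\mathbb{D}$ is the open unit disk in $\mathbb{C}$ and $\mathbb{D}^2=\mathbb{D}\times\mathbb{D}$. A function $K:\Omega\times\Omega\to\mathbb{C}$ is a positive semi-definite kernel if for every finite subset $F\subset\Omega$ the matrix $(K(z,\zeta))_{z,\zeta\in F}$ is positive semi-definite. Holomorphic for $L_j$ means holomorphic in $(z,\zeta)\in\mathbb{D}^2\times\mathbb{D}^2\subset\mathbb{C}^4$. *)

theory Defs
  imports "HOL-Analysis.Analysis"
begin

abbreviation unit_disc :: "complex set" (\<open>\<bbbD>\<close>)
  where "\<bbbD> \<equiv> ball 0 1"

definition bidisc :: "(complex \<times> complex) set"
  where "bidisc = \<bbbD> \<times> \<bbbD>"

(* Holomorphy in several variables is complex Frechet differentiability: the (real)
   Frechet derivative at each point is given by complex coefficients a, b, ...,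
   i.e. it is complex linear.  Meant for open S. *)
definition holomorphic2_on :: "(complex \<times> complex \<Rightarrow> complex) \<Rightarrow> (complex \<times> complex) set \<Rightarrow> bool"
  where "holomorphic2_on f S \<longleftrightarrow>
    (\<forall>z\<in>S. \<exists>a b. (f has_derivative (\<lambda>(h\<^sub>1, h\<^sub>2). a * h\<^sub>1 + b * h\<^sub>2)) (at z))"

definition holomorphic4_on ::
    "((complex \<times> complex) \<times> (complex \<times> complex) \<Rightarrow> complex)
      \<Rightarrow> ((complex \<times> complex) \<times> (complex \<times> complex)) set \<Rightarrow> bool"
  where "holomorphic4_on f S \<longleftrightarrow>
    (\<forall>p\<in>S. \<exists>a b c d.
      (f has_derivative (\<lambda>((h\<^sub>1, h\<^sub>2), (k\<^sub>1, k\<^sub>2)). a * h\<^sub>1 + b * h\<^sub>2 + c * k\<^sub>1 + d * k\<^sub>2)) (at p))"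

(* Positive semi-definiteness of a complex matrix A means that all values of v* A v are real
   and nonnegative; in particular A is Hermitian and has a real nonnegative diagonal. *)
definition psd_matrix_on :: "'a set \<Rightarrow> ('a \<Rightarrow> 'a \<Rightarrow> complex) \<Rightarrow> bool"
  where "psd_matrix_on F A \<longleftrightarrow>
    (\<forall>v. (\<Sum>z\<in>F. \<Sum>\<zeta>\<in>F. cnj (v z) * A z \<zeta> * v \<zeta>) \<in> \<real>\<^sub>\<ge>\<^sub>0)"

definition psd_kernel_on :: "'a set \<Rightarrow> ('a \<Rightarrow> 'a \<Rightarrow> complex) \<Rightarrow> bool"
  where "psd_kernel_on \<Omega> K \<longleftrightarrow> (\<forall>F. finite F \<and> F \<subseteq> \<Omega> \<longrightarrow> psd_matrix_on F K)"

end

theory Submission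
  imports Defs "HOL-Complex_Analysis.Great_Picard"
begin

text \<open>
  The kernels and the functions $L_j$ are constructed on the level of Taylor coefficients, first for a
  polynomial $p$ with $|p| \le 1$ on the torus, and then for $f$ by compactness.

  \<^item> \<^bold>\<open>Right kernels.\<close> Since multiplication by $p$ is a contraction on the torus, the distance
    of an analytic polynomial $h$ to a space that is adapted to half of the frequencies defines a positive
    quadratic form $A(h)$. It decreases under the backward shift in $z_1$, and under the backward shift
    in $z_2$ it changes in a controlled way. The two differences are positive semi-definite kernels
    $k_1$ and $k_2$ with
    $1 - p(z)\overline{p(\zeta)} = (1 - z_1\bar\zeta_1) k_1 + (1 - z_2\bar\zeta_2) k_2$
    (\<open>Agler_coefficient_kernels\<close>).

  \<^item> \<^bold>\<open>Left kernels and $L$.\<close> Written as an equality of Gram matrices, this identity defines an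
    isometry between spans of vectors, hence a contraction $V$. Iterating the adjoint of $V$ produces left
    vectors, whose Gram matrices $m_1, m_2$ satisfy the same identity up to a positive semi-definite
    defect $N$. The pairings $l_j$ of right and left vectors satisfy
    $p(z) - p(\zeta) = (z_1 - \zeta_1) l_1 + (z_2 - \zeta_2) l_2$, which merely expresses that $V$ and its
    adjoint are adjoint. The Cauchy--Schwarz inequality gives
    $|l_j(z,\zeta)|^2 \le k_j(z,z)\, m_j(\zeta,\zeta)$ (\<open>lurking_isometry\<close>).

  \<^item> \<^bold>\<open>Compactness.\<close> Both identities and the Cauchy--Schwarz inequality bound all these coefficients by a constant
    (\<open>diagonal_bound\<close>). So one may approximate $f$ by polynomials and pass to a subsequence along
    which every coefficient converges (\<open>Agler_data_exists\<close>). Bounded coefficients give power series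
    that converge and are holomorphic on the polydisc (\<open>gen_holomorphic\<close>).

  \<^item> \<^bold>\<open>Symmetrization.\<close> The estimate for $l_j$ involves the right kernel at one point and the left
    kernel at the other. Take for $K_j$ the mean of the right and the left kernel, where the defect, in
    the form $N / (1 - z_1\bar\zeta_1)$, is added to the left kernel for $j = 1$; and take for $L_j$ the
    mean of $l_j(z,\zeta)$ and $l_j(\zeta,z)$. Both identities are preserved, and the Cauchy--Schwarz
    inequality for the sum of the two spaces gives $|L_j(z,\zeta)|^2 \le K_j(z,z) K_j(\zeta,\zeta)$.
\<close>

section \<open>Positive semi-definite kernels\<close>

text \<open>
  The form is linear in the first vector and conjugate linear in the second, so that a kernel
  $K(z,\zeta) = \sum k_{\mu\nu} z^\mu \bar\zeta^\nu$ is the form of $k$ at the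
  vectors of monomials of $z$ and of $\zeta$.
\<close>

definition sform :: "'a set \<Rightarrow> ('a \<Rightarrow> 'a \<Rightarrow> complex) \<Rightarrow> ('a \<Rightarrow> complex) \<Rightarrow> ('a \<Rightarrow> complex) \<Rightarrow> complex"
  where "sform F K c d = (\<Sum>i\<in>F. \<Sum>j\<in>F. c i * K i j * cnj (d j))"

abbreviation psd where "psd \<equiv> psd_kernel_on UNIV"

lemma psd_kernelI:
  assumes "\<And>F c. finite F \<Longrightarrow> sform F K c c \<in> \<real>\<^sub>\<ge>\<^sub>0"
  shows "psd_kernel_on \<Omega> K"
  unfolding psd_kernel_on_def psd_matrix_on_def
proof (intro allI impI)
  fix F :: "'a set" and v :: "'a \<Rightarrow> complex" assume "finite F \<and> F \<subseteq> \<Omega>"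
  then show "(\<Sum>z\<in>F. \<Sum>\<zeta>\<in>F. cnj (v z) * K z \<zeta> * v \<zeta>) \<in> \<real>\<^sub>\<ge>\<^sub>0"
    using assms[of F "\<lambda>i. cnj (v i)"] by (simp add: sform_def)
qed

lemma psd_kernelD:
  assumes "psd_kernel_on \<Omega> K" "finite F" "F \<subseteq> \<Omega>"
  shows "sform F K c c \<in> \<real>\<^sub>\<ge>\<^sub>0"
proof -
  have "psd_matrix_on F K"
    using assms by (simp add: psd_kernel_on_def)
  then have "(\<Sum>z\<in>F. \<Sum>\<zeta>\<in>F. cnj (cnj (c z)) * K z \<zeta> * cnj (c \<zeta>)) \<in> \<real>\<^sub>\<ge>\<^sub>0"
    unfolding psd_matrix_on_def by (rule spec)
  then show ?thesis by (simp add: sform_def)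
qed

text \<open>
  Repetitions in the family cause no trouble: the weights in each fibre of the family add up.
  This makes semi-inner products of arbitrary linear combinations available without a vector
  space of combinations.
\<close>

lemma psd_family:
  fixes K :: "'a \<Rightarrow> 'a \<Rightarrow> complex"
  assumes K: "psd K" and T: "finite T"
  shows "(\<Sum>p\<in>T. \<Sum>q\<in>T. C p * K (z p) (z q) * cnj (C q)) \<in> \<real>\<^sub>\<ge>\<^sub>0"
proof -
  define D where "D x = (\<Sum>p | p \<in> T \<and> z p = x. C p)" for x
  have fib: "(\<Sum>p\<in>T. C p * g (z p)) = (\<Sum>x\<in>z ` T. D x * g x)" for g :: "'a \<Rightarrow> complex"
  proof -
    have "(\<Sum>p\<in>T. C p * g (z p)) = (\<Sum>x\<in>z ` T. \<Sum>p\<in>{p\<in>T. z p = x}. C p * g (z p))"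
      by (rule sum.image_gen[OF T, of "\<lambda>p. C p * g (z p)" z])
    also have "\<dots> = (\<Sum>x\<in>z ` T. D x * g x)"
      unfolding D_def sum_distrib_right by (intro sum.cong refl) auto
    finally show ?thesis .
  qed
  have fib': "(\<Sum>p\<in>T. g (z p) * cnj (C p)) = (\<Sum>x\<in>z ` T. g x * cnj (D x))" for g :: "'a \<Rightarrow> complex"
    using arg_cong[OF fib[of "\<lambda>x. cnj (g x)"], of cnj]
    by (simp only: cnj_sum complex_cnj_mult complex_cnj_cnj mult.commute)
  have "(\<Sum>p\<in>T. \<Sum>q\<in>T. C p * K (z p) (z q) * cnj (C q))
      = (\<Sum>p\<in>T. C p * (\<Sum>q\<in>T. K (z p) (z q) * cnj (C q)))"
    by (simp only: sum_distrib_left mult.assoc)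
  also have "\<dots> = (\<Sum>x\<in>z ` T. D x * (\<Sum>y\<in>z ` T. K x y * cnj (D y)))"
    unfolding fib' by (rule fib)
  also have "\<dots> = sform (z ` T) K D D"
    by (simp only: sform_def sum_distrib_left mult.assoc)
  finally show ?thesis using psd_kernelD[OF K, of "z ` T" D] T by simp
qed

lemma sform_sum_left:
  "sform F K (\<lambda>i. \<Sum>p\<in>T. a p * x p i) d = (\<Sum>p\<in>T. a p * sform F K (x p) d)"
proof -
  define h where "h i = (\<Sum>j\<in>F. K i j * cnj (d j))" for i
  have h: "sform F K c d = (\<Sum>i\<in>F. c i * h i)" for c
    by (simp add: sform_def h_def sum_distrib_left mult.assoc)
  have "(\<Sum>i\<in>F. (\<Sum>p\<in>T. a p * x p i) * h i) = (\<Sum>i\<in>F. \<Sum>p\<in>T. a p * (x p i * h i))"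
    by (simp only: sum_distrib_right mult.assoc)
  also have "\<dots> = (\<Sum>p\<in>T. \<Sum>i\<in>F. a p * (x p i * h i))" by (rule sum.swap)
  also have "\<dots> = (\<Sum>p\<in>T. a p * (\<Sum>i\<in>F. x p i * h i))" by (simp only: sum_distrib_left)
  finally show ?thesis unfolding h .
qed

lemma sform_sum_right:
  "sform F K c (\<lambda>i. \<Sum>p\<in>T. a p * x p i) = (\<Sum>p\<in>T. cnj (a p) * sform F K c (x p))"
proof -
  define h where "h j = (\<Sum>i\<in>F. c i * K i j)" for j
  have h: "sform F K c d = (\<Sum>j\<in>F. h j * cnj (d j))" for d
    unfolding sform_def h_def sum_distrib_right by (rule sum.swap)
  have "(\<Sum>j\<in>F. h j * cnj (\<Sum>p\<in>T. a p * x p j)) = (\<Sum>j\<in>F. \<Sum>p\<in>T. cnj (a p) * (h j * cnj (x p j)))"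
    by (simp only: cnj_sum complex_cnj_mult sum_distrib_left mult.left_commute)
  also have "\<dots> = (\<Sum>p\<in>T. \<Sum>j\<in>F. cnj (a p) * (h j * cnj (x p j)))" by (rule sum.swap)
  also have "\<dots> = (\<Sum>p\<in>T. cnj (a p) * (\<Sum>j\<in>F. h j * cnj (x p j)))" by (simp only: sum_distrib_left)
  finally show ?thesis unfolding h .
qed

lemma psd_sform:
  assumes K: "psd_kernel_on \<Omega> K" and F: "finite F" "F \<subseteq> \<Omega>"
  shows "psd (sform F K)"
proof (rule psd_kernelI)
  fix T :: "('a \<Rightarrow> complex) set" and a assume "finite T"
  have "sform T (sform F K) a a = sform F K (\<lambda>i. \<Sum>p\<in>T. a p * p i) (\<lambda>i. \<Sum>p\<in>T. a p * p i)"
    unfolding sform_sum_left sform_sum_right sform_def[of T] sum_distrib_left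
    by (simp only: mult_ac)
  then show "sform T (sform F K) a a \<in> \<real>\<^sub>\<ge>\<^sub>0" using psd_kernelD[OF K F] by simp
qed

lemma psd_diag:
  assumes K: "psd K"
  shows "K i i \<in> \<real>\<^sub>\<ge>\<^sub>0"
  using psd_kernelD[OF K, of "{i}" "\<lambda>_. 1"] by (simp add: sform_def)

lemma psd_two:
  assumes K: "psd K"
  shows "a * cnj a * K i i + a * cnj b * K i j + b * cnj a * K j i + b * cnj b * K j j \<in> \<real>\<^sub>\<ge>\<^sub>0"
  using psd_family[OF K, of "{True,False}" "\<lambda>p. if p then a else b" "\<lambda>p. if p then i else j"]
  by (simp add: algebra_simps)

lemma psd_hermitian:
  assumes K: "psd K"
  shows "K j i = cnj (K i j)"
proof -
  have 1: "K i i \<in> \<real>\<^sub>\<ge>\<^sub>0" "K j j \<in> \<real>\<^sub>\<ge>\<^sub>0" by (rule psd_diag[OF K])+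
  have 2: "Im (K i j + K j i) = 0" using psd_two[OF K, of 1 i 1 j] 1
    by (simp add: complex_nonneg_Reals_iff)
  have 3: "Im (\<i> * K i j - \<i> * K j i) = 0" using psd_two[OF K, of \<i> i 1 j] 1
    by (simp add: complex_nonneg_Reals_iff)
  show ?thesis using 2 3 by (simp add: complex_eq_iff)
qed

text \<open>
  The form of the two points at the weights $K_{jj}$ and $-K_{ij}$ is $K_{jj}$ times the difference of
  the two sides. If $K_{jj} = 0$, the weights $-t \overline{K_{ij}}$ and $1$ with a small $t > 0$ give a
  negative value unless $K_{ij} = 0$.
\<close>

lemma psd_Cauchy_Schwarz:
  assumes K: "psd K"
  shows "(cmod (K i j))\<^sup>2 \<le> Re (K i i) * Re (K j j)"
proof -
  define p where "p = Re (K i i)"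
  define r where "r = Re (K j j)"
  define b where "b = K i j"
  have p: "K i i = of_real p" "p \<ge> 0" and r: "K j j = of_real r" "r \<ge> 0"
    using psd_diag[OF K, of i] psd_diag[OF K, of j]
    by (auto simp: complex_nonneg_Reals_iff p_def r_def complex_eq_iff)
  have ji: "K j i = cnj b" using psd_hermitian[OF K] b_def by metis
  have *: "p * (cmod a)\<^sup>2 + 2 * Re (a * cnj e * b) + r * (cmod e)\<^sup>2 \<ge> 0" for a e
  proof -
    have "a * cnj a * K i i + a * cnj e * K i j + e * cnj a * K j i + e * cnj e * K j j \<in> \<real>\<^sub>\<ge>\<^sub>0"
      by (rule psd_two[OF K])
    also have "a * cnj a * K i i + a * cnj e * K i j + e * cnj a * K j i + e * cnj e * K j j
       = of_real (p * (cmod a)\<^sup>2 + r * (cmod e)\<^sup>2) + (a * cnj e * b + cnj (a * cnj e * b))"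
      by (simp add: p r ji b_def[symmetric] complex_norm_square[symmetric] mult_ac)
    finally show ?thesis by (simp add: complex_nonneg_Reals_iff algebra_simps)
  qed
  have bb: "Re (- b * cnj b) = - (cmod b)\<^sup>2"
    by (metis Re_complex_of_real complex_norm_square mult_minus_left uminus_complex.sel(1))
  show ?thesis
  proof (cases "r = 0")
    case True
    have *: "p * t\<^sup>2 * (cmod b)\<^sup>2 - 2 * t * (cmod b)\<^sup>2 \<ge> 0" if "t > 0" for t
      using *[of "- of_real t * cnj b" 1] True bb that
      by (simp add: norm_mult power_mult_distrib cmod_def power2_eq_square algebra_simps)
    define t where "t = 1 / (p + 1)"
    have t: "t > 0" "p * t < 2" using p by (auto simp: t_def field_simps)
    have "t * (cmod b)\<^sup>2 * (p * t - 2) \<ge> 0"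
      using *[OF t(1)] by (simp add: power2_eq_square algebra_simps)
    then have "\<not> t * (cmod b)\<^sup>2 > 0"
      using t mult_pos_neg[of "t * (cmod b)\<^sup>2" "p * t - 2"] by linarith
    then have "\<not> (cmod b)\<^sup>2 > 0" using t mult_pos_pos[of t "(cmod b)\<^sup>2"] by blast
    then have "(cmod b)\<^sup>2 \<le> 0" by simp
    then show ?thesis using True r_def b_def by simp
  next
    case False
    have "p * r\<^sup>2 - r * (cmod b)\<^sup>2 \<ge> 0"
      using *[of "of_real r" "- b"] bb r
      by (simp add: norm_mult power_mult_distrib cmod_def power2_eq_square algebra_simps)
    then have "r * (p * r - (cmod b)\<^sup>2) \<ge> 0" by (simp add: power2_eq_square algebra_simps)
    then have "p * r - (cmod b)\<^sup>2 \<ge> 0" using False r by (simp add: zero_le_mult_iff)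
    then show ?thesis by (simp add: p_def r_def b_def)
  qed
qed

section \<open>Orthogonal projections in a semi-inner product\<close>

text \<open>
  If $\sum_r t_{ir} y_r$ is the orthogonal projection of $i$ onto the span of the $y_r$, then $R$ is
  the Gram matrix of the residuals, $P$ that of the projections, and Pythagoras gives $K = R + P$.
\<close>

lemma residual_kernel:
  fixes K :: "'a \<Rightarrow> 'a \<Rightarrow> complex" and y :: "'b \<Rightarrow> 'a"
  assumes K: "psd K" and S: "finite S"
    and t: "\<And>i s. s \<in> S \<Longrightarrow> K i (y s) = (\<Sum>r\<in>S. t i r * K (y r) (y s))"
  defines "R \<equiv> \<lambda>i j. K i j - (\<Sum>r\<in>S. t i r * K (y r) j)"
  defines "P \<equiv> \<lambda>i j. \<Sum>r\<in>S. \<Sum>s\<in>S. t i r * K (y r) (y s) * cnj (t j s)"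
  shows "psd R" "psd P" "R i j = K i j - P i j"
proof -
  have t': "K (y s) j = (\<Sum>r\<in>S. K (y s) (y r) * cnj (t j r))" if "s \<in> S" for s j
  proof -
    have "K (y s) j = cnj (K j (y s))" by (rule psd_hermitian[OF K])
    also have "\<dots> = (\<Sum>r\<in>S. cnj (K (y r) (y s)) * cnj (t j r))"
      by (subst t[OF that]) (simp only: cnj_sum complex_cnj_mult mult.commute)
    finally show ?thesis by (simp only: psd_hermitian[OF K, symmetric])
  qed
  have RP: "R i j = K i j - P i j" for i j
  proof -
    have "t i r * K (y r) j = (\<Sum>s\<in>S. t i r * K (y r) (y s) * cnj (t j s))" if "r \<in> S" for r
      unfolding t'[OF that, of j] by (simp only: sum_distrib_left mult.assoc)
    then show ?thesis unfolding R_def P_def by (simp cong: sum.cong)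
  qed
  then show "R i j = K i j - P i j" .
  show P: "psd P"
  proof (rule psd_kernelI)
    fix F :: "'a set" and c assume F: "finite F"
    have "sform F P c c = (\<Sum>i\<in>F. \<Sum>j\<in>F. \<Sum>r\<in>S. \<Sum>s\<in>S. (c i * t i r) * K (y r) (y s) * cnj (c j * t j s))"
      unfolding sform_def P_def sum_distrib_left sum_distrib_right by (simp only: complex_cnj_mult mult_ac)
    also have "\<dots> = (\<Sum>i\<in>F. \<Sum>r\<in>S. \<Sum>j\<in>F. \<Sum>s\<in>S. (c i * t i r) * K (y r) (y s) * cnj (c j * t j s))"
      by (intro sum.cong refl sum.swap)
    also have "\<dots> = (\<Sum>p\<in>F \<times> S. \<Sum>q\<in>F \<times> S. (c (fst p) * t (fst p) (snd p)) * K (y (snd p)) (y (snd q)) * cnj (c (fst q) * t (fst q) (snd q)))"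
    proof -
      have "(\<Sum>i\<in>F. \<Sum>r\<in>S. h i r) = (\<Sum>p\<in>F \<times> S. h (fst p) (snd p))" for h :: "'a \<Rightarrow> 'b \<Rightarrow> complex"
        by (simp add: sum.cartesian_product split_def)
      then show ?thesis by simp
    qed
    also have "\<dots> \<in> \<real>\<^sub>\<ge>\<^sub>0"
      using psd_family[OF K, of "F \<times> S" "\<lambda>p. c (fst p) * t (fst p) (snd p)" "\<lambda>p. y (snd p)"] F S by simp
    finally show "sform F P c c \<in> \<real>\<^sub>\<ge>\<^sub>0" .
  qed
  show "psd R"
  proof (rule psd_kernelI)
    fix F :: "'a set" and c assume F: "finite F"
    define C where "C = case_sum c (\<lambda>r. - (\<Sum>i\<in>F. c i * t i r))"
    have 1: "(\<Sum>r\<in>S. (\<Sum>i\<in>F. c i * t i r) * K (y r) j) = (\<Sum>i\<in>F. c i * P i j)" for j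
    proof -
      have "(\<Sum>r\<in>S. (\<Sum>i\<in>F. c i * t i r) * K (y r) j) = (\<Sum>r\<in>S. \<Sum>i\<in>F. c i * (t i r * K (y r) j))"
        by (simp only: sum_distrib_right mult.assoc)
      also have "\<dots> = (\<Sum>i\<in>F. c i * (\<Sum>r\<in>S. t i r * K (y r) j))"
        unfolding sum_distrib_left by (rule sum.swap)
      finally show ?thesis using RP unfolding R_def by simp
    qed
    have 2: "(\<Sum>r\<in>S. (\<Sum>i\<in>F. c i * t i r) * K (y r) (y s)) = (\<Sum>i\<in>F. c i * K i (y s))" if "s \<in> S" for s
    proof -
      have "(\<Sum>r\<in>S. (\<Sum>i\<in>F. c i * t i r) * K (y r) (y s)) = (\<Sum>r\<in>S. \<Sum>i\<in>F. c i * (t i r * K (y r) (y s)))"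
        by (simp only: sum_distrib_right mult.assoc)
      also have "\<dots> = (\<Sum>i\<in>F. c i * (\<Sum>r\<in>S. t i r * K (y r) (y s)))"
        unfolding sum_distrib_left by (rule sum.swap)
      finally show ?thesis by (simp only: t[OF that, symmetric])
    qed
    have "(\<Sum>p\<in>F <+> S. \<Sum>q\<in>F <+> S. C p * K (case_sum id y p) (case_sum id y q) * cnj (C q))
      = (\<Sum>q\<in>F <+> S. (\<Sum>p\<in>F <+> S. C p * K (case_sum id y p) (case_sum id y q)) * cnj (C q))"
      unfolding sum_distrib_right by (rule sum.swap)
    also have "\<dots> = (\<Sum>j\<in>F. (\<Sum>i\<in>F. c i * K i j) * cnj (c j) - (\<Sum>i\<in>F. c i * P i j) * cnj (c j))"
      using F S by (simp add: sum.Plus C_def sum_negf 1 2[unfolded 1] left_diff_distrib o_def)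
    also have "\<dots> = (\<Sum>j\<in>F. \<Sum>i\<in>F. c i * R i j * cnj (c j))"
      unfolding RP by (simp only: sum_subtractf sum_distrib_right left_diff_distrib right_diff_distrib)
    also have "\<dots> = sform F R c c" unfolding sform_def by (rule sum.swap)
    finally show "sform F R c c \<in> \<real>\<^sub>\<ge>\<^sub>0"
      using psd_family[OF K, of "F <+> S" C "case_sum id y"] F S by simp
  qed
qed

text \<open>
  Gram--Schmidt, one vector at a time. The residual of the new vector $y_a$ may have norm $0$; then
  the Cauchy--Schwarz inequality for the residual kernel shows that it is orthogonal to everything,
  and the coefficient $u_i = 0$, which the convention for division by zero supplies, is correct.
\<close>

lemma projection_exists:
  fixes K :: "'a \<Rightarrow> 'a \<Rightarrow> complex" and y :: "'b \<Rightarrow> 'a"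
  assumes K: "psd K" and S: "finite S"
  shows "\<exists>t. \<forall>i. \<forall>s\<in>S. K i (y s) = (\<Sum>r\<in>S. t i r * K (y r) (y s))"
  using S
proof (induction S)
  case empty
  then show ?case by simp
next
  case (insert a S)
  then obtain t where t: "\<And>i s. s \<in> S \<Longrightarrow> K i (y s) = (\<Sum>r\<in>S. t i r * K (y r) (y s))" by blast
  define R where "R i j = K i j - (\<Sum>r\<in>S. t i r * K (y r) j)" for i j
  have psdR: "psd R"
    using residual_kernel(1)[OF K insert(1) t] unfolding R_def by blast
  have R0: "R i (y a) = 0" if "R (y a) (y a) = 0" for i
    using psd_Cauchy_Schwarz[OF psdR, of i "y a"] that by simp
  define u where "u i = R i (y a) / R (y a) (y a)" for i
  have u: "u i * R (y a) (y a) = R i (y a)" for i using R0 by (auto simp: u_def)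
  define t' where "t' i r = (if r = a then u i else t i r - u i * t (y a) r)" for i r
  have "K i (y s) = (\<Sum>r\<in>insert a S. t' i r * K (y r) (y s))" if "s \<in> insert a S" for i s
  proof -
    have "(\<Sum>r\<in>insert a S. t' i r * K (y r) (y s)) = u i * K (y a) (y s) + (\<Sum>r\<in>S. (t i r - u i * t (y a) r) * K (y r) (y s))"
      using insert by (auto simp: t'_def intro!: sum.cong)
    also have "\<dots> = u i * (K (y a) (y s) - (\<Sum>r\<in>S. t (y a) r * K (y r) (y s))) + (\<Sum>r\<in>S. t i r * K (y r) (y s))"
      by (simp only: left_diff_distrib right_diff_distrib sum_subtractf sum_distrib_left mult.assoc) simp
    also have "\<dots> = K i (y s)"
    proof (cases "s = a")
      case True
      then show ?thesis using u[of i] by (simp add: R_def)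
    next
      case False
      then show ?thesis using that by (simp add: t[symmetric])
    qed
    finally show ?thesis by (rule sym)
  qed
  then show ?case by blast
qed

section \<open>Minimizing a semi-definite form over a coordinate subspace\<close>

lemma psd_kernel_limit:
  assumes psd: "\<And>n. psd_kernel_on \<Omega> (R n)"
    and lim: "\<And>i j. i \<in> \<Omega> \<Longrightarrow> j \<in> \<Omega> \<Longrightarrow> (\<lambda>n::nat. R n i j) \<longlonglongrightarrow> A i j"
  shows "psd_kernel_on \<Omega> A"
  unfolding psd_kernel_on_def psd_matrix_on_def
proof (intro allI impI)
  fix F v assume F: "finite F \<and> F \<subseteq> \<Omega>"
  have l: "(\<lambda>n. \<Sum>z\<in>F. \<Sum>\<zeta>\<in>F. cnj (v z) * R n z \<zeta> * v \<zeta>) \<longlonglongrightarrow> (\<Sum>z\<in>F. \<Sum>\<zeta>\<in>F. cnj (v z) * A z \<zeta> * v \<zeta>)"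
    using F by (intro tendsto_intros lim) auto
  have m: "(\<Sum>z\<in>F. \<Sum>\<zeta>\<in>F. cnj (v z) * R n z \<zeta> * v \<zeta>) \<in> \<real>\<^sub>\<ge>\<^sub>0" for n
    using psd[of n] F by (simp add: psd_kernel_on_def psd_matrix_on_def)
  show "(\<Sum>z\<in>F. \<Sum>\<zeta>\<in>F. cnj (v z) * A z \<zeta> * v \<zeta>) \<in> \<real>\<^sub>\<ge>\<^sub>0"
    by (rule closed_sequentially[OF closed_nonneg_Reals_complex m l])
qed

lemma sform_superset:
  assumes "finite G" "F \<subseteq> G"
    and "\<And>i j. i \<in> G \<Longrightarrow> j \<in> G \<Longrightarrow> i \<notin> F \<or> j \<notin> F \<Longrightarrow> c i * K i j * cnj (d j) = 0"
  shows "sform G K c d = sform F K c d"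
proof -
  have "sform G K c d = (\<Sum>p\<in>G \<times> G. c (fst p) * K (fst p) (snd p) * cnj (d (snd p)))"
    by (simp add: sform_def sum.cartesian_product split_def)
  also have "\<dots> = (\<Sum>p\<in>F \<times> F. c (fst p) * K (fst p) (snd p) * cnj (d (snd p)))"
  proof (rule sum.mono_neutral_right)
    show "\<forall>p\<in>G \<times> G - F \<times> F. c (fst p) * K (fst p) (snd p) * cnj (d (snd p)) = 0"
      by (intro ballI assms(3)) auto
  qed (use assms in auto)
  also have "\<dots> = sform F K c d"
    by (simp add: sform_def sum.cartesian_product split_def)
  finally show ?thesis .
qed

lemma sform_cong:
  assumes "\<And>i j. i \<in> F \<Longrightarrow> j \<in> F \<Longrightarrow> c i * K i j * cnj (d j) = c' i * K' i j * cnj (d' j)"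
  shows "sform F K c d = sform F K' c' d'"
  unfolding sform_def using assms by (intro sum.cong refl) auto

lemma sform_diff: "sform F (\<lambda>i j. K i j - P i j) c d = sform F K c d - sform F P c d"
  by (simp only: sform_def right_diff_distrib left_diff_distrib sum_subtractf)

lemma psd_Re_nonneg: "psd K \<Longrightarrow> finite F \<Longrightarrow> 0 \<le> Re (sform F K c c)"
  using psd_kernelD[of UNIV K F c] by (simp add: complex_nonneg_Reals_iff)

text \<open>
  The infimum of the form of $K$ over all modifications of a vector in the coordinates of $S$ is again
  the form of a kernel. For a finite part of $S$ it is the form of the residual kernel, where the
  projection is the minimizer. As the finite parts grow these kernels stay bounded by the diagonal of
  $K$, so a subsequence converges entrywise, and its limit represents the infimum over all of $S$.
\<close>

lemma shorted_kernel:
  fixes K :: "'i::countable \<Rightarrow> 'i \<Rightarrow> complex"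
  assumes K: "psd K" and diag: "\<And>i. Re (K i i) \<le> 1"
  obtains A where "psd A"
    and "\<And>F G c d. \<lbrakk>finite G; F \<subseteq> G; G - F \<subseteq> S; \<And>i. i \<in> F \<Longrightarrow> d i = c i\<rbrakk>
           \<Longrightarrow> Re (sform F A c c) \<le> Re (sform G K d d)"
    and "\<And>F c e. \<lbrakk>finite F; F \<inter> S = {}; e > 0\<rbrakk> \<Longrightarrow> \<exists>G d. finite G \<and> F \<subseteq> G \<and> G - F \<subseteq> S \<and>
           (\<forall>i\<in>F. d i = c i) \<and> Re (sform G K d d) \<le> Re (sform F A c c) + e"
proof -
  define T where "T n = {s \<in> S. to_nat s < n}" for n
  have finT: "finite (T n)" for n
    unfolding T_def by (rule finite_subset[OF _ finite_vimageI[of "{..<n}" to_nat]]) auto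
  have "\<exists>t. \<forall>i. \<forall>s\<in>T n. K i s = (\<Sum>r\<in>T n. t i r * K r s)" for n
    using projection_exists[OF K finT, of n "\<lambda>s. s"] by simp
  then obtain t where t: "\<And>n i s. s \<in> T n \<Longrightarrow> K i s = (\<Sum>r\<in>T n. t n i r * K r s)"
    by metis
  define R where "R n i j = K i j - (\<Sum>r\<in>T n. t n i r * K r j)" for n i j
  define P where "P n i j = (\<Sum>r\<in>T n. \<Sum>s\<in>T n. t n i r * K r s * cnj (t n j s))" for n i j
  note res = residual_kernel[OF K finT, of _ "\<lambda>s. s", OF t, folded R_def P_def]
  have R: "psd (R n)" for n
    using res(1)[of n] by (simp add: R_def[abs_def])
  have P: "psd (P n)" for n
    using res(2)[of n] by (simp add: P_def[abs_def])
  have RP: "R n i j = K i j - P n i j" for n i j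
    using res(3)[of n] by simp
  have R0: "R n i s = 0" if "s \<in> T n" for n i s
    unfolding R_def by (subst t[OF that]) simp
  have R0': "R n s i = 0" if "s \<in> T n" for n i s
    using psd_hermitian[OF R, of n s i] R0[OF that] by simp
  have bound: "norm (R n i j) \<le> 1" for n i j
  proof -
    have d: "0 \<le> Re (R n i i)" "Re (R n i i) \<le> 1" for i
      using psd_diag[OF R, of n i] psd_diag[OF P, of n i] diag[of i] RP[of n i i]
      by (auto simp: complex_nonneg_Reals_iff)
    have "(cmod (R n i j))\<^sup>2 \<le> Re (R n i i) * Re (R n j j)" by (rule psd_Cauchy_Schwarz[OF R])
    also have "\<dots> \<le> 1 * 1" using d by (intro mult_mono) auto
    finally show ?thesis by (simp add: power2_le_iff_abs_le abs_square_le_1)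
  qed
  obtain k where k: "strict_mono (k::nat\<Rightarrow>nat)"
    and lim: "\<And>x. \<exists>l. (\<lambda>n. R (k n) (fst x) (snd x)) \<longlonglongrightarrow> l"
    using function_convergent_subsequence[of UNIV "\<lambda>n x. R n (fst x) (snd x)" 1] bound by auto
  define A where "A i j = (SOME l. (\<lambda>n. R (k n) i j) \<longlonglongrightarrow> l)" for i j
  have A: "(\<lambda>n. R (k n) i j) \<longlonglongrightarrow> A i j" for i j
  proof -
    have "\<exists>l. (\<lambda>n. R (k n) i j) \<longlonglongrightarrow> l" using lim[of "(i,j)"] by simp
    then show ?thesis unfolding A_def by (rule someI_ex)
  qed
  have limA: "(\<lambda>n. Re (sform F (R (k n)) c c)) \<longlonglongrightarrow> Re (sform F A c c)" for F c
    unfolding sform_def by (intro tendsto_intros A)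
  show thesis
  proof
    show "psd A" by (rule psd_kernel_limit[OF R A])
  next
    fix F G :: "'i set" and c d :: "'i \<Rightarrow> complex"
    assume G: "finite G" "F \<subseteq> G" "G - F \<subseteq> S" "\<And>i. i \<in> F \<Longrightarrow> d i = c i"
    obtain N where N: "\<And>i. i \<in> G \<Longrightarrow> to_nat i < N"
      using finite_nat_set_iff_bounded[of "to_nat ` G"] G(1) by auto
    have "Re (sform F (R n) c c) \<le> Re (sform G K d d)" if "n \<ge> N" for n
    proof -
      have sub: "G - F \<subseteq> T n" using G(3) N that by (force simp: T_def)
      have "sform F (R n) c c = sform F (R n) d d"
        using G(4) by (intro sform_cong) auto
      also have "\<dots> = sform G (R n) d d"
        using G sub R0 R0' by (intro sform_superset[symmetric]) auto
      also have "Re \<dots> = Re (sform G K d d) - Re (sform G (P n) d d)"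
        using sform_diff[of G K "P n"] RP[of n, abs_def] by (simp add: RP[abs_def] fun_eq_iff cong: sform_cong)
      also have "\<dots> \<le> Re (sform G K d d)" using psd_Re_nonneg[OF P G(1)] by simp
      finally show ?thesis .
    qed
    then have "\<forall>n\<ge>N. Re (sform F (R (k n)) c c) \<le> Re (sform G K d d)"
      using seq_suble[OF k] le_trans by blast
    then show "Re (sform F A c c) \<le> Re (sform G K d d)"
      using LIMSEQ_le_const2[OF limA] by blast
  next
    fix F :: "'i set" and c :: "'i \<Rightarrow> complex" and e :: real
    assume F: "finite F" "F \<inter> S = {}" and e: "e > 0"
    obtain m where "\<bar>Re (sform F (R (k m)) c c) - Re (sform F A c c)\<bar> < e"
      using limA[of F c] e unfolding LIMSEQ_iff by (auto simp: dist_real_def)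
    then have "Re (sform F (R (k m)) c c) \<le> Re (sform F A c c) + e" by linarith
    then obtain n where n: "Re (sform F (R n) c c) \<le> Re (sform F A c c) + e" by blast
    define d where "d i = (if i \<in> F then c i else - (\<Sum>p\<in>F. c p * t n p i))" for i
    define G where "G = F \<union> T n"
    have disj: "F \<inter> T n = {}" using F(2) by (auto simp: T_def)
    have "(\<Sum>i\<in>G. d i * P n i j) = 0" for j
    proof -
      have "(\<Sum>i\<in>G. d i * P n i j) = (\<Sum>i\<in>F. c i * P n i j) + (\<Sum>r\<in>T n. - (\<Sum>p\<in>F. c p * t n p r) * P n r j)"
        unfolding G_def using F(1) finT disj
        by (subst sum.union_disjoint) (auto simp: d_def intro!: arg_cong2[of _ _ _ _ "(+)"] sum.cong)
      also have "(\<Sum>r\<in>T n. - (\<Sum>p\<in>F. c p * t n p r) * P n r j) = - (\<Sum>r\<in>T n. \<Sum>p\<in>F. c p * (t n p r * K r j))"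
      proof -
        have "P n r j = K r j" if "r \<in> T n" for r using RP[of n r j] R0'[OF that] by simp
        then show ?thesis by (simp add: sum_negf sum_distrib_right mult.assoc)
      qed
      also have "(\<Sum>r\<in>T n. \<Sum>p\<in>F. c p * (t n p r * K r j)) = (\<Sum>p\<in>F. c p * (\<Sum>r\<in>T n. t n p r * K r j))"
        unfolding sum_distrib_left by (rule sum.swap)
      also have "(\<lambda>p. \<Sum>r\<in>T n. t n p r * K r j) = (\<lambda>p. P n p j)"
        using RP[of n _ j] by (simp add: R_def fun_eq_iff)
      finally show ?thesis by simp
    qed
    then have "sform G (P n) d d = 0"
      unfolding sform_def by (subst sum.swap) (simp add: sum_distrib_right[symmetric])
    then have "sform G K d d = sform G (R n) d d"
      using sform_diff[of G K "P n"] by (simp add: RP[abs_def])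
    also have "\<dots> = sform F (R n) d d"
      using F finT R0 R0' by (intro sform_superset) (auto simp: G_def)
    also have "\<dots> = sform F (R n) c c" by (intro sform_cong) (auto simp: d_def)
    finally have "Re (sform G K d d) \<le> Re (sform F A c c) + e" using n by simp
    moreover have "finite G" "F \<subseteq> G" "G - F \<subseteq> S" "\<forall>i\<in>F. d i = c i"
      using F finT by (auto simp: G_def d_def T_def)
    ultimately show "\<exists>G d. finite G \<and> F \<subseteq> G \<and> G - F \<subseteq> S \<and>
           (\<forall>i\<in>F. d i = c i) \<and> Re (sform G K d d) \<le> Re (sform F A c c) + e" by blast
  qed
qed

section \<open>The block kernel of a polynomial bounded by one on the torus\<close>

text \<open>
  The Gram matrix of the functions $\bar z^{\mu} \oplus 0$ (marked False) and
  $\bar p \bar z^{\xi} \oplus \sqrt{1 - |p|^2}\, \bar z^{\xi}$ (marked True) on the torus, where $p$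
  has the coefficients $f$. Both families are orthonormal, and a mixed entry is a coefficient of $p$.
\<close>

definition block_kernel :: "(int \<times> int \<Rightarrow> complex) \<Rightarrow> bool \<times> int \<times> int \<Rightarrow> bool \<times> int \<times> int \<Rightarrow> complex"
  where "block_kernel f p q = (if fst p = fst q then of_bool (snd p = snd q)
     else if fst q then f (snd p - snd q) else cnj (f (snd q - snd p)))"

text \<open>
  Discrete orthogonality of characters: finite sums over roots of unity replace integrals over the torus,
  exactly as long as the frequencies involved are smaller than the number of roots.
\<close>

lemma sum_cis_eq_0:
  assumes "a \<noteq> 0" "\<bar>a\<bar> < int M"
  shows "(\<Sum>j<M. cis (2 * pi * of_int a * real j / real M)) = 0"
proof -
  define w where "w = cis (2 * pi * of_int a / real M)"
  have M: "M > 0" using assms by linarith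
  have "w ^ M = cis (real M * (2 * pi * of_int a / real M))"
    unfolding w_def by (rule Complex.DeMoivre)
  also have "real M * (2 * pi * of_int a / real M) = 2 * pi * of_int a" using M by simp
  finally have wM: "w ^ M = 1" by simp
  have "w \<noteq> 1"
  proof
    assume "w = 1"
    then have "cos (2 * pi * of_int a / real M) = 1" by (simp add: w_def complex_eq_iff)
    then obtain n :: int where "2 * pi * of_int a / real M = of_int n * 2 * pi"
      by (auto simp: cos_one_2pi_int)
    then have "real_of_int a = of_int (n * int M)" using M by (simp add: field_simps)
    then have "a = n * int M" by (simp only: of_int_eq_iff)
    then have "\<bar>a\<bar> \<ge> int M" using assms(1) by (auto simp: abs_mult mult_le_cancel_right1)
    then show False using assms by simp
  qed
  moreover have "(\<Sum>j<M. cis (2 * pi * of_int a * real j / real M)) = (\<Sum>j<M. w ^ j)"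
    by (simp add: w_def Complex.DeMoivre mult_ac)
  ultimately show ?thesis using wM by (simp add: geometric_sum)
qed

text \<open>
  This is the only place where the bound on the polynomial enters: it makes $\sqrt{1-|p|^2}$ real, and
  the matrix of any finite set of indices is a Gram matrix of vectors of samples at $M$-th roots of
  unity for a large $M$.
\<close>

lemma block_kernel_psd:
  fixes f :: "int \<times> int \<Rightarrow> complex"
  assumes fin: "finite \<Gamma>" and supp: "\<And>\<xi>. \<xi> \<notin> \<Gamma> \<Longrightarrow> f \<xi> = 0"
    and bd: "\<And>u v. cmod u = 1 \<Longrightarrow> cmod v = 1 \<Longrightarrow>
               cmod (\<Sum>\<xi>\<in>\<Gamma>. f \<xi> * (u powi fst \<xi> * v powi snd \<xi>)) \<le> 1"
  shows "psd (block_kernel f)"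
proof (rule psd_kernelI)
  fix F :: "(bool \<times> int \<times> int) set" and c assume F: "finite F"
  define X where "X = fst ` snd ` F \<union> snd ` snd ` F \<union> fst ` \<Gamma> \<union> snd ` \<Gamma>"
  have X: "finite X" using F fin by (auto simp: X_def)
  from X have le_Max: "\<bar>x\<bar> \<le> Max (abs ` X)" if "x \<in> X" for x using that by simp
  define m where "m = Max (abs ` X) + 1"
  have m: "\<bar>x\<bar> < m" if "x \<in> X" for x using le_Max[OF that] by (simp add: m_def)
  \<comment> \<open>With all exponents below m in modulus, every frequency that occurs is below 3m, hence below M.\<close>
  define M where "M = nat (4 * \<bar>m\<bar>) + 1"
  define E where "E \<xi> s = cis (2 * pi * of_int (fst \<xi>) * real (fst s) / real M)
                 * cis (2 * pi * of_int (snd \<xi>) * real (snd s) / real M)" for \<xi> :: "int \<times> int" and s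
  define I where "I = {..<M} \<times> {..<M}"
  have E_add: "E (\<mu> + \<nu>) s = E \<mu> s * E \<nu> s" for \<mu> \<nu> s
    by (simp add: E_def cis_mult algebra_simps add_divide_distrib)
  have E_cnj: "cnj (E \<mu> s) = E (- \<mu>) s" for \<mu> s by (simp add: E_def cis_cnj)
  have E_one: "E \<mu> s * E (- \<mu>) s = 1" for \<mu> s by (simp add: E_add[symmetric]) (simp add: E_def)
  have orth: "(\<Sum>s\<in>I. E \<xi> s) = of_bool (\<xi> = 0) * of_nat (M * M)"
    if "\<bar>fst \<xi>\<bar> < int M" "\<bar>snd \<xi>\<bar> < int M" for \<xi>
  proof -
    have "(\<Sum>s\<in>I. E \<xi> s) = (\<Sum>j<M. cis (2 * pi * of_int (fst \<xi>) * real j / real M))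
          * (\<Sum>k<M. cis (2 * pi * of_int (snd \<xi>) * real k / real M))"
      unfolding I_def E_def sum_product sum.cartesian_product by (simp add: split_def)
    then show ?thesis using that sum_cis_eq_0[of "fst \<xi>" M] sum_cis_eq_0[of "snd \<xi>" M]
      by (cases "fst \<xi> = 0"; cases "snd \<xi> = 0") (auto simp: prod_eq_iff)
  qed
  define \<phi> where "\<phi> s = (\<Sum>\<xi>\<in>\<Gamma>. f \<xi> * E \<xi> s)" for s
  have \<phi>: "cmod (\<phi> s) \<le> 1" for s
  proof -
    have "E \<xi> s = cis (2 * pi * real (fst s) / real M) powi fst \<xi> * cis (2 * pi * real (snd s) / real M) powi snd \<xi>" for \<xi>
      by (simp add: E_def cis_power_int mult_ac)
    then show ?thesis unfolding \<phi>_def using bd by simp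
  qed
  define \<rho> where "\<rho> s = complex_of_real (sqrt (1 - (cmod (\<phi> s))\<^sup>2))" for s
  have \<rho>: "\<phi> s * cnj (\<phi> s) + \<rho> s * cnj (\<rho> s) = 1" for s
  proof -
    have "(cmod (\<phi> s))\<^sup>2 \<le> 1" using \<phi>[of s] by (simp add: abs_square_le_1)
    then have "\<rho> s * cnj (\<rho> s) = of_real (1 - (cmod (\<phi> s))\<^sup>2)"
      by (simp add: \<rho>_def flip: of_real_mult)
    then show ?thesis by (simp only: complex_norm_square[symmetric]) simp
  qed
  define V where "V p s = (if fst p then cnj (\<phi> s) else 1) * E (- snd p) s" for p s
  define W where "W p s = (if fst p then \<rho> s else 0) * E (- snd p) s" for p s
  have shift: "(\<Sum>s\<in>I. \<phi> s * E (\<nu> - \<mu>) s) = f (\<mu> - \<nu>) * of_nat (M * M)"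
    if "p \<in> F" "q \<in> F" "\<mu> = snd p" "\<nu> = snd q" for p q \<mu> \<nu>
  proof -
    have "(\<Sum>s\<in>I. \<phi> s * E (\<nu> - \<mu>) s) = (\<Sum>\<xi>\<in>\<Gamma>. f \<xi> * (\<Sum>s\<in>I. E (\<xi> + (\<nu> - \<mu>)) s))"
      unfolding \<phi>_def E_add sum_distrib_right sum_distrib_left mult.assoc by (rule sum.swap)
    also have "\<dots> = (\<Sum>\<xi>\<in>\<Gamma>. f \<xi> * (of_bool (\<xi> = \<mu> - \<nu>) * of_nat (M * M)))"
    proof (intro sum.cong refl arg_cong2[of _ _ _ _ "(*)"])
      fix \<xi> assume g: "\<xi> \<in> \<Gamma>"
      have "{fst \<xi>, snd \<xi>, fst \<mu>, snd \<mu>, fst \<nu>, snd \<nu>} \<subseteq> X" using g that by (auto simp: X_def)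
      then have "\<bar>fst (\<xi> + (\<nu> - \<mu>))\<bar> < int M" "\<bar>snd (\<xi> + (\<nu> - \<mu>))\<bar> < int M"
        using m[of "fst \<xi>"] m[of "fst \<mu>"] m[of "fst \<nu>"] m[of "snd \<xi>"] m[of "snd \<mu>"] m[of "snd \<nu>"]
        by (auto simp: M_def)
      then show "(\<Sum>s\<in>I. E (\<xi> + (\<nu> - \<mu>)) s) = of_bool (\<xi> = \<mu> - \<nu>) * of_nat (M * M)"
        by (subst orth) (auto simp: algebra_simps eq_neg_iff_add_eq_0 prod_eq_iff)
    qed
    also have "\<dots> = f (\<mu> - \<nu>) * of_nat (M * M)"
      using fin supp[of "\<mu> - \<nu>"] by (cases "\<mu> - \<nu> \<in> \<Gamma>") (auto simp: of_bool_def if_distrib if_distribR cong: if_cong)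
    finally show ?thesis .
  qed
  have VV: "V p s * cnj (V q s) = (if fst p then cnj (\<phi> s) else 1) * (if fst q then \<phi> s else 1) * E (snd q - snd p) s"
     and WW: "W p s * cnj (W q s) = (if fst p \<and> fst q then \<rho> s * cnj (\<rho> s) else 0) * E (snd q - snd p) s" for p q s
    using E_add[of "snd q" "- snd p" s] by (auto simp: V_def W_def E_cnj mult_ac)
  have gram: "(\<Sum>s\<in>I. V p s * cnj (V q s) + W p s * cnj (W q s)) = block_kernel f p q * of_nat (M * M)"
    if pq: "p \<in> F" "q \<in> F" for p q
  proof -
    have sm: "\<bar>fst (snd q - snd p)\<bar> < int M" "\<bar>snd (snd q - snd p)\<bar> < int M"
    proof -
      have "{fst (snd p), snd (snd p), fst (snd q), snd (snd q)} \<subseteq> X" using pq by (auto simp: X_def)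
      then show "\<bar>fst (snd q - snd p)\<bar> < int M" "\<bar>snd (snd q - snd p)\<bar> < int M"
        using m[of "fst (snd p)"] m[of "snd (snd p)"] m[of "fst (snd q)"] m[of "snd (snd q)"] by (auto simp: M_def)
    qed
    consider "fst p = fst q" | "\<not> fst p" "fst q" | "fst p" "\<not> fst q" by blast
    then show ?thesis
    proof cases
      case 1
      then have "V p s * cnj (V q s) + W p s * cnj (W q s) = E (snd q - snd p) s" for s
        unfolding VV WW distrib_right[symmetric] using \<rho>[of s]
        by (cases "fst q") (auto simp: mult.commute)
      then show ?thesis using 1 orth[OF sm] by (auto simp: block_kernel_def)
    next
      case 2
      then show ?thesis unfolding VV WW using shift[OF pq refl refl] by (simp add: block_kernel_def)
    next
      case 3
      have "(\<Sum>s\<in>I. cnj (\<phi> s) * E (snd q - snd p) s) = cnj (\<Sum>s\<in>I. \<phi> s * E (snd p - snd q) s)"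
        by (simp add: E_cnj)
      then show ?thesis unfolding VV WW using 3 shift[OF pq(2,1) refl refl] by (simp add: block_kernel_def)
    qed
  qed
  have M: "M > 0" by (simp add: M_def)
  have "sform F (block_kernel f) c c * of_nat (M * M)
      = (\<Sum>p\<in>F. \<Sum>q\<in>F. c p * (\<Sum>s\<in>I. V p s * cnj (V q s) + W p s * cnj (W q s)) * cnj (c q))"
    unfolding sform_def sum_distrib_right by (intro sum.cong refl) (simp add: gram)
  also have "\<dots> = (\<Sum>p\<in>F. \<Sum>q\<in>F. \<Sum>s\<in>I. c p * (V p s * cnj (V q s) + W p s * cnj (W q s)) * cnj (c q))"
    by (simp only: sum_distrib_left sum_distrib_right)
  also have "\<dots> = (\<Sum>p\<in>F. \<Sum>s\<in>I. \<Sum>q\<in>F. c p * (V p s * cnj (V q s) + W p s * cnj (W q s)) * cnj (c q))"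
    by (intro sum.cong refl sum.swap)
  also have "\<dots> = (\<Sum>s\<in>I. \<Sum>p\<in>F. \<Sum>q\<in>F. c p * (V p s * cnj (V q s) + W p s * cnj (W q s)) * cnj (c q))"
    by (rule sum.swap)
  also have "\<dots> = (\<Sum>s\<in>I. (\<Sum>p\<in>F. c p * V p s) * cnj (\<Sum>p\<in>F. c p * V p s)
                         + (\<Sum>p\<in>F. c p * W p s) * cnj (\<Sum>p\<in>F. c p * W p s))"
    unfolding cnj_sum sum_product complex_cnj_mult sum.distrib[symmetric]
    by (intro sum.cong refl) (simp add: algebra_simps)
  also have "\<dots> = of_real (\<Sum>s\<in>I. (cmod (\<Sum>p\<in>F. c p * V p s))\<^sup>2 + (cmod (\<Sum>p\<in>F. c p * W p s))\<^sup>2)"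
    by (simp only: complex_norm_square[symmetric]) simp
  finally have *: "sform F (block_kernel f) c c * of_nat (M * M)
     = of_real (\<Sum>s\<in>I. (cmod (\<Sum>p\<in>F. c p * V p s))\<^sup>2 + (cmod (\<Sum>p\<in>F. c p * W p s))\<^sup>2)" .
  have **: "sform F (block_kernel f) c c = of_real ((\<Sum>s\<in>I. (cmod (\<Sum>p\<in>F. c p * V p s))\<^sup>2 + (cmod (\<Sum>p\<in>F. c p * W p s))\<^sup>2) / real (M * M))"
    unfolding of_real_divide *[symmetric] using M by simp
  show "sform F (block_kernel f) c c \<in> \<real>\<^sub>\<ge>\<^sub>0"
    unfolding ** nonneg_Reals_of_real_iff by (intro divide_nonneg_nonneg sum_nonneg add_nonneg_nonneg) auto
qed

section \<open>Agler kernels of a polynomial\<close>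

type_synonym idx = "int \<times> int"

text \<open>
  Exponents range over all of $\mathbb{Z}^2$, with coefficients that vanish outside the quadrant, so that
  multiplying a power series by a variable is a translation of its coefficients without case distinctions.
\<close>

abbreviation e1 :: idx where "e1 \<equiv> (1, 0)"
abbreviation e2 :: idx where "e2 \<equiv> (0, 1)"

abbreviation delta :: "idx \<Rightarrow> idx \<Rightarrow> complex" where "delta \<mu> \<nu> \<equiv> of_bool (\<mu> = 0 \<and> \<nu> = 0)"
abbreviation diag_diff where "diag_diff e k \<mu> \<nu> \<equiv> k \<mu> \<nu> - k (\<mu> - e) (\<nu> - e)"
abbreviation cross_diff where "cross_diff e l \<mu> \<nu> \<equiv> l (\<mu> - e) \<nu> - l \<mu> (\<nu> - e)"

definition quadrant :: "idx set" where "quadrant = {\<mu>. 0 \<le> fst \<mu> \<and> 0 \<le> snd \<mu>}"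

lemma sform_reindex:
  assumes "inj_on h F"
  shows "sform (h ` F) K c d = sform F (\<lambda>i j. K (h i) (h j)) (\<lambda>i. c (h i)) (\<lambda>i. d (h i))"
  by (simp add: sform_def sum.reindex[OF assms])

lemma sum_of_bool_delta:
  fixes g :: "'a \<Rightarrow> complex"
  assumes "finite A"
  shows "(\<Sum>j\<in>A. a * of_bool (i = j) * g j) = (if i \<in> A then a * g i else 0)"
proof -
  have "(\<Sum>j\<in>A. a * of_bool (i = j) * g j) = (\<Sum>j\<in>A. if i = j then a * g i else 0)"
    by (intro sum.cong) auto
  then show ?thesis using assms by simp
qed

lemma sform_union:
  assumes K: "psd K" and XY: "finite X" "finite Y" "X \<inter> Y = {}"
  shows "Re (sform (X \<union> Y) K d d) = Re (sform X K d d) + Re (sform Y K d d)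
           + 2 * Re (\<Sum>i\<in>X. \<Sum>j\<in>Y. d i * K i j * cnj (d j))"
proof -
  have "(\<Sum>j\<in>Y. \<Sum>i\<in>X. d j * K j i * cnj (d i)) = (\<Sum>i\<in>X. \<Sum>j\<in>Y. d j * K j i * cnj (d i))"
    by (rule sum.swap)
  also have "\<dots> = cnj (\<Sum>i\<in>X. \<Sum>j\<in>Y. d i * K i j * cnj (d j))"
    unfolding cnj_sum by (intro sum.cong refl) (simp add: psd_hermitian[OF K, symmetric])
  finally have "(\<Sum>j\<in>Y. \<Sum>i\<in>X. d j * K j i * cnj (d i)) = cnj (\<Sum>i\<in>X. \<Sum>j\<in>Y. d i * K i j * cnj (d j))" .
  then have "Re (\<Sum>j\<in>Y. \<Sum>i\<in>X. d j * K j i * cnj (d i)) = Re (\<Sum>i\<in>X. \<Sum>j\<in>Y. d i * K i j * cnj (d j))"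
    by (simp only: cnj.sel)
  then show ?thesis
    by (simp only: sform_def sum.union_disjoint[OF XY] sum.distrib plus_complex.sel)
qed

lemma sform_quadrant:
  assumes "finite F"
  shows "sform F (\<lambda>\<mu> \<nu>. if \<mu> \<in> quadrant \<and> \<nu> \<in> quadrant then A (False, \<mu>) (False, \<nu>) else 0) c d
       = sform (Pair False ` (F \<inter> quadrant)) A (\<lambda>p. c (snd p)) (\<lambda>p. d (snd p))"
proof -
  have "sform F (\<lambda>\<mu> \<nu>. if \<mu> \<in> quadrant \<and> \<nu> \<in> quadrant then A (False, \<mu>) (False, \<nu>) else 0) c d
     = sform (F \<inter> quadrant) (\<lambda>\<mu> \<nu>. if \<mu> \<in> quadrant \<and> \<nu> \<in> quadrant then A (False, \<mu>) (False, \<nu>) else 0) c d"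
    using assms by (intro sform_superset) auto
  also have "\<dots> = sform (F \<inter> quadrant) (\<lambda>\<mu> \<nu>. A (False, \<mu>) (False, \<nu>)) c d"
    by (intro sform_cong) auto
  finally show ?thesis by (subst sform_reindex) (auto simp: inj_on_def)
qed

text \<open>
  The block kernel is a Gram matrix. Let $A(h)$ be the squared distance of a combination $h$ of the vectors
  marked False with exponents in the quadrant to the span $S$ of the vectors marked True with
  $\xi_2 \ge 0$ and of those marked False with $\mu_1 < 0 \le \mu_2$.

  Let $h'$ be the backward shift of $h$ in the first exponent. Lowering all first exponents by one is
  isometric, carries $S$ into itself, and carries $h$ to $h'$ up to an element of $S$. Hence
  $A(h') \le A(h)$, that is, $k_2 = A - A(\cdot - e_1)$ is positive semi-definite.

  Let now $h'$ be the backward shift in the second exponent. From an approximation of $h'$ one obtains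
  one of $h$ by raising all second exponents by one and adding a combination of the vectors marked True
  with $\xi_2 = 0$. The latter are orthonormal, and orthogonal to all other vectors in use except $h$,
  because $f$ vanishes outside the quadrant. The optimal combination gives $A(h) \le A(h') + D(h)$. Here
  $D(h) = \|h_0\|^2 - \sum_n |s_n|^2$, where $h_0$ is the part of $h$ with second exponent $0$, and
  $s_n$ is the product of $h$ with the vector marked True at $(n, 0)$. Hence
  $k_1 = D - (A - A(\cdot - e_2))$ is positive semi-definite.

  In the combination of $k_1$ and $k_2$ on the right-hand side the kernel $A$ cancels, and the sum over
  $n$ in $D$ telescopes to the single term $f_\mu \bar f_\nu$.
\<close>

lemma Agler_coefficient_kernels:
  fixes f :: "idx \<Rightarrow> complex"
  assumes psd: "psd (block_kernel f)"
    and supp: "\<And>\<xi>. \<xi> \<notin> quadrant \<Longrightarrow> f \<xi> = 0"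
  obtains k1 k2 where "psd k1" "psd k2"
    and "\<And>\<mu> \<nu>. \<mu> \<notin> quadrant \<or> \<nu> \<notin> quadrant \<Longrightarrow> k1 \<mu> \<nu> = 0 \<and> k2 \<mu> \<nu> = 0"
    and "\<And>\<mu> \<nu>. delta \<mu> \<nu> - f \<mu> * cnj (f \<nu>)
            = diag_diff e1 k1 \<mu> \<nu> + diag_diff e2 k2 \<mu> \<nu>"
proof -
  define S where "S = {p :: bool \<times> idx. 0 \<le> snd (snd p) \<and> (fst p \<or> fst (snd p) < 0)}"
  let ?K = "block_kernel f"
  have "Re (?K i i) \<le> 1" for i by (simp add: block_kernel_def)
  from shorted_kernel[OF psd this, of S] obtain A' where A': "psd A'"
    and le: "\<And>F G c d. \<lbrakk>finite G; F \<subseteq> G; G - F \<subseteq> S; \<And>i. i \<in> F \<Longrightarrow> d i = c i\<rbrakk>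
           \<Longrightarrow> Re (sform F A' c c) \<le> Re (sform G ?K d d)"
    and attained: "\<And>F c e. \<lbrakk>finite F; F \<inter> S = {}; e > 0\<rbrakk> \<Longrightarrow> \<exists>G d. finite G \<and> F \<subseteq> G \<and> G - F \<subseteq> S \<and>
           (\<forall>i\<in>F. d i = c i) \<and> Re (sform G ?K d d) \<le> Re (sform F A' c c) + e"
    by blast
  define A where "A = (\<lambda>\<mu> \<nu>. if \<mu> \<in> quadrant \<and> \<nu> \<in> quadrant then A' (False, \<mu>) (False, \<nu>) else 0)"
  have sA: "sform F A c c = sform (Pair False ` (F \<inter> quadrant)) A' (\<lambda>p. c (snd p)) (\<lambda>p. c (snd p))"
    if "finite F" for F c
    unfolding A_def by (rule sform_quadrant[OF that])
  have A: "psd A"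
  proof (rule psd_kernelI)
    fix F :: "idx set" and c assume "finite F"
    then show "sform F A c c \<in> \<real>\<^sub>\<ge>\<^sub>0" unfolding sA[OF \<open>finite F\<close>] by (intro psd_kernelD[OF A']) auto
  qed
  have sAsh: "sform F (\<lambda>\<mu> \<nu>. A (\<mu> - e) (\<nu> - e)) c c
      = sform (Pair False ` ((\<lambda>\<mu>. \<mu> - e) ` F \<inter> quadrant)) A' (\<lambda>p. c (snd p + e)) (\<lambda>p. c (snd p + e))"
    if "finite F" for F c e
  proof -
    have "sform F (\<lambda>\<mu> \<nu>. A (\<mu> - e) (\<nu> - e)) c c
        = sform ((\<lambda>\<mu>. \<mu> - e) ` F) A (\<lambda>\<mu>. c (\<mu> + e)) (\<lambda>\<mu>. c (\<mu> + e))"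
      by (subst sform_reindex) (auto simp: inj_on_def)
    then show ?thesis using sA[of "(\<lambda>\<mu>. \<mu> - e) ` F" "\<lambda>\<mu>. c (\<mu> + e)"] that by simp
  qed
  have disj: "Pair False ` (F \<inter> quadrant) \<inter> S = {}" for F by (auto simp: S_def quadrant_def)
  \<comment> \<open>An almost optimal modification of h, translated by minus e1, is admissible for the backward shift of h.\<close>
  have le1: "Re (sform F (\<lambda>\<mu> \<nu>. A (\<mu> - e1) (\<nu> - e1)) c c) \<le> Re (sform F A c c)" if F: "finite F" for F c
  proof (rule field_le_epsilon)
    fix e :: real assume e: "e > 0"
    define F0 where "F0 = Pair False ` (F \<inter> quadrant)"
    obtain G d where G: "finite G" "F0 \<subseteq> G" "G - F0 \<subseteq> S" "\<And>i. i \<in> F0 \<Longrightarrow> d i = c (snd i)"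
      "Re (sform G ?K d d) \<le> Re (sform F A c c) + e"
    proof -
      have "finite F0" "F0 \<inter> S = {}" using F disj by (auto simp: F0_def)
      from attained[OF this e, of "\<lambda>p. c (snd p)"] show ?thesis
        using that unfolding sA[OF F, of c, folded F0_def] by blast
    qed
    define \<sigma> where "\<sigma> p = (fst p, snd p - e1)" for p :: "bool \<times> idx"
    have inj: "inj_on \<sigma> G" by (auto simp: inj_on_def \<sigma>_def prod_eq_iff)
    define d' where "d' p = d (fst p, snd p + e1)" for p
    have "sform (\<sigma> ` G) ?K d' d' = sform G ?K d d"
      unfolding sform_reindex[OF inj] by (intro sform_cong) (auto simp: \<sigma>_def d'_def block_kernel_def prod_eq_iff)
    moreover have "Re (sform (Pair False ` ((\<lambda>\<mu>. \<mu> - e1) ` F \<inter> quadrant)) A' (\<lambda>p. c (snd p + e1)) (\<lambda>p. c (snd p + e1)))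
      \<le> Re (sform (\<sigma> ` G) ?K d' d')"
    proof (rule le)
      show "finite (\<sigma> ` G)" using G(1) by simp
      show "Pair False ` ((\<lambda>\<mu>. \<mu> - e1) ` F \<inter> quadrant) \<subseteq> \<sigma> ` G"
      proof (clarsimp)
        fix a b assume ab: "(a, b) \<in> F" "(a - 1, b) \<in> quadrant"
        then have "(False, (a, b)) \<in> G" using G(2) by (auto simp: F0_def quadrant_def)
        then show "(False, a - 1, b) \<in> \<sigma> ` G" by (force simp: \<sigma>_def)
      qed
      show "\<sigma> ` G - Pair False ` ((\<lambda>\<mu>. \<mu> - e1) ` F \<inter> quadrant) \<subseteq> S"
      proof
        fix x assume x: "x \<in> \<sigma> ` G - Pair False ` ((\<lambda>\<mu>. \<mu> - e1) ` F \<inter> quadrant)"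
        then obtain p where p: "p \<in> G" "x = \<sigma> p" by auto
        show "x \<in> S"
        proof (cases "p \<in> F0")
          case True
          then obtain \<mu> where \<mu>: "p = (False, \<mu>)" "\<mu> \<in> F" "\<mu> \<in> quadrant" by (auto simp: F0_def)
          have "\<mu> - e1 \<notin> quadrant" using x p(2) \<mu> by (auto simp: \<sigma>_def)
          then show ?thesis using \<mu> p(2) by (auto simp: \<sigma>_def S_def quadrant_def)
        next
          case False
          then have "p \<in> S" using G(3) p(1) by blast
          then show ?thesis using p(2) by (auto simp: \<sigma>_def S_def)
        qed
      qed
      show "d' i = c (snd i + e1)" if "i \<in> Pair False ` ((\<lambda>\<mu>. \<mu> - e1) ` F \<inter> quadrant)" for i
      proof -
        obtain \<mu> where \<mu>: "i = (False, \<mu> - e1)" "\<mu> \<in> F" "\<mu> - e1 \<in> quadrant" using \<open>i \<in> _\<close> by auto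
        then have "(False, \<mu>) \<in> F0" by (auto simp: F0_def quadrant_def)
        then show ?thesis using G(4) \<mu> by (simp add: d'_def)
      qed
    qed
    ultimately show "Re (sform F (\<lambda>\<mu> \<nu>. A (\<mu> - e1) (\<nu> - e1)) c c) \<le> Re (sform F A c c) + e"
      unfolding sAsh[OF F] using G(5) by simp
  qed
  \<comment> \<open>Any longer range of n from 0 on gives the same sum, since f vanishes outside the quadrant.\<close>
  define D where "D \<mu> \<nu> = of_bool (\<mu> = \<nu> \<and> \<mu> \<in> quadrant \<and> snd \<mu> = 0)
      - (\<Sum>n\<in>{0..fst \<mu>}. f (\<mu> - (n, 0)) * cnj (f (\<nu> - (n, 0))))" for \<mu> \<nu>
  have sD: "sform F D c c = of_real ((\<Sum>\<mu> | \<mu> \<in> F \<and> \<mu> \<in> quadrant \<and> snd \<mu> = 0. (cmod (c \<mu>))\<^sup>2)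
      - (\<Sum>n\<in>{0..N}. (cmod (\<Sum>\<mu>\<in>F. c \<mu> * f (\<mu> - (n, 0))))\<^sup>2))"
    if F: "finite F" and N: "\<And>\<mu>. \<mu> \<in> F \<Longrightarrow> fst \<mu> \<le> N" for F c N
  proof -
    have "sform F (\<lambda>\<mu> \<nu>. of_bool (\<mu> = \<nu> \<and> \<mu> \<in> quadrant \<and> snd \<mu> = 0)) c c
        = (\<Sum>\<mu>\<in>F. if \<mu> \<in> quadrant \<and> snd \<mu> = 0 then c \<mu> * cnj (c \<mu>) else 0)"
    proof -
      have "(\<Sum>\<nu>\<in>F. c \<mu> * of_bool (\<mu> = \<nu> \<and> \<mu> \<in> quadrant \<and> snd \<mu> = 0) * cnj (c \<nu>))
         = (\<Sum>\<nu>\<in>F. if \<nu> = \<mu> then (if \<mu> \<in> quadrant \<and> snd \<mu> = 0 then c \<mu> * cnj (c \<mu>) else 0) else 0)" for \<mu>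
        by (intro sum.cong) auto
      then show ?thesis unfolding sform_def using F by simp
    qed
    also have "\<dots> = of_real (\<Sum>\<mu> | \<mu> \<in> F \<and> \<mu> \<in> quadrant \<and> snd \<mu> = 0. (cmod (c \<mu>))\<^sup>2)"
      using F by (simp add: complex_norm_square sum.inter_filter[symmetric] del: of_real_power)
    finally have 1: "sform F (\<lambda>\<mu> \<nu>. of_bool (\<mu> = \<nu> \<and> \<mu> \<in> quadrant \<and> snd \<mu> = 0)) c c
      = of_real (\<Sum>\<mu> | \<mu> \<in> F \<and> \<mu> \<in> quadrant \<and> snd \<mu> = 0. (cmod (c \<mu>))\<^sup>2)" .
    have ext: "(\<Sum>n\<in>{0..fst \<mu>}. f (\<mu> - (n, 0)) * cnj (f (\<nu> - (n, 0)))) = (\<Sum>n\<in>{0..N}. f (\<mu> - (n, 0)) * cnj (f (\<nu> - (n, 0))))"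
      if "\<mu> \<in> F" for \<mu> \<nu>
      using N[OF that] by (intro sum.mono_neutral_left) (auto intro!: supp simp: quadrant_def)
    have "sform F (\<lambda>\<mu> \<nu>. \<Sum>n\<in>{0..fst \<mu>}. f (\<mu> - (n, 0)) * cnj (f (\<nu> - (n, 0)))) c c
       = (\<Sum>\<mu>\<in>F. \<Sum>\<nu>\<in>F. \<Sum>n\<in>{0..N}. (c \<mu> * f (\<mu> - (n, 0))) * cnj (c \<nu> * f (\<nu> - (n, 0))))"
      unfolding sform_def by (intro sum.cong refl) (simp only: ext sum_distrib_left sum_distrib_right complex_cnj_mult mult_ac)
    also have "\<dots> = (\<Sum>\<mu>\<in>F. \<Sum>n\<in>{0..N}. \<Sum>\<nu>\<in>F. (c \<mu> * f (\<mu> - (n, 0))) * cnj (c \<nu> * f (\<nu> - (n, 0))))"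
      by (intro sum.cong refl sum.swap)
    also have "\<dots> = (\<Sum>n\<in>{0..N}. \<Sum>\<mu>\<in>F. \<Sum>\<nu>\<in>F. (c \<mu> * f (\<mu> - (n, 0))) * cnj (c \<nu> * f (\<nu> - (n, 0))))"
      by (rule sum.swap)
    also have "\<dots> = (\<Sum>n\<in>{0..N}. (\<Sum>\<mu>\<in>F. c \<mu> * f (\<mu> - (n, 0))) * cnj (\<Sum>\<mu>\<in>F. c \<mu> * f (\<mu> - (n, 0))))"
      by (simp only: cnj_sum sum_product)
    also have "\<dots> = of_real (\<Sum>n\<in>{0..N}. (cmod (\<Sum>\<mu>\<in>F. c \<mu> * f (\<mu> - (n, 0))))\<^sup>2)"
      by (simp only: complex_norm_square[symmetric]) simp
    finally show ?thesis unfolding D_def sform_diff 1 by simp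
  qed
  \<comment> \<open>G1 is the translate of an almost optimal set for the backward shift, F00 carries the part of h of degree 0 in the second variable, and T0 the correction.\<close>
  have le2: "Re (sform F A c c) \<le> Re (sform F (\<lambda>\<mu> \<nu>. A (\<mu> - e2) (\<nu> - e2)) c c) + Re (sform F D c c)"
    if F: "finite F" for F c
  proof (rule field_le_epsilon)
    fix e :: real assume e: "e > 0"
    define F0 where "F0 = Pair False ` (F \<inter> quadrant)"
    define F2 where "F2 = Pair False ` ((\<lambda>\<mu>. \<mu> - e2) ` F \<inter> quadrant)"
    obtain G' d' where G': "finite G'" "F2 \<subseteq> G'" "G' - F2 \<subseteq> S" "\<And>i. i \<in> F2 \<Longrightarrow> d' i = c (snd i + e2)"
      "Re (sform G' ?K d' d') \<le> Re (sform F (\<lambda>\<mu> \<nu>. A (\<mu> - e2) (\<nu> - e2)) c c) + e"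
    proof -
      have "finite F2" "F2 \<inter> S = {}" using F disj by (auto simp: F2_def)
      from attained[OF this e, of "\<lambda>p. c (snd p + e2)"] show ?thesis
        using that unfolding sAsh[OF F, of e2 c, folded F2_def] by blast
    qed
    have G'snd: "0 \<le> snd (snd p)" if "p \<in> G'" for p
      using G'(2,3) that by (cases "p \<in> F2") (auto simp: F2_def S_def quadrant_def)
    define N where "N = Max (insert 0 (fst ` F))"
    have N: "fst \<mu> \<le> N" if "\<mu> \<in> F" for \<mu> using F that by (auto simp: N_def)
    define s where "s n = (\<Sum>\<mu>\<in>F. c \<mu> * f (\<mu> - (n, 0)))" for n
    define \<tau> where "\<tau> p = (fst p, snd p + e2)" for p :: "bool \<times> idx"
    have inj: "inj_on \<tau> X" for X by (auto simp: inj_on_def \<tau>_def prod_eq_iff)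
    define G1 where "G1 = \<tau> ` G'"
    define F00 where "F00 = Pair False ` {\<mu>. \<mu> \<in> F \<and> \<mu> \<in> quadrant \<and> snd \<mu> = 0}"
    define T0 where "T0 = (\<lambda>n::int. (True, (n, 0::int))) ` {0..N}"
    \<comment> \<open>The weight -s minimizes the sum of |t|^2 + 2 Re (s cnj t) over the weights t on T0.\<close>
    define d where "d p = (if snd (snd p) \<ge> 1 then d' (fst p, snd p - e2)
         else if fst p then - s (fst (snd p)) else c (snd p))" for p
    have fin: "finite G1" "finite F00" "finite T0" using F G'(1) by (auto simp: G1_def F00_def T0_def)
    have G1snd: "1 \<le> snd (snd p)" if "p \<in> G1" for p
      using that G'snd by (auto simp: G1_def \<tau>_def)
    have F0_split: "F0 \<subseteq> G1 \<union> F00"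
    proof
      fix p assume "p \<in> F0"
      then obtain \<mu> where \<mu>: "p = (False, \<mu>)" "\<mu> \<in> F" "\<mu> \<in> quadrant" by (auto simp: F0_def)
      show "p \<in> G1 \<union> F00"
      proof (cases "snd \<mu> = 0")
        case True
        then show ?thesis using \<mu> by (auto simp: F00_def)
      next
        case False
        then have "(False, \<mu> - e2) \<in> G'" using \<mu> G'(2) by (auto simp: F2_def quadrant_def)
        then have "\<tau> (False, \<mu> - e2) \<in> G1" unfolding G1_def by (rule imageI)
        then show ?thesis using \<mu> by (simp add: \<tau>_def)
      qed
    qed
    have G1_F0: "p \<in> S" if "p \<in> G1" "p \<notin> F0" for p
    proof -
      obtain q where q: "q \<in> G'" "p = \<tau> q" using \<open>p \<in> G1\<close> unfolding G1_def by blast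
      have "q \<notin> F2"
      proof
        assume "q \<in> F2"
        then obtain \<mu> where "\<mu> \<in> F" "\<mu> - e2 \<in> quadrant" "q = (False, \<mu> - e2)" by (auto simp: F2_def)
        then have "p \<in> F0" using q(2) by (auto simp: F0_def \<tau>_def quadrant_def)
        then show False using that by simp
      qed
      then have "q \<in> S" using q G'(3) by blast
      then show ?thesis using q(2) by (auto simp: \<tau>_def S_def)
    qed
    have dF0: "d i = c (snd i)" if "i \<in> F0" for i
    proof -
      obtain \<mu> where \<mu>: "i = (False, \<mu>)" "\<mu> \<in> F" "\<mu> \<in> quadrant" using \<open>i \<in> F0\<close> unfolding F0_def by blast
      show ?thesis
      proof (cases "snd \<mu> \<ge> 1")
        case True
        then have "(False, \<mu> - e2) \<in> F2" using \<mu> by (auto simp: F2_def quadrant_def)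
        then show ?thesis using G'(4)[of "(False, \<mu> - e2)"] True \<mu> by (simp add: d_def)
      next
        case False
        then show ?thesis using \<mu> by (simp add: d_def)
      qed
    qed
    define X where "X = G1 \<union> F00"
    have finX: "finite X" using fin by (simp add: X_def)
    \<comment> \<open>The correction pairs with h alone: its pairings with the rest of G1 are off-diagonal entries of an identity matrix or coefficients of f outside the quadrant.\<close>
    have s_eq: "(\<Sum>i\<in>X. d i * ?K i (True, (n, 0))) = s n" if n: "0 \<le> n" for n
    proof -
      have "(\<Sum>i\<in>X. d i * ?K i (True, (n, 0))) = (\<Sum>i\<in>F0. d i * ?K i (True, (n, 0)))"
      proof (rule sum.mono_neutral_right[OF finX])
        show "F0 \<subseteq> X" using F0_split by (simp add: X_def)
        show "\<forall>i\<in>X - F0. d i * ?K i (True, (n, 0)) = 0"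
        proof
          fix i assume i: "i \<in> X - F0"
          then have "i \<in> G1" by (auto simp: X_def F00_def F0_def)
          then have iS: "i \<in> S" "1 \<le> snd (snd i)" using G1_F0 G1snd i by auto
          have "snd i - (n, 0) \<notin> quadrant" if "\<not> fst i" using iS that n by (auto simp: S_def quadrant_def)
          then show "d i * ?K i (True, (n, 0)) = 0" using iS by (auto simp: block_kernel_def supp)
        qed
      qed
      also have "\<dots> = (\<Sum>\<mu>\<in>F \<inter> quadrant. c \<mu> * f (\<mu> - (n, 0)))"
      proof -
        have "d (False, \<mu>) = c \<mu>" if "\<mu> \<in> F \<inter> quadrant" for \<mu> using dF0[of "(False, \<mu>)"] that by (auto simp: F0_def)
        then show ?thesis unfolding F0_def by (subst sum.reindex) (auto simp: inj_on_def block_kernel_def)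
      qed
      also have "\<dots> = s n"
        unfolding s_def using F n by (intro sum.mono_neutral_left) (auto intro!: supp simp: quadrant_def)
      finally show ?thesis .
    qed
    have dT: "d (True, (n, 0)) = - s n" for n by (simp add: d_def)
    have cross: "(\<Sum>i\<in>X. \<Sum>j\<in>T0. d i * ?K i j * cnj (d j)) = - (\<Sum>n\<in>{0..N}. s n * cnj (s n))"
    proof -
      have "(\<Sum>i\<in>X. \<Sum>j\<in>T0. d i * ?K i j * cnj (d j)) = (\<Sum>j\<in>T0. (\<Sum>i\<in>X. d i * ?K i j) * cnj (d j))"
        unfolding sum_distrib_right by (rule sum.swap)
      also have "\<dots> = (\<Sum>n\<in>{0..N}. s n * cnj (- s n))"
        unfolding T0_def by (subst sum.reindex) (auto simp: inj_on_def dT s_eq)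
      finally show ?thesis by (simp add: sum_negf)
    qed
    have formT0: "sform T0 ?K d d = (\<Sum>n\<in>{0..N}. s n * cnj (s n))"
    proof -
      have "sform T0 ?K d d = (\<Sum>n\<in>{0..N}. \<Sum>m\<in>{0..N}. s n * of_bool (n = m) * cnj (s m))"
        unfolding T0_def by (subst sform_reindex) (auto simp: inj_on_def sform_def dT block_kernel_def)
      then show ?thesis by (simp add: sum_of_bool_delta)
    qed
    have formX: "Re (sform X ?K d d) = Re (sform G1 ?K d d) + Re (sform F00 ?K d d)"
    proof -
      have "d i * ?K i j * cnj (d j) = 0" if "i \<in> G1" "j \<in> F00" for i j
      proof -
        have ij: "1 \<le> snd (snd i)" "snd (snd j) = 0" "\<not> fst j" using that G1snd by (auto simp: F00_def)
        then have "snd j - snd i \<notin> quadrant" by (auto simp: quadrant_def)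
        then show ?thesis using ij by (auto simp: block_kernel_def supp)
      qed
      then have "(\<Sum>i\<in>G1. \<Sum>j\<in>F00. d i * ?K i j * cnj (d j)) = 0"
        by (intro sum.neutral ballI) blast
      moreover have "G1 \<inter> F00 = {}" using G1snd by (fastforce simp: F00_def)
      ultimately show ?thesis unfolding X_def using sform_union[OF psd fin(1,2), of d]
        by (simp del: Re_sum)
    qed
    have formG1: "sform G1 ?K d d = sform G' ?K d' d'"
      unfolding G1_def sform_reindex[OF inj]
      by (intro sform_cong) (use G'snd in \<open>auto simp: \<tau>_def d_def block_kernel_def\<close>)
    have formF00: "sform F00 ?K d d = of_real (\<Sum>\<mu> | \<mu> \<in> F \<and> \<mu> \<in> quadrant \<and> snd \<mu> = 0. (cmod (c \<mu>))\<^sup>2)"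
    proof -
      let ?Q = "{\<mu>. \<mu> \<in> F \<and> \<mu> \<in> quadrant \<and> snd \<mu> = 0}"
      have "sform F00 ?K d d = (\<Sum>\<mu>\<in>?Q. \<Sum>\<nu>\<in>?Q. c \<mu> * of_bool (\<mu> = \<nu>) * cnj (c \<nu>))"
        unfolding F00_def by (subst sform_reindex) (auto simp: inj_on_def sform_def d_def block_kernel_def)
      then show ?thesis using F by (simp add: sum_of_bool_delta complex_norm_square del: of_real_power)
    qed
    have ss: "Re (\<Sum>n\<in>{0..N}. s n * cnj (s n)) = (\<Sum>n\<in>{0..N}. (cmod (s n))\<^sup>2)"
      by (simp only: complex_norm_square[symmetric]) simp
    have "Re (sform F0 A' (\<lambda>p. c (snd p)) (\<lambda>p. c (snd p))) \<le> Re (sform (X \<union> T0) ?K d d)"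
    proof (rule le)
      show "finite (X \<union> T0)" using fin finX by simp
      show "F0 \<subseteq> X \<union> T0" using F0_split by (auto simp: X_def)
      show "X \<union> T0 - F0 \<subseteq> S"
      proof -
        have "T0 \<subseteq> S" by (auto simp: T0_def S_def)
        moreover have "F00 \<subseteq> F0" by (auto simp: F00_def F0_def)
        ultimately show ?thesis using G1_F0 by (auto simp: X_def)
      qed
    qed (rule dF0)
    also have "\<dots> = Re (sform X ?K d d) + Re (sform T0 ?K d d)
       + 2 * Re (\<Sum>i\<in>X. \<Sum>j\<in>T0. d i * ?K i j * cnj (d j))"
    proof (rule sform_union[OF psd finX fin(3)])
      show "X \<inter> T0 = {}" using G1snd by (fastforce simp: X_def T0_def F00_def)
    qed
    also have "\<dots> = Re (sform G' ?K d' d') + Re (sform F D c c)"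
    proof -
      have "sform F D c c = of_real ((\<Sum>\<mu> | \<mu> \<in> F \<and> \<mu> \<in> quadrant \<and> snd \<mu> = 0. (cmod (c \<mu>))\<^sup>2)
         - (\<Sum>n\<in>{0..N}. (cmod (s n))\<^sup>2))"
        unfolding s_def by (rule sD[OF F]) (rule N)
      then have "Re (sform F D c c) = (\<Sum>\<mu> | \<mu> \<in> F \<and> \<mu> \<in> quadrant \<and> snd \<mu> = 0. (cmod (c \<mu>))\<^sup>2)
         - (\<Sum>n\<in>{0..N}. (cmod (s n))\<^sup>2)" by (simp only: Re_complex_of_real)
      then show ?thesis
        unfolding cross formT0 formX formG1 formF00 uminus_complex.sel ss by simp
    qed
    finally show "Re (sform F A c c) \<le> Re (sform F (\<lambda>\<mu> \<nu>. A (\<mu> - e2) (\<nu> - e2)) c c) + Re (sform F D c c) + e"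
      using G'(5) unfolding sA[OF F] F0_def by simp
  qed
  define k2 where "k2 \<mu> \<nu> = A \<mu> \<nu> - A (\<mu> - e1) (\<nu> - e1)" for \<mu> \<nu>
  define k1 where "k1 \<mu> \<nu> = D \<mu> \<nu> - diag_diff e2 A \<mu> \<nu>" for \<mu> \<nu>
  have real: "Im (sform F A c c) = 0" "Im (sform F (\<lambda>\<mu> \<nu>. A (\<mu> - e) (\<nu> - e)) c c) = 0"
    if "finite F" for F c e
    using psd_kernelD[OF A, of F c] psd_kernelD[OF A', of "Pair False ` ((\<lambda>\<mu>. \<mu> - e) ` F \<inter> quadrant)"] that
    by (auto simp: complex_nonneg_Reals_iff sAsh)
  show thesis
  proof (rule that[of k1 k2])
    show "psd k2"
    proof (rule psd_kernelI)
      fix F :: "idx set" and c assume F: "finite F"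
      show "sform F k2 c c \<in> \<real>\<^sub>\<ge>\<^sub>0"
        unfolding k2_def sform_diff using le1[OF F, of c] real(1)[OF F, of c] real(2)[OF F, of e1 c] by (simp add: complex_nonneg_Reals_iff)
    qed
    show "psd k1"
    proof (rule psd_kernelI)
      fix F :: "idx set" and c assume F: "finite F"
      have "Im (sform F D c c) = 0"
        using sD[OF F, of "Max (fst ` F)" c] F by simp
      then show "sform F k1 c c \<in> \<real>\<^sub>\<ge>\<^sub>0"
        unfolding k1_def sform_diff using le2[OF F, of c] real(1)[OF F, of c] real(2)[OF F, of e2 c] by (simp add: complex_nonneg_Reals_iff)
    qed
    show "k1 \<mu> \<nu> = 0 \<and> k2 \<mu> \<nu> = 0" if "\<mu> \<notin> quadrant \<or> \<nu> \<notin> quadrant" for \<mu> \<nu>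
    proof -
      have out: "\<xi> - e1 \<notin> quadrant" "\<xi> - e2 \<notin> quadrant" "0 \<le> n \<Longrightarrow> \<xi> - (n, 0) \<notin> quadrant"
        if "\<xi> \<notin> quadrant" for \<xi> n
        using that by (auto simp: quadrant_def)
      have "D \<mu> \<nu> = 0" using that unfolding D_def by (auto intro!: sum.neutral simp: supp out)
      then show ?thesis using that by (elim disjE) (simp_all add: k1_def k2_def A_def out)
    qed
    show "delta \<mu> \<nu> - f \<mu> * cnj (f \<nu>)
        = diag_diff e1 k1 \<mu> \<nu> + diag_diff e2 k2 \<mu> \<nu>" for \<mu> \<nu>
    proof -
      define h where "h n = f (\<mu> - (n, 0)) * cnj (f (\<nu> - (n, 0)))" for n
      have "(\<Sum>n\<in>{0..fst \<mu>}. h n) = h 0 + (\<Sum>n\<in>{0..fst \<mu> - 1}. h (n + 1))"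
      proof (cases "0 \<le> fst \<mu>")
        case True
        have "{0..fst \<mu>} = insert 0 ((\<lambda>n. n + 1) ` {0..fst \<mu> - 1})"
          using True by (auto simp: image_iff intro!: bexI[of _ "_ - 1"])
        moreover have "(\<Sum>n\<in>(\<lambda>n. n + 1) ` {0..fst \<mu> - 1}. h n) = (\<Sum>n\<in>{0..fst \<mu> - 1}. h (n + 1))"
          by (subst sum.reindex) auto
        ultimately show ?thesis by (subst \<open>{0..fst \<mu>} = _\<close>) (subst sum.insert, auto)
      next
        case False
        then have "h 0 = 0" by (simp add: h_def supp quadrant_def)
        then show ?thesis using False by simp
      qed
      moreover have "of_bool (\<mu> = \<nu> \<and> \<mu> \<in> quadrant \<and> snd \<mu> = 0) - of_bool (\<mu> - e1 = \<nu> - e1 \<and> \<mu> - e1 \<in> quadrant \<and> snd (\<mu> - e1) = 0)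
         = (delta \<mu> \<nu> :: complex)"
        by (auto simp: quadrant_def prod_eq_iff)
      ultimately have "D \<mu> \<nu> - D (\<mu> - e1) (\<nu> - e1) = delta \<mu> \<nu> - f \<mu> * cnj (f \<nu>)"
        unfolding D_def h_def by (simp add: algebra_simps zero_prod_def[symmetric])
      then show ?thesis unfolding k1_def k2_def by (simp add: algebra_simps)
    qed
  qed
qed

section \<open>The lurking isometry\<close>

text \<open>
  A vector of $\mathbb{C} \oplus H_1 \oplus H_2$, where $H_1$ and $H_2$ are the semi-inner product spaces
  of combinations of exponents with the Gram matrices $k_1$ and $k_2$.
\<close>

type_synonym vec = "complex \<times> (idx \<Rightarrow> complex) \<times> (idx \<Rightarrow> complex)"

lemma psd_pullback:
  assumes "psd K"
  shows "psd (\<lambda>i j. K (h i) (h j))"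
  using psd_family[OF assms, where z = h] by (intro psd_kernelI) (simp add: sform_def)

lemma psd_transpose:
  assumes "psd K"
  shows "psd (\<lambda>i j. K j i)"
proof (rule psd_kernelI)
  fix F :: "'a set" and c assume F: "finite F"
  have "sform F (\<lambda>i j. K j i) c c = sform F K (\<lambda>i. cnj (c i)) (\<lambda>i. cnj (c i))"
    unfolding sform_def by (subst sum.swap) (intro sum.cong refl, simp)
  then show "sform F (\<lambda>i j. K j i) c c \<in> \<real>\<^sub>\<ge>\<^sub>0" using psd_kernelD[OF assms F] by simp
qed

lemma psd_rank_one: "psd (\<lambda>i j. g i * cnj (g j))"
proof (rule psd_kernelI)
  fix F :: "'a set" and c assume F: "finite F"
  have "sform F (\<lambda>i j. g i * cnj (g j)) c c = (\<Sum>i\<in>F. c i * g i) * cnj (\<Sum>i\<in>F. c i * g i)"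
    unfolding sform_def cnj_sum sum_product by (intro sum.cong refl) simp
  also have "\<dots> = of_real ((cmod (\<Sum>i\<in>F. c i * g i))\<^sup>2)" by (rule complex_norm_square[symmetric])
  finally show "sform F (\<lambda>i j. g i * cnj (g j)) c c \<in> \<real>\<^sub>\<ge>\<^sub>0" by (simp del: of_real_power)
qed

lemma psd_add:
  assumes "psd_kernel_on \<Omega> K" "psd_kernel_on \<Omega> P"
  shows "psd_kernel_on \<Omega> (\<lambda>i j. K i j + P i j)"
  using assms unfolding psd_kernel_on_def psd_matrix_on_def
  by (simp add: distrib_left distrib_right sum.distrib)

text \<open>
  Coefficient by coefficient, this is the expansion of the solution $w$ of
  $w = W(1, \zeta_1 w_1, \zeta_2 w_2)$.
\<close>

function left_vector :: "(vec \<Rightarrow> vec) \<Rightarrow> idx \<Rightarrow> vec" where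
  "left_vector W \<nu> = (if \<nu> \<in> quadrant
     then W (of_bool (\<nu> = 0), fst (snd (left_vector W (\<nu> - e1))), snd (snd (left_vector W (\<nu> - e2))))
     else (0, \<lambda>_. 0, \<lambda>_. 0))"
  by auto
\<comment> \<open>The two exponents are raised by one so that the measure also decreases from 0 to -1.\<close>
termination
  by (relation "Wellfounded.measure (\<lambda>(W, \<nu>). nat (fst \<nu> + 1) + nat (snd \<nu> + 1))") (auto simp: quadrant_def)

declare left_vector.simps [simp del]

text \<open>
  Let $u_\mu$ be the unit vectors. The identity for $k_1, k_2$ says that
  $x_\mu = (\delta_{\mu 0}, u_{\mu - e_1}, u_{\mu - e_2})$ and
  $y_\mu = (f_\mu, u_\mu, u_\mu)$ have the same Gram matrix, so $x_\mu \mapsto y_\mu$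
  extends to a contraction $V$. Its adjoint $W$ projects onto the span of the $y_\mu$ and then
  replaces $y_\mu$ by $x_\mu$; projecting onto a finite span needs no completeness, which is why
  the exponents are restricted to $\Xi$.

  The vectors $w_\nu = W s_\nu$ with $s_\nu = (\delta_{\nu 0}, w_{\nu - e_1}, w_{\nu - e_2})$
  provide kernels from the left, $m_j(\mu,\nu) = \langle w_\nu, w_\mu\rangle_j$, and mixed
  kernels $l_j(\mu, \nu) = \langle u_\mu, w_\nu\rangle_j$. Expanding
  $\langle x_\mu, W s_\nu\rangle = \langle y_\mu, s_\nu\rangle$ gives the difference
  identity for $l_1, l_2$, and $\|W s\| \le \|s\|$ says that the $m_j$ satisfy the Agler identity up to a
  positive semi-definite defect. The last two claims are the Cauchy--Schwarz inequality in $H_j$.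
\<close>

lemma lurking_isometry:
  fixes f :: "idx \<Rightarrow> complex"
  assumes k1: "psd k1" and k2: "psd k2"
    and k_out: "\<And>\<mu> \<nu>. \<mu> \<notin> quadrant \<or> \<nu> \<notin> quadrant \<Longrightarrow> k1 \<mu> \<nu> = 0 \<and> k2 \<mu> \<nu> = 0"
    and agler: "\<And>\<mu> \<nu>. delta \<mu> \<nu> - f \<mu> * cnj (f \<nu>)
            = diag_diff e1 k1 \<mu> \<nu> + diag_diff e2 k2 \<mu> \<nu>"
    and \<Xi>: "finite \<Xi>" and down: "\<And>\<mu> e. \<mu> \<in> \<Xi> \<Longrightarrow> e \<in> {e1, e2} \<Longrightarrow> \<mu> - e \<in> quadrant \<Longrightarrow> \<mu> - e \<in> \<Xi>"
  obtains q m1 m2 l1 l2 where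
    "psd m1" "psd m2"
    "psd (\<lambda>\<mu> \<nu>. delta \<mu> \<nu> - q \<mu> * cnj (q \<nu>)
        - diag_diff e1 m1 \<mu> \<nu> - diag_diff e2 m2 \<mu> \<nu>)"
    "\<And>\<mu> \<nu>. \<mu> \<notin> quadrant \<or> \<nu> \<notin> quadrant \<Longrightarrow> m1 \<mu> \<nu> = 0 \<and> m2 \<mu> \<nu> = 0"
    "\<And>\<nu>. \<nu> \<notin> quadrant \<Longrightarrow> q \<nu> = 0"
    "\<And>\<mu> \<nu>. \<mu> \<notin> \<Xi> \<or> \<nu> \<notin> quadrant \<Longrightarrow> l1 \<mu> \<nu> = 0 \<and> l2 \<mu> \<nu> = 0"
    "\<And>\<mu> \<nu>. \<mu> \<in> \<Xi> \<Longrightarrow> f \<mu> * of_bool (\<nu> = 0) - of_bool (\<mu> = 0) * q \<nu>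
       = cross_diff e1 l1 \<mu> \<nu> + cross_diff e2 l2 \<mu> \<nu>"
    "\<And>X Y c d. finite X \<Longrightarrow> X \<subseteq> \<Xi> \<Longrightarrow> finite Y \<Longrightarrow>
       (cmod (\<Sum>\<mu>\<in>X. \<Sum>\<nu>\<in>Y. c \<mu> * d \<nu> * l1 \<mu> \<nu>))\<^sup>2 \<le> Re (sform X k1 c c) * Re (sform Y m1 d d)"
    "\<And>X Y c d. finite X \<Longrightarrow> X \<subseteq> \<Xi> \<Longrightarrow> finite Y \<Longrightarrow>
       (cmod (\<Sum>\<mu>\<in>X. \<Sum>\<nu>\<in>Y. c \<mu> * d \<nu> * l2 \<mu> \<nu>))\<^sup>2 \<le> Re (sform X k2 c c) * Re (sform Y m2 d d)"
proof -
  define ip :: "vec \<Rightarrow> vec \<Rightarrow> complex" where "ip c d = fst c * cnj (fst d)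
     + sform \<Xi> k1 (fst (snd c)) (fst (snd d)) + sform \<Xi> k2 (snd (snd c)) (snd (snd d))" for c d
  have s1: "psd (sform \<Xi> k1)" and s2: "psd (sform \<Xi> k2)"
    using psd_sform[OF k1 \<Xi>] psd_sform[OF k2 \<Xi>] by auto
  have ip: "psd ip"
    unfolding ip_def[abs_def] by (intro psd_add psd_rank_one psd_pullback[OF s1] psd_pullback[OF s2])
  define comb :: "(idx \<Rightarrow> complex) \<Rightarrow> (idx \<Rightarrow> vec) \<Rightarrow> vec" where
    "comb a x = (\<Sum>p\<in>\<Xi>. a p * fst (x p), \<lambda>i. \<Sum>p\<in>\<Xi>. a p * fst (snd (x p)) i, \<lambda>i. \<Sum>p\<in>\<Xi>. a p * snd (snd (x p)) i)" for a x
  have ip_left: "ip (comb a x) d = (\<Sum>p\<in>\<Xi>. a p * ip (x p) d)" for a x d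
    by (simp add: ip_def comb_def sform_sum_left distrib_left sum.distrib) (simp only: sum_distrib_right mult.assoc)
  have ip_right: "ip c (comb a x) = (\<Sum>p\<in>\<Xi>. cnj (a p) * ip c (x p))" for a x c
    by (simp add: ip_def comb_def sform_sum_right distrib_left sum.distrib) (simp only: sum_distrib_left mult_ac)
  define U :: "idx \<Rightarrow> idx \<Rightarrow> complex" where "U \<nu> i = of_bool (i = \<nu>)" for \<nu> i
  define x :: "idx \<Rightarrow> vec" where "x \<mu> = (of_bool (\<mu> = 0), U (\<mu> - e1), U (\<mu> - e2))" for \<mu>
  define y :: "idx \<Rightarrow> vec" where "y \<mu> = (f \<mu>, U \<mu>, U \<mu>)" for \<mu>
  have sU: "sform \<Xi> k (U \<mu>) d = (if \<mu> \<in> \<Xi> then (\<Sum>j\<in>\<Xi>. k \<mu> j * cnj (d j)) else 0)" for k \<mu> d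
  proof -
    have "sform \<Xi> k (U \<mu>) d = (\<Sum>i\<in>\<Xi>. if i = \<mu> then (\<Sum>j\<in>\<Xi>. k \<mu> j * cnj (d j)) else 0)"
      unfolding sform_def U_def by (intro sum.cong) auto
    then show ?thesis using \<Xi> by simp
  qed
  have sUU: "sform \<Xi> k (U \<mu>) (U \<nu>) = (if \<mu> \<in> \<Xi> \<and> \<nu> \<in> \<Xi> then k \<mu> \<nu> else 0)" for k \<mu> \<nu>
  proof -
    have "(\<Sum>j\<in>\<Xi>. k \<mu> j * cnj (U \<nu> j)) = (\<Sum>j\<in>\<Xi>. if j = \<nu> then k \<mu> \<nu> else 0)"
      unfolding U_def by (intro sum.cong) auto
    then show ?thesis unfolding sU using \<Xi> by simp
  qed
  have gram: "ip (x \<mu>) (x \<nu>) = ip (y \<mu>) (y \<nu>)" if ab: "\<mu> \<in> \<Xi>" "\<nu> \<in> \<Xi>" for \<mu> \<nu>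
  proof -
    have "sform \<Xi> k1 (U (\<mu> - e1)) (U (\<nu> - e1)) = k1 (\<mu> - e1) (\<nu> - e1)"
      "sform \<Xi> k2 (U (\<mu> - e2)) (U (\<nu> - e2)) = k2 (\<mu> - e2) (\<nu> - e2)"
      using down[OF ab(1)] down[OF ab(2)] k_out[of "\<mu> - e1" "\<nu> - e1"] k_out[of "\<mu> - e2" "\<nu> - e2"]
      unfolding sUU by auto
    then show ?thesis using ab agler[of \<mu> \<nu>] by (auto simp: ip_def x_def y_def sUU algebra_simps)
  qed
  obtain t where t: "\<And>i s. s \<in> \<Xi> \<Longrightarrow> ip i (y s) = (\<Sum>r\<in>\<Xi>. t i r * ip (y r) (y s))"
    using projection_exists[OF ip \<Xi>, of y] by blast
  \<comment> \<open>The coefficients t are determined only up to vectors of norm 0, so W is linear only modulo such vectors; semi-inner products do not see the difference.\<close>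
  define W where "W i = comb (t i) x" for i
  have WW: "ip (W i) (W j) = (\<Sum>r\<in>\<Xi>. \<Sum>s\<in>\<Xi>. t i r * ip (y r) (y s) * cnj (t j s))" for i j
  proof -
    have "ip (W i) (W j) = (\<Sum>r\<in>\<Xi>. t i r * (\<Sum>s\<in>\<Xi>. cnj (t j s) * ip (x r) (x s)))"
      by (simp only: W_def ip_left) (simp only: ip_right)
    also have "\<dots> = (\<Sum>r\<in>\<Xi>. \<Sum>s\<in>\<Xi>. t i r * ip (y r) (y s) * cnj (t j s))"
      unfolding sum_distrib_left by (intro sum.cong refl) (simp add: gram)
    finally show ?thesis .
  qed
  have contr: "psd (\<lambda>i j. ip i j - ip (W i) (W j))"
  proof -
    note r = residual_kernel[OF ip \<Xi>, of y t, OF t]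
    have "(\<lambda>i j. ip i j - ip (W i) (W j)) = (\<lambda>i j. ip i j - (\<Sum>r\<in>\<Xi>. t i r * ip (y r) j))"
      by (intro ext) (simp only: WW, rule r(3)[symmetric])
    then show ?thesis using r(1) by simp
  qed
  have adj: "ip (x \<mu>) (W i) = ip (y \<mu>) i" if a: "\<mu> \<in> \<Xi>" for \<mu> i
  proof -
    have *: "ip (x \<mu>) (x s) = cnj (ip (y s) (y \<mu>))" if "s \<in> \<Xi>" for s
      using gram[OF a that] psd_hermitian[OF ip, of "y \<mu>" "y s"] by simp
    have "ip (x \<mu>) (W i) = (\<Sum>s\<in>\<Xi>. cnj (t i s) * ip (x \<mu>) (x s))" by (simp only: W_def ip_right)
    also have "\<dots> = (\<Sum>s\<in>\<Xi>. cnj (t i s) * cnj (ip (y s) (y \<mu>)))"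
      by (intro sum.cong refl) (simp add: *)
    also have "\<dots> = cnj (ip i (y \<mu>))" by (subst t[OF a]) simp
    finally show ?thesis using psd_hermitian[OF ip, of "y \<mu>" i] by simp
  qed
  define w where "w = left_vector W"
  have w_out: "w \<nu> = (0, \<lambda>_. 0, \<lambda>_. 0)" if "\<nu> \<notin> quadrant" for \<nu>
    using that unfolding w_def by (subst left_vector.simps) simp
  define s :: "idx \<Rightarrow> vec" where "s \<nu> = (of_bool (\<nu> = 0), fst (snd (w (\<nu> - e1))), snd (snd (w (\<nu> - e2))))" for \<nu>
  have w_in: "w \<nu> = W (s \<nu>)" if "\<nu> \<in> quadrant" for \<nu>
    using that unfolding w_def s_def by (subst left_vector.simps) simp
  define l1 where "l1 \<mu> \<nu> = sform \<Xi> k1 (U \<mu>) (fst (snd (w \<nu>)))" for \<mu> \<nu>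
  define l2 where "l2 \<mu> \<nu> = sform \<Xi> k2 (U \<mu>) (snd (snd (w \<nu>)))" for \<mu> \<nu>
  define m1 where "m1 \<mu> \<nu> = sform \<Xi> k1 (fst (snd (w \<nu>))) (fst (snd (w \<mu>)))" for \<mu> \<nu>
  define m2 where "m2 \<mu> \<nu> = sform \<Xi> k2 (snd (snd (w \<nu>))) (snd (snd (w \<mu>)))" for \<mu> \<nu>
  define q where "q \<nu> = cnj (fst (w \<nu>))" for \<nu>
  have s_zero: "sform \<Xi> k (\<lambda>_. 0) d = 0" "sform \<Xi> k d (\<lambda>_. 0) = 0" for k d by (simp_all add: sform_def)
  have out: "\<xi> - e1 \<notin> quadrant" "\<xi> - e2 \<notin> quadrant" "\<xi> \<noteq> 0" if "\<xi> \<notin> quadrant" for \<xi>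
    using that by (auto simp: quadrant_def)
  have cs: "(cmod (\<Sum>\<mu>\<in>X. \<Sum>\<nu>\<in>Y. c \<mu> * d \<nu> * sform \<Xi> k (U \<mu>) (v \<nu>)))\<^sup>2
      \<le> Re (sform X k c c) * Re (sform Y (\<lambda>\<mu> \<nu>. sform \<Xi> k (v \<nu>) (v \<mu>)) d d)"
    if k: "psd (sform \<Xi> k)" and X: "finite X" "X \<subseteq> \<Xi>" and Y: "finite Y" for X Y c d k and v :: "idx \<Rightarrow> idx \<Rightarrow> complex"
  proof -
    define a where "a = (\<lambda>i. \<Sum>\<mu>\<in>X. c \<mu> * U \<mu> i)"
    define b where "b = (\<lambda>i. \<Sum>\<nu>\<in>Y. cnj (d \<nu>) * v \<nu> i)"
    have "sform \<Xi> k a b = (\<Sum>\<mu>\<in>X. \<Sum>\<nu>\<in>Y. c \<mu> * d \<nu> * sform \<Xi> k (U \<mu>) (v \<nu>))"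
      unfolding a_def b_def sform_sum_left sform_sum_right sum_distrib_left by (simp add: mult_ac)
    moreover have "sform \<Xi> k a a = sform X k c c"
    proof -
      have "sform \<Xi> k a a = (\<Sum>\<mu>\<in>X. \<Sum>\<nu>\<in>X. c \<mu> * (cnj (c \<nu>) * sform \<Xi> k (U \<mu>) (U \<nu>)))"
        unfolding a_def sform_sum_left sform_sum_right sum_distrib_left ..
      also have "\<dots> = sform X k c c"
        unfolding sform_def[of X] using X(2) by (intro sum.cong refl) (auto simp: sUU)
      finally show ?thesis .
    qed
    moreover have "sform \<Xi> k b b = sform Y (\<lambda>\<mu> \<nu>. sform \<Xi> k (v \<nu>) (v \<mu>)) d d"
    proof -
      have "sform \<Xi> k b b = (\<Sum>\<nu>\<in>Y. \<Sum>\<mu>\<in>Y. cnj (d \<nu>) * (d \<mu> * sform \<Xi> k (v \<nu>) (v \<mu>)))"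
        unfolding b_def sform_sum_left sform_sum_right sum_distrib_left by simp
      also have "\<dots> = sform Y (\<lambda>\<mu> \<nu>. sform \<Xi> k (v \<nu>) (v \<mu>)) d d"
        unfolding sform_def[of Y] by (subst sum.swap) (intro sum.cong refl, simp)
      finally show ?thesis .
    qed
    ultimately show ?thesis using psd_Cauchy_Schwarz[OF k, of a b] by simp
  qed
  show thesis
  proof (rule that[of m1 m2 q l1 l2])
    show "psd m1" unfolding m1_def[abs_def]
      by (rule psd_transpose[OF psd_pullback[OF s1]])
    show "psd m2" unfolding m2_def[abs_def]
      by (rule psd_transpose[OF psd_pullback[OF s2]])
    let ?N = "\<lambda>\<mu> \<nu>. delta \<mu> \<nu> - q \<mu> * cnj (q \<nu>)
        - diag_diff e1 m1 \<mu> \<nu> - diag_diff e2 m2 \<mu> \<nu>"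
    have N: "?N \<mu> \<nu> = ip (s \<nu>) (s \<mu>) - ip (w \<nu>) (w \<mu>)" for \<mu> \<nu>
      by (simp add: ip_def s_def q_def m1_def m2_def algebra_simps) blast
    have N_out: "?N \<mu> \<nu> = 0" if "\<mu> \<notin> quadrant \<or> \<nu> \<notin> quadrant" for \<mu> \<nu>
      unfolding N using that by (elim disjE) (simp_all add: ip_def s_def w_out out s_zero)
    show "psd ?N"
    proof (rule psd_kernelI)
      fix F :: "idx set" and c assume F: "finite F"
      have "sform F ?N c c = sform (F \<inter> quadrant) ?N c c"
        using F N_out by (intro sform_superset) auto
      also have "\<dots> = sform (F \<inter> quadrant) (\<lambda>\<mu> \<nu>. ip (s \<nu>) (s \<mu>) - ip (W (s \<nu>)) (W (s \<mu>))) c c"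
        unfolding N by (intro sform_cong) (simp add: w_in)
      also have "\<dots> \<in> \<real>\<^sub>\<ge>\<^sub>0"
        using F by (intro psd_kernelD[OF psd_transpose[OF psd_pullback[OF contr, of s]]]) auto
      finally show "sform F ?N c c \<in> \<real>\<^sub>\<ge>\<^sub>0" .
    qed
    show "m1 \<mu> \<nu> = 0 \<and> m2 \<mu> \<nu> = 0" if "\<mu> \<notin> quadrant \<or> \<nu> \<notin> quadrant" for \<mu> \<nu>
      using that by (elim disjE) (simp_all add: m1_def m2_def w_out s_zero)
    show "q \<nu> = 0" if "\<nu> \<notin> quadrant" for \<nu> using that by (simp add: q_def w_out)
    show "l1 \<mu> \<nu> = 0 \<and> l2 \<mu> \<nu> = 0" if "\<mu> \<notin> \<Xi> \<or> \<nu> \<notin> quadrant" for \<mu> \<nu>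
      using that by (elim disjE) (simp_all add: l1_def l2_def w_out s_zero sU)
    show "f \<mu> * of_bool (\<nu> = 0) - of_bool (\<mu> = 0) * q \<nu>
       = cross_diff e1 l1 \<mu> \<nu> + cross_diff e2 l2 \<mu> \<nu>" if a: "\<mu> \<in> \<Xi>" for \<mu> \<nu>
    proof (cases "\<nu> \<in> quadrant")
      case True
      have "ip (x \<mu>) (w \<nu>) = ip (y \<mu>) (s \<nu>)" unfolding w_in[OF True] by (rule adj[OF a])
      then show ?thesis
        by (simp add: ip_def x_def y_def s_def l1_def l2_def q_def algebra_simps)
    next
      case False
      then show ?thesis by (simp add: l1_def l2_def q_def w_out out s_zero)
    qed
    show "(cmod (\<Sum>\<mu>\<in>X. \<Sum>\<nu>\<in>Y. c \<mu> * d \<nu> * l1 \<mu> \<nu>))\<^sup>2 \<le> Re (sform X k1 c c) * Re (sform Y m1 d d)"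
      if "finite X" "X \<subseteq> \<Xi>" "finite Y" for X Y c d
      unfolding l1_def m1_def[abs_def] by (rule cs[OF s1 that])
    show "(cmod (\<Sum>\<mu>\<in>X. \<Sum>\<nu>\<in>Y. c \<mu> * d \<nu> * l2 \<mu> \<nu>))\<^sup>2 \<le> Re (sform X k2 c c) * Re (sform Y m2 d d)"
      if "finite X" "X \<subseteq> \<Xi>" "finite Y" for X Y c d
      unfolding l2_def m2_def[abs_def] by (rule cs[OF s2 that])
  qed
qed

section \<open>Uniform bounds for the coefficients\<close>

text \<open>
  The hypothesis says that mass flows from each exponent to its two upper neighbours and never increases,
  except for one unit entering at the origin. Hence the total mass on each antidiagonal is at most $1$.
\<close>

lemma diagonal_bound:
  fixes p q :: "idx \<Rightarrow> real"
  assumes nonneg: "\<And>\<mu>. 0 \<le> p \<mu>" "\<And>\<mu>. 0 \<le> q \<mu>"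
    and out: "\<And>\<mu>. \<mu> \<notin> quadrant \<Longrightarrow> p \<mu> = 0 \<and> q \<mu> = 0"
    and le: "\<And>\<mu>. p \<mu> + q \<mu> \<le> of_bool (\<mu> = 0) + p (\<mu> - e1) + q (\<mu> - e2)"
  shows "p \<mu> \<le> 1 \<and> q \<mu> \<le> 1"
proof -
  define T where "T n = (\<Sum>a\<le>n. p (int a, int n - int a) + q (int a, int n - int a))" for n :: nat
  have T: "T n \<le> 1" for n
  proof (induction n)
    case 0
    have "p (-1, 0) = 0" "q (0, -1) = 0" using out by (auto simp: quadrant_def)
    then show ?case using le[of "(0, 0)"] by (simp add: T_def zero_prod_def)
  next
    case (Suc n)
    have "T (Suc n) \<le> (\<Sum>a\<le>Suc n. p (int a - 1, int (Suc n) - int a) + q (int a, int n - int a))"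
      unfolding T_def
    proof (rule sum_mono)
      fix a assume "a \<in> {..Suc n}"
      have "(int a, int (Suc n) - int a) \<noteq> 0" by (auto simp: zero_prod_def)
      then show "p (int a, int (Suc n) - int a) + q (int a, int (Suc n) - int a)
          \<le> p (int a - 1, int (Suc n) - int a) + q (int a, int n - int a)"
        using le[of "(int a, int (Suc n) - int a)"] by (simp add: algebra_simps)
    qed
    also have "\<dots> = (\<Sum>a\<le>Suc n. p (int a - 1, int (Suc n) - int a)) + (\<Sum>a\<le>Suc n. q (int a, int n - int a))"
      by (rule sum.distrib)
    also have "(\<Sum>a\<le>Suc n. p (int a - 1, int (Suc n) - int a)) = (\<Sum>a\<le>n. p (int a, int n - int a))"
    proof -
      have "p (-1, 1 + int n) = 0" using out by (auto simp: quadrant_def)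
      then show ?thesis by (subst sum.atMost_Suc_shift) simp
    qed
    also have "(\<Sum>a\<le>Suc n. q (int a, int n - int a)) = (\<Sum>a\<le>n. q (int a, int n - int a))"
    proof -
      have "q (1 + int n, -1) = 0" using out by (auto simp: quadrant_def)
      then show ?thesis by (simp add: algebra_simps)
    qed
    finally show ?case using Suc by (simp add: T_def sum.distrib)
  qed
  show ?thesis
  proof (cases "\<mu> \<in> quadrant")
    case True
    define a b where "a = nat (fst \<mu>)" and "b = nat (snd \<mu>)"
    have ab: "\<mu> = (int a, int b)" using True by (simp add: a_def b_def quadrant_def prod_eq_iff)
    have "p (int a, int (a + b) - int a) + q (int a, int (a + b) - int a) \<le> T (a + b)"
      unfolding T_def by (rule member_le_sum) (auto simp: nonneg add_nonneg_nonneg)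
    then show ?thesis using T[of "a + b"] nonneg[of \<mu>] ab by auto
  next
    case False
    then show ?thesis using out by simp
  qed
qed

section \<open>Power series on the bidisc\<close>

text \<open>
  The value $0$ outside the quadrant lets power series be summed over all exponents.
\<close>

definition mon :: "idx \<Rightarrow> complex \<times> complex \<Rightarrow> complex"
  where "mon \<xi> z = (if \<xi> \<in> quadrant then fst z ^ nat (fst \<xi>) * snd z ^ nat (snd \<xi>) else 0)"

lemma has_sum_quadrant:
  fixes f :: "idx \<Rightarrow> 'a::{comm_monoid_add, topological_space}"
  assumes "\<And>\<xi>. \<xi> \<notin> quadrant \<Longrightarrow> f \<xi> = 0"
  shows "(f has_sum s) UNIV \<longleftrightarrow> ((\<lambda>p. f (int (fst p), int (snd p))) has_sum s) UNIV"
proof -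
  have "(f has_sum s) UNIV \<longleftrightarrow> (f has_sum s) quadrant"
    using assms by (intro has_sum_cong_neutral) auto
  also have "\<dots> \<longleftrightarrow> ((\<lambda>p. f (int (fst p), int (snd p))) has_sum s) UNIV"
    by (rule has_sum_reindex_bij_witness[of _ "\<lambda>p. (int (fst p), int (snd p))" "\<lambda>\<xi>. (nat (fst \<xi>), nat (snd \<xi>))"])
       (auto simp: quadrant_def)
  finally show ?thesis .
qed

lemma geometric_product_summable:
  fixes r s :: real
  assumes "0 \<le> r" "r < 1" "0 \<le> s" "s < 1"
  shows "(\<lambda>p::nat \<times> nat. r ^ fst p * s ^ snd p) summable_on UNIV"
proof -
  have g: "((\<lambda>n. t ^ n) has_sum (1 / (1 - t))) UNIV" if "0 \<le> t" "t < 1" for t :: real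
    using that by (intro sums_nonneg_imp_has_sum geometric_sums) auto
  have "(\<lambda>p::nat \<times> nat. r ^ fst p * s ^ snd p) summable_on UNIV \<times> UNIV"
  proof (rule summable_on_SigmaI)
    show "((\<lambda>y. r ^ fst (x, y) * s ^ snd (x, y)) has_sum (r ^ x * (1 / (1 - s)))) UNIV" for x :: nat
      using has_sum_cmult_right[OF g[of s], of "r ^ x"] assms by simp
    show "(\<lambda>x. r ^ x * (1 / (1 - s))) summable_on UNIV"
      using has_sum_cmult_left[OF g[of r], of "1 / (1 - s)"] assms unfolding summable_on_def by blast
  qed (use assms in auto)
  then show ?thesis by simp
qed

lemma mon_summable:
  assumes "z \<in> bidisc"
  shows "(\<lambda>\<xi>. norm (mon \<xi> z)) summable_on UNIV"
proof -
  have z: "norm (fst z) < 1" "norm (snd z) < 1" using assms by (auto simp: bidisc_def)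
  then obtain s where "((\<lambda>p::nat \<times> nat. norm (fst z) ^ fst p * norm (snd z) ^ snd p) has_sum s) UNIV"
    using geometric_product_summable[of "norm (fst z)" "norm (snd z)"] by (auto simp: summable_on_def)
  then have "((\<lambda>\<xi>. norm (mon \<xi> z)) has_sum s) UNIV"
    by (subst has_sum_quadrant) (auto simp: mon_def quadrant_def norm_mult norm_power)
  then show ?thesis by (auto simp: summable_on_def)
qed

text \<open>
  Cauchy's inequality on circles of radius $r < 1$, with $r \to 1$.
\<close>

lemma disc_power_series:
  assumes holo: "g holomorphic_on ball 0 1" and bd: "\<And>w. w \<in> ball 0 1 \<Longrightarrow> cmod (g w) \<le> 1"
  defines "a \<equiv> \<lambda>n. (deriv ^^ n) g 0 / fact n"
  shows "cmod (a n) \<le> 1" and "w \<in> ball 0 1 \<Longrightarrow> (\<lambda>n. a n * w ^ n) sums g w"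
proof -
  have "cmod (a n) * r ^ n \<le> 1" if r: "0 < r" "r < 1" for r
  proof -
    have "norm ((deriv ^^ n) g 0) \<le> fact n * 1 / r ^ n"
    proof (rule Cauchy_inequality)
      show "g holomorphic_on ball 0 r" using r by (intro holomorphic_on_subset[OF holo]) auto
      show "continuous_on (cball 0 r) g"
        using r by (intro holomorphic_on_imp_continuous_on holomorphic_on_subset[OF holo]) auto
    qed (use r bd in auto)
    then show ?thesis using r by (simp add: a_def norm_divide field_simps)
  qed
  then have ev: "eventually (\<lambda>r. cmod (a n) * r ^ n \<le> 1) (at_left 1)"
    by (intro eventually_at_leftI[of 0]) auto
  have "((\<lambda>r::real. cmod (a n) * r ^ n) \<longlongrightarrow> cmod (a n) * 1 ^ n) (at_left 1)"
    by (intro tendsto_intros)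
  from tendsto_upperbound[OF this ev] show "cmod (a n) \<le> 1" by simp
  show "(\<lambda>n. a n * w ^ n) sums g w" if "w \<in> ball 0 1"
    using holomorphic_power_series[OF holo that] by (simp add: a_def)
qed

lemma power_series_tail:
  fixes a :: "nat \<Rightarrow> complex"
  assumes a: "\<And>n. cmod (a n) \<le> 1" and w: "cmod w < 1" and s: "(\<lambda>n. a n * w ^ n) sums s"
  shows "cmod (s - (\<Sum>n<N. a n * w ^ n)) \<le> cmod w ^ N / (1 - cmod w)"
proof -
  have s': "(\<lambda>n. a (n + N) * w ^ (n + N)) sums (s - (\<Sum>n<N. a n * w ^ n))"
    using s by (subst sums_iff_shift) simp
  have g: "(\<lambda>n. cmod w ^ N * cmod w ^ n) sums (cmod w ^ N * (1 / (1 - cmod w)))"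
    using w by (intro sums_mult geometric_sums) auto
  have "norm (a (n + N) * w ^ (n + N)) \<le> cmod w ^ N * cmod w ^ n" for n
    using mult_right_mono[OF a[of "n + N"], of "cmod w ^ (n + N)"]
    by (simp add: norm_mult norm_power power_add mult_ac)
  then have "norm (\<Sum>n. a (n + N) * w ^ (n + N)) \<le> (\<Sum>n. cmod w ^ N * cmod w ^ n)"
    using g by (intro norm_suminf_le) (auto simp: sums_iff)
  then show ?thesis using s' g by (simp add: sums_iff)
qed

text \<open>
  Expand in the first variable with coefficients $A_n(v)$, and then each $A_n$ in the second variable. The
  coefficient $A_n$ is holomorphic because it is the uniform limit, as $w \to 0$, of
  $(f(w, v) - \sum_{m<n} A_m(v) w^m) / w^n$; since all $|A_m| \le 1$, the error is at most
  $|w| / (1 - |w|)$.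
\<close>

lemma bidisc_power_series:
  assumes holo: "holomorphic2_on f bidisc" and f: "f ` bidisc \<subseteq> ball 0 1"
  obtains c where "\<And>\<xi>. cmod (c \<xi>) \<le> 1" "\<And>\<xi>. \<xi> \<notin> quadrant \<Longrightarrow> c \<xi> = 0"
    "\<And>z. z \<in> bidisc \<Longrightarrow> ((\<lambda>\<xi>. c \<xi> * mon \<xi> z) has_sum f z) UNIV"
proof -
  have bd: "cmod (f (u, v)) \<le> 1" if "u \<in> ball 0 1" "v \<in> ball 0 1" for u v
    using f that by (force simp: bidisc_def)
  have h1: "(\<lambda>u. f (u, v)) holomorphic_on ball 0 1" if v: "v \<in> ball 0 1" for v
  proof (rule holomorphic_onI)
    fix u :: complex assume u: "u \<in> ball 0 1"
    obtain a b where D: "(f has_derivative (\<lambda>(h1, h2). a * h1 + b * h2)) (at (u, v))"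
      using holo u v unfolding holomorphic2_on_def bidisc_def by blast
    have "((\<lambda>u. (u, v)) has_derivative (\<lambda>h. (h, 0))) (at u)" by (auto intro!: derivative_eq_intros)
    from has_derivative_compose[OF this D] have "((\<lambda>u. f (u, v)) has_derivative (\<lambda>h. a * h)) (at u)" by simp
    then have "((\<lambda>u. f (u, v)) has_field_derivative a) (at u)" by (simp add: has_field_derivative_def)
    then show "(\<lambda>u. f (u, v)) field_differentiable at u within ball 0 1"
      using field_differentiable_def field_differentiable_at_within by blast
  qed
  have h2: "(\<lambda>v. f (u, v)) holomorphic_on ball 0 1" if u: "u \<in> ball 0 1" for u
  proof (rule holomorphic_onI)
    fix v :: complex assume v: "v \<in> ball 0 1"
    obtain a b where D: "(f has_derivative (\<lambda>(h1, h2). a * h1 + b * h2)) (at (u, v))"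
      using holo u v unfolding holomorphic2_on_def bidisc_def by blast
    have "((\<lambda>v. (u, v)) has_derivative (\<lambda>h. (0, h))) (at v)" by (auto intro!: derivative_eq_intros)
    from has_derivative_compose[OF this D] have "((\<lambda>v. f (u, v)) has_derivative (\<lambda>h. b * h)) (at v)" by simp
    then have "((\<lambda>v. f (u, v)) has_field_derivative b) (at v)" by (simp add: has_field_derivative_def)
    then show "(\<lambda>v. f (u, v)) field_differentiable at v within ball 0 1"
      using field_differentiable_def field_differentiable_at_within by blast
  qed
  define A where "A n v = (deriv ^^ n) (\<lambda>u. f (u, v)) 0 / fact n" for n v
  have A_bd: "cmod (A n v) \<le> 1" if "v \<in> ball 0 1" for n v
    unfolding A_def using disc_power_series(1)[OF h1[OF that]] bd that by blast
  have A_sums: "(\<lambda>n. A n v * u ^ n) sums f (u, v)" if "u \<in> ball 0 1" "v \<in> ball 0 1" for u v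
    unfolding A_def using disc_power_series(2)[OF h1[OF that(2)] _ that(1)] bd that by blast
  have A_holo: "A n holomorphic_on ball 0 1" for n
  proof (induction n rule: less_induct)
    case (less n)
    define w :: "nat \<Rightarrow> complex" where "w k = of_real (1 / real (k + 2))" for k
    have cw: "cmod (w k) = 1 / real (k + 2)" for k unfolding w_def norm_of_real by simp
    have w: "w k \<noteq> 0" "cmod (w k) = 1 / real (k + 2)" "cmod (w k) \<le> 1 / 2" for k
    proof -
      have "0 < 1 / real (k + 2)" "1 / real (k + 2) \<le> 1 / 2" by (simp, intro frac_le) auto
      then show "w k \<noteq> 0" "cmod (w k) \<le> 1 / 2" using cw[of k] by (metis norm_zero less_irrefl, simp only:)
    qed (rule cw)
    define h where "h k v = (f (w k, v) - (\<Sum>m<n. A m v * w k ^ m)) / w k ^ n" for k v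
    show ?case
    proof (rule holomorphic_uniform_sequence[of _ h])
      show "h k holomorphic_on ball 0 1" for k
        unfolding h_def using less w[of k] by (intro holomorphic_intros h2) auto
      fix x :: complex assume x: "x \<in> ball 0 1"
      have dist: "dist (h k v) (A n v) \<le> 2 * (1 / real (k + 2))" if v: "v \<in> ball 0 1" for k v
      proof -
        have "cmod (f (w k, v) - (\<Sum>m<Suc n. A m v * w k ^ m)) \<le> cmod (w k) ^ Suc n / (1 - cmod (w k))"
          using w[of k] v by (intro power_series_tail A_bd A_sums) auto
        also have "\<dots> \<le> cmod (w k) ^ Suc n / (1 / 2)" using w[of k] by (intro divide_left_mono) auto
        finally have "cmod (f (w k, v) - (\<Sum>m<Suc n. A m v * w k ^ m)) / cmod (w k) ^ n \<le> 2 * cmod (w k)"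
          using w(1)[of k] by (simp add: pos_divide_le_eq mult_ac del: sum.lessThan_Suc)
        moreover have "h k v - A n v = (f (w k, v) - (\<Sum>m<Suc n. A m v * w k ^ m)) / w k ^ n"
          using w(1)[of k] by (simp add: h_def field_simps)
        ultimately show ?thesis using w(2)[of k] by (simp add: dist_norm norm_divide norm_power)
      qed
      obtain d where d: "d > 0" "cball x d \<subseteq> ball 0 1" using x open_contains_cball open_ball by blast
      have "uniform_limit (cball x d) h (A n) sequentially"
      proof (rule uniform_limitI)
        fix e :: real assume "e > 0"
        have "(\<lambda>k. 2 * (1 / real (k + 2))) \<longlonglongrightarrow> 0"
          by (intro tendsto_mult_right_zero LIMSEQ_ignore_initial_segment[OF lim_1_over_n])
        then have "\<forall>\<^sub>F k in sequentially. 2 * (1 / real (k + 2)) < e"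
          using \<open>e > 0\<close> by (rule order_tendstoD)
        then show "\<forall>\<^sub>F k in sequentially. \<forall>v\<in>cball x d. dist (h k v) (A n v) < e"
          by eventually_elim (use d dist in \<open>blast intro: le_less_trans\<close>)
      qed
      then show "\<exists>d>0. cball x d \<subseteq> ball 0 1 \<and> uniform_limit (cball x d) h (A n) sequentially"
        using d by blast
    qed simp
  qed
  define C where "C n m = (deriv ^^ m) (A n) 0 / fact m" for n m
  have C_bd: "cmod (C n m) \<le> 1" for n m
    unfolding C_def using disc_power_series(1)[OF A_holo] A_bd by blast
  have C_sums: "(\<lambda>m. C n m * v ^ m) sums A n v" if "v \<in> ball 0 1" for n v
    unfolding C_def using disc_power_series(2)[OF A_holo _ that] A_bd by blast
  define c where "c \<xi> = (if \<xi> \<in> quadrant then C (nat (fst \<xi>)) (nat (snd \<xi>)) else 0)" for \<xi>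
  show thesis
  proof (rule that[of c])
    show "cmod (c \<xi>) \<le> 1" for \<xi> using C_bd by (simp add: c_def)
    show "c \<xi> = 0" if "\<xi> \<notin> quadrant" for \<xi> using that by (simp add: c_def)
    fix z assume z: "z \<in> bidisc"
    define u v where "u = fst z" and "v = snd z"
    have uv: "u \<in> ball 0 1" "v \<in> ball 0 1" "z = (u, v)" using z by (auto simp: u_def v_def bidisc_def)
    have sumn: "summable (\<lambda>m. norm (b m * x ^ m))" if "\<And>m. cmod (b m) \<le> 1" "x \<in> ball 0 1" for b :: "nat \<Rightarrow> complex" and x
    proof (rule summable_comparison_test')
      show "summable (\<lambda>m. cmod x ^ m)" using that(2) by (simp add: summable_geometric)
      show "norm (norm (b m * x ^ m)) \<le> cmod x ^ m" for m
        using mult_right_mono[OF that(1)[of m], of "cmod x ^ m"] by (simp add: norm_mult norm_power)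
    qed
    have "((\<lambda>p. C (fst p) (snd p) * (u ^ fst p * v ^ snd p)) has_sum f z) (UNIV \<times> UNIV)"
    proof (rule has_sum_SigmaI)
      fix n
      have "((\<lambda>m. C n m * v ^ m) has_sum A n v) UNIV"
        by (rule norm_summable_imp_has_sum[OF sumn C_sums]) (use C_bd uv in auto)
      from has_sum_cmult_right[OF this, of "u ^ n"]
      show "((\<lambda>m. C (fst (n, m)) (snd (n, m)) * (u ^ fst (n, m) * v ^ snd (n, m))) has_sum u ^ n * A n v) UNIV"
        by (simp add: mult_ac)
    next
      have "((\<lambda>n. A n v * u ^ n) has_sum f (u, v)) UNIV"
        by (rule norm_summable_imp_has_sum[OF sumn A_sums]) (use A_bd uv in auto)
      then show "((\<lambda>n. u ^ n * A n v) has_sum f z) UNIV" using uv(3) by (simp add: mult.commute)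
    next
      have "(\<lambda>p. norm (C (fst p) (snd p) * (u ^ fst p * v ^ snd p))) summable_on UNIV"
      proof (rule summable_on_comparison_test)
        show "(\<lambda>p::nat \<times> nat. norm u ^ fst p * norm v ^ snd p) summable_on UNIV"
          using uv by (intro geometric_product_summable) auto
        show "norm (C (fst p) (snd p) * (u ^ fst p * v ^ snd p)) \<le> norm u ^ fst p * norm v ^ snd p" for p
          using mult_right_mono[OF C_bd[of "fst p" "snd p"], of "norm u ^ fst p * norm v ^ snd p"]
          by (simp add: norm_mult norm_power)
      qed auto
      then show "(\<lambda>p. C (fst p) (snd p) * (u ^ fst p * v ^ snd p)) summable_on UNIV \<times> UNIV"
        using abs_summable_summable by fastforce
    qed
    then show "((\<lambda>\<xi>. c \<xi> * mon \<xi> z) has_sum f z) UNIV"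
      by (subst has_sum_quadrant) (auto simp: c_def mon_def quadrant_def u_def v_def)
  qed
qed

section \<open>Approximation and passage to the limit\<close>

text \<open>
  A partial sum of $f(rz)$ that is uniformly within $e$ of $f(rz)$ on the torus, divided by $1 + e$.
\<close>

lemma polynomial_approximant:
  assumes c: "\<And>\<xi>. cmod (c \<xi>) \<le> 1" "\<And>\<xi>. \<xi> \<notin> quadrant \<Longrightarrow> c \<xi> = 0"
    and s: "\<And>z. z \<in> bidisc \<Longrightarrow> ((\<lambda>\<xi>. c \<xi> * mon \<xi> z) has_sum f z) UNIV"
    and f: "f ` bidisc \<subseteq> ball 0 1"
    and r: "0 < r" "r < 1" and e: "0 < e" and B: "finite B"
  obtains \<Gamma> where "finite \<Gamma>" "B \<subseteq> \<Gamma>"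
    "\<And>u v. cmod u = 1 \<Longrightarrow> cmod v = 1 \<Longrightarrow>
       cmod (\<Sum>\<xi>\<in>\<Gamma>. c \<xi> * mon \<xi> (of_real r, of_real r) / of_real (1 + e) * (u powi fst \<xi> * v powi snd \<xi>)) \<le> 1"
proof -
  define \<rho> :: "complex \<times> complex" where "\<rho> = (of_real r, of_real r)"
  have \<rho>: "\<rho> \<in> bidisc" using r by (simp add: \<rho>_def bidisc_def)
  obtain S where S: "((\<lambda>\<xi>. norm (mon \<xi> \<rho>)) has_sum S) UNIV"
    using mon_summable[OF \<rho>] by (auto simp: summable_on_def)
  then have "eventually (\<lambda>X. dist (\<Sum>\<xi>\<in>X. norm (mon \<xi> \<rho>)) S < e) (finite_subsets_at_top UNIV)"
    using e unfolding has_sum_def by (rule tendstoD)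
  then obtain X where X: "finite X" "\<And>Y. finite Y \<Longrightarrow> X \<subseteq> Y \<Longrightarrow> dist (\<Sum>\<xi>\<in>Y. norm (mon \<xi> \<rho>)) S < e"
    unfolding eventually_finite_subsets_at_top by auto
  define \<Gamma> where "\<Gamma> = X \<union> B"
  have \<Gamma>: "finite \<Gamma>" using X B by (simp add: \<Gamma>_def)
  have tail: "((\<lambda>\<xi>. norm (mon \<xi> \<rho>)) has_sum (S - (\<Sum>\<xi>\<in>\<Gamma>. norm (mon \<xi> \<rho>)))) (UNIV - \<Gamma>)"
    by (rule has_sum_Diff[OF S]) (use \<Gamma> in auto)
  have tail_le: "S - (\<Sum>\<xi>\<in>\<Gamma>. norm (mon \<xi> \<rho>)) \<le> e"
    using X(2)[OF \<Gamma>] by (auto simp: \<Gamma>_def dist_real_def)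
  show thesis
  proof (rule that[of \<Gamma>])
    show "finite \<Gamma>" "B \<subseteq> \<Gamma>" using \<Gamma> by (auto simp: \<Gamma>_def)
    fix u v :: complex assume uv: "cmod u = 1" "cmod v = 1"
    define z where "z = (of_real r * u, of_real r * v)"
    have z: "z \<in> bidisc" using uv r by (simp add: z_def bidisc_def norm_mult)
    have mz: "mon \<xi> z = mon \<xi> \<rho> * (u powi fst \<xi> * v powi snd \<xi>)" for \<xi>
    proof (cases "\<xi> \<in> quadrant")
      case True
      then show ?thesis
        by (simp add: mon_def z_def \<rho>_def power_mult_distrib power_int_def quadrant_def)
    qed (simp add: mon_def)
    have nz: "norm (mon \<xi> z) = norm (mon \<xi> \<rho>)" for \<xi>
      using uv by (simp add: mz norm_mult norm_power_int)
    have "((\<lambda>\<xi>. c \<xi> * mon \<xi> z) has_sum (f z - (\<Sum>\<xi>\<in>\<Gamma>. c \<xi> * mon \<xi> z))) (UNIV - \<Gamma>)"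
      by (rule has_sum_Diff[OF s[OF z]]) (use \<Gamma> in auto)
    then have "norm (f z - (\<Sum>\<xi>\<in>\<Gamma>. c \<xi> * mon \<xi> z)) \<le> S - (\<Sum>\<xi>\<in>\<Gamma>. norm (mon \<xi> \<rho>))"
    proof (rule norm_infsum_le)
      show "((\<lambda>\<xi>. norm (mon \<xi> \<rho>)) has_sum (S - (\<Sum>\<xi>\<in>\<Gamma>. norm (mon \<xi> \<rho>)))) (UNIV - \<Gamma>)" by (rule tail)
      show "norm (c \<xi> * mon \<xi> z) \<le> norm (mon \<xi> \<rho>)" for \<xi>
        using mult_right_mono[OF c(1)[of \<xi>], of "norm (mon \<xi> \<rho>)"] by (simp add: norm_mult nz)
    qed
    then have "norm (f z - (\<Sum>\<xi>\<in>\<Gamma>. c \<xi> * mon \<xi> z)) \<le> e" using tail_le by simp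
    moreover have "norm (f z) \<le> 1" using f z by force
    ultimately have le: "norm (\<Sum>\<xi>\<in>\<Gamma>. c \<xi> * mon \<xi> z) \<le> 1 + e"
      using norm_triangle_sub[of "\<Sum>\<xi>\<in>\<Gamma>. c \<xi> * mon \<xi> z" "f z"] by (simp add: norm_minus_commute)
    have "(\<Sum>\<xi>\<in>\<Gamma>. c \<xi> * mon \<xi> (of_real r, of_real r) / of_real (1 + e) * (u powi fst \<xi> * v powi snd \<xi>))
       = (\<Sum>\<xi>\<in>\<Gamma>. c \<xi> * mon \<xi> z) / of_real (1 + e)"
      unfolding sum_divide_distrib mz \<rho>_def by (intro sum.cong refl) simp
    then show "cmod (\<Sum>\<xi>\<in>\<Gamma>. c \<xi> * mon \<xi> (of_real r, of_real r) / of_real (1 + e) * (u powi fst \<xi> * v powi snd \<xi>)) \<le> 1"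
      using le e by (simp only: norm_divide norm_of_real) (simp add: divide_le_eq_1)
  qed
qed

text \<open>
  The Cauchy--Schwarz inequality in a form that survives limits, with no reference to the vectors
  behind the kernels.
\<close>

definition dominated where
  "dominated \<Xi> k m l \<longleftrightarrow> (\<forall>X Y c d. finite X \<longrightarrow> X \<subseteq> \<Xi> \<longrightarrow> finite Y \<longrightarrow>
     (cmod (\<Sum>\<mu>\<in>X. \<Sum>\<nu>\<in>Y. c \<mu> * d \<nu> * l \<mu> \<nu>))\<^sup>2 \<le> Re (sform X k c c) * Re (sform Y m d d))"

text \<open>
  Everything that has to pass to the limit. In the limit $\Xi$ is the set of all exponents. The
  function $q$ comes from the left and stands for $f$; the difference identity on the diagonal
  $z = \zeta$ forces the two to agree. The bound $2$ gives compactness of the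
  sequence of data and convergence of the power series.
\<close>

definition Agler_data where
  "Agler_data \<Xi> f k1 k2 m1 m2 l1 l2 q \<longleftrightarrow>
     psd k1 \<and> psd k2 \<and> psd m1 \<and> psd m2 \<and>
     psd (\<lambda>\<mu> \<nu> :: idx. delta \<mu> \<nu> - q \<mu> * cnj (q \<nu>)
        - diag_diff e1 m1 \<mu> \<nu> - diag_diff e2 m2 \<mu> \<nu>) \<and>
     (\<forall>\<mu> \<nu>. \<forall>x\<in>{k1 \<mu> \<nu>, k2 \<mu> \<nu>, m1 \<mu> \<nu>, m2 \<mu> \<nu>, l1 \<mu> \<nu>, l2 \<mu> \<nu>, q \<nu>}. cmod x \<le> 2) \<and>
     (\<forall>\<mu> \<nu>. \<mu> \<notin> quadrant \<or> \<nu> \<notin> quadrant \<longrightarrow>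
        (\<forall>x\<in>{k1 \<mu> \<nu>, k2 \<mu> \<nu>, m1 \<mu> \<nu>, m2 \<mu> \<nu>, l1 \<mu> \<nu>, l2 \<mu> \<nu>}. x = 0)) \<and>
     (\<forall>\<nu>. \<nu> \<notin> quadrant \<longrightarrow> q \<nu> = 0) \<and>
     (\<forall>\<mu> \<nu>. delta \<mu> \<nu> - f \<mu> * cnj (f \<nu>)
            = diag_diff e1 k1 \<mu> \<nu> + diag_diff e2 k2 \<mu> \<nu>) \<and>
     (\<forall>\<mu>\<in>\<Xi>. \<forall>\<nu>. f \<mu> * of_bool (\<nu> = 0) - of_bool (\<mu> = 0) * q \<nu>
       = cross_diff e1 l1 \<mu> \<nu> + cross_diff e2 l2 \<mu> \<nu>) \<and>
     dominated \<Xi> k1 m1 l1 \<and> dominated \<Xi> k2 m2 l2"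

lemma Agler_dataD:
  assumes "Agler_data \<Xi> f k1 k2 m1 m2 l1 l2 q"
  shows "psd k1" "psd k2" "psd m1" "psd m2"
    "psd (\<lambda>\<mu> \<nu> :: idx. delta \<mu> \<nu> - q \<mu> * cnj (q \<nu>)
        - diag_diff e1 m1 \<mu> \<nu> - diag_diff e2 m2 \<mu> \<nu>)"
    "cmod (k1 \<mu> \<nu>) \<le> 2" "cmod (k2 \<mu> \<nu>) \<le> 2" "cmod (m1 \<mu> \<nu>) \<le> 2" "cmod (m2 \<mu> \<nu>) \<le> 2"
    "cmod (l1 \<mu> \<nu>) \<le> 2" "cmod (l2 \<mu> \<nu>) \<le> 2" "cmod (q \<nu>) \<le> 2"
    "\<mu> \<notin> quadrant \<or> \<nu> \<notin> quadrant \<Longrightarrow> k1 \<mu> \<nu> = 0 \<and> k2 \<mu> \<nu> = 0 \<and> m1 \<mu> \<nu> = 0 \<and> m2 \<mu> \<nu> = 0 \<and> l1 \<mu> \<nu> = 0 \<and> l2 \<mu> \<nu> = 0"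
    "\<nu> \<notin> quadrant \<Longrightarrow> q \<nu> = 0"
    "delta \<mu> \<nu> - f \<mu> * cnj (f \<nu>)
            = diag_diff e1 k1 \<mu> \<nu> + diag_diff e2 k2 \<mu> \<nu>"
    "\<mu> \<in> \<Xi> \<Longrightarrow> f \<mu> * of_bool (\<nu> = 0) - of_bool (\<mu> = 0) * q \<nu>
       = cross_diff e1 l1 \<mu> \<nu> + cross_diff e2 l2 \<mu> \<nu>"
    "dominated \<Xi> k1 m1 l1" "dominated \<Xi> k2 m2 l2"
  using assms unfolding Agler_data_def by blast+

text \<open>
  The Agler identity and its version with defect, restricted to the diagonal, are instances of the
  flow of mass that bounds the diagonals; Cauchy--Schwarz then bounds the other entries.
\<close>

lemma Agler_data_polynomial:
  fixes f :: "idx \<Rightarrow> complex"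
  assumes fin: "finite \<Gamma>" and supp: "\<And>\<xi>. \<xi> \<notin> \<Gamma> \<Longrightarrow> f \<xi> = 0" and quad: "\<And>\<xi>. \<xi> \<notin> quadrant \<Longrightarrow> f \<xi> = 0"
    and bd: "\<And>u v. cmod u = 1 \<Longrightarrow> cmod v = 1 \<Longrightarrow>
               cmod (\<Sum>\<xi>\<in>\<Gamma>. f \<xi> * (u powi fst \<xi> * v powi snd \<xi>)) \<le> 1"
    and \<Xi>: "finite \<Xi>" and down: "\<And>\<mu> e. \<mu> \<in> \<Xi> \<Longrightarrow> e \<in> {e1, e2} \<Longrightarrow> \<mu> - e \<in> quadrant \<Longrightarrow> \<mu> - e \<in> \<Xi>"
  shows "\<exists>k1 k2 m1 m2 l1 l2 q. Agler_data \<Xi> f k1 k2 m1 m2 l1 l2 q"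
proof -
  obtain k1 k2 where k: "psd k1" "psd k2"
    and k_out: "\<And>\<mu> \<nu>. \<mu> \<notin> quadrant \<or> \<nu> \<notin> quadrant \<Longrightarrow> k1 \<mu> \<nu> = 0 \<and> k2 \<mu> \<nu> = 0"
    and agler: "\<And>\<mu> \<nu>. delta \<mu> \<nu> - f \<mu> * cnj (f \<nu>)
            = diag_diff e1 k1 \<mu> \<nu> + diag_diff e2 k2 \<mu> \<nu>"
    using Agler_coefficient_kernels[OF block_kernel_psd[OF fin supp bd] quad] by metis
  show ?thesis
  proof (rule lurking_isometry[OF k k_out agler \<Xi> down])
    fix m1 m2 q l1 l2
    assume m: "psd m1" "psd m2"
    and N: "psd (\<lambda>\<mu> \<nu>. delta \<mu> \<nu> - q \<mu> * cnj (q \<nu>)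
        - diag_diff e1 m1 \<mu> \<nu> - diag_diff e2 m2 \<mu> \<nu>)"
    and m_out: "\<And>\<mu> \<nu>. \<mu> \<notin> quadrant \<or> \<nu> \<notin> quadrant \<Longrightarrow> m1 \<mu> \<nu> = 0 \<and> m2 \<mu> \<nu> = 0"
    and q_out: "\<And>\<nu>. \<nu> \<notin> quadrant \<Longrightarrow> q \<nu> = 0"
    and l_out: "\<And>\<mu> \<nu>. \<mu> \<notin> \<Xi> \<or> \<nu> \<notin> quadrant \<Longrightarrow> l1 \<mu> \<nu> = 0 \<and> l2 \<mu> \<nu> = 0"
    and l_eq: "\<And>\<mu> \<nu>. \<mu> \<in> \<Xi> \<Longrightarrow> f \<mu> * of_bool (\<nu> = 0) - of_bool (\<mu> = 0) * q \<nu>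
       = cross_diff e1 l1 \<mu> \<nu> + cross_diff e2 l2 \<mu> \<nu>"
    and cs1: "\<And>X Y c d. finite X \<Longrightarrow> X \<subseteq> \<Xi> \<Longrightarrow> finite Y \<Longrightarrow>
       (cmod (\<Sum>\<mu>\<in>X. \<Sum>\<nu>\<in>Y. c \<mu> * d \<nu> * l1 \<mu> \<nu>))\<^sup>2 \<le> Re (sform X k1 c c) * Re (sform Y m1 d d)"
    and cs2: "\<And>X Y c d. finite X \<Longrightarrow> X \<subseteq> \<Xi> \<Longrightarrow> finite Y \<Longrightarrow>
       (cmod (\<Sum>\<mu>\<in>X. \<Sum>\<nu>\<in>Y. c \<mu> * d \<nu> * l2 \<mu> \<nu>))\<^sup>2 \<le> Re (sform X k2 c c) * Re (sform Y m2 d d)"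
  have nonneg: "0 \<le> Re (P \<mu> \<mu>)" if "psd P" for P :: "idx \<Rightarrow> idx \<Rightarrow> complex" and \<mu>
    using psd_diag[OF that, of \<mu>] by (simp add: complex_nonneg_Reals_iff)
  have sq: "Re (a * cnj a) = (cmod a)\<^sup>2" for a
    by (metis Re_complex_of_real complex_norm_square)
  have kd: "Re (k1 \<mu> \<mu>) \<le> 1 \<and> Re (k2 \<mu> \<mu>) \<le> 1" for \<mu>
  proof (rule diagonal_bound)
    fix \<mu>
    show "Re (k1 \<mu> \<mu>) + Re (k2 \<mu> \<mu>) \<le> of_bool (\<mu> = 0) + Re (k1 (\<mu> - e1) (\<mu> - e1)) + Re (k2 (\<mu> - e2) (\<mu> - e2))"
    proof -
      have "of_bool (\<mu> = 0) - (cmod (f \<mu>))\<^sup>2 = (Re (k1 \<mu> \<mu>) - Re (k1 (\<mu> - e1) (\<mu> - e1)))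
          + (Re (k2 \<mu> \<mu>) - Re (k2 (\<mu> - e2) (\<mu> - e2)))"
        using arg_cong[OF agler[of \<mu> \<mu>], of Re] sq[of "f \<mu>"]
        by (cases "\<mu> = 0") (simp_all del: times_complex.sel)
      then show ?thesis using zero_le_power2[of "cmod (f \<mu>)"] by linarith
    qed
  qed (use nonneg k k_out in auto)
  have md_le: "(cmod (q \<mu>))\<^sup>2 + Re (m1 \<mu> \<mu>) + Re (m2 \<mu> \<mu>)
      \<le> of_bool (\<mu> = 0) + Re (m1 (\<mu> - e1) (\<mu> - e1)) + Re (m2 (\<mu> - e2) (\<mu> - e2))" for \<mu>
    using nonneg[OF N, of \<mu>] sq[of "q \<mu>"] by (cases "\<mu> = 0") (simp_all del: times_complex.sel)
  have md: "Re (m1 \<mu> \<mu>) \<le> 1 \<and> Re (m2 \<mu> \<mu>) \<le> 1" for \<mu>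
  proof (rule diagonal_bound)
    fix \<mu>
    show "Re (m1 \<mu> \<mu>) + Re (m2 \<mu> \<mu>) \<le> of_bool (\<mu> = 0) + Re (m1 (\<mu> - e1) (\<mu> - e1)) + Re (m2 (\<mu> - e2) (\<mu> - e2))"
      using md_le[of \<mu>] zero_le_power2[of "cmod (q \<mu>)"] by linarith
  qed (use nonneg m m_out in auto)
  have le1: "cmod x \<le> 2" if "(cmod x)\<^sup>2 \<le> a * b" "0 \<le> a" "a \<le> 1" "0 \<le> b" "b \<le> 1" for x a b
  proof -
    have "a * b \<le> 1 * 1" using that by (intro mult_mono) auto
    then have "(cmod x)\<^sup>2 \<le> 2\<^sup>2" using that by simp
    then show ?thesis by (rule power2_le_imp_le) simp
  qed
  have bk: "cmod (k1 \<mu> \<nu>) \<le> 2" "cmod (k2 \<mu> \<nu>) \<le> 2" for \<mu> \<nu>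
    using le1[OF psd_Cauchy_Schwarz[OF k(1)]] le1[OF psd_Cauchy_Schwarz[OF k(2)]] kd nonneg[OF k(1)] nonneg[OF k(2)] by auto
  have bm: "cmod (m1 \<mu> \<nu>) \<le> 2" "cmod (m2 \<mu> \<nu>) \<le> 2" for \<mu> \<nu>
    using le1[OF psd_Cauchy_Schwarz[OF m(1)]] le1[OF psd_Cauchy_Schwarz[OF m(2)]] md nonneg[OF m(1)] nonneg[OF m(2)] by auto
  have ll: "(cmod (l1 \<mu> \<nu>))\<^sup>2 \<le> Re (k1 \<mu> \<mu>) * Re (m1 \<nu> \<nu>)" "(cmod (l2 \<mu> \<nu>))\<^sup>2 \<le> Re (k2 \<mu> \<mu>) * Re (m2 \<nu> \<nu>)" for \<mu> \<nu>
  proof -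
    have "(cmod (l1 \<mu> \<nu>))\<^sup>2 \<le> Re (k1 \<mu> \<mu>) * Re (m1 \<nu> \<nu>) \<and> (cmod (l2 \<mu> \<nu>))\<^sup>2 \<le> Re (k2 \<mu> \<mu>) * Re (m2 \<nu> \<nu>)"
    proof (cases "\<mu> \<in> \<Xi>")
      case True
      then show ?thesis
        using cs1[of "{\<mu>}" "{\<nu>}" "\<lambda>_. 1" "\<lambda>_. 1"] cs2[of "{\<mu>}" "{\<nu>}" "\<lambda>_. 1" "\<lambda>_. 1"] by (simp add: sform_def)
    next
      case False
      then show ?thesis using l_out k m by (simp add: nonneg)
    qed
    then show "(cmod (l1 \<mu> \<nu>))\<^sup>2 \<le> Re (k1 \<mu> \<mu>) * Re (m1 \<nu> \<nu>)" "(cmod (l2 \<mu> \<nu>))\<^sup>2 \<le> Re (k2 \<mu> \<mu>) * Re (m2 \<nu> \<nu>)" by auto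
  qed
  have bl: "cmod (l1 \<mu> \<nu>) \<le> 2" "cmod (l2 \<mu> \<nu>) \<le> 2" for \<mu> \<nu>
    using le1[OF ll(1)] le1[OF ll(2)] kd md nonneg k m by auto
  have bq: "cmod (q \<nu>) \<le> 2" for \<nu>
  proof -
    have "(cmod (q \<nu>))\<^sup>2 \<le> 1 + 1 + 1"
      using md_le[of \<nu>] md[of "\<nu> - e1"] md[of "\<nu> - e2"] nonneg[OF m(1), of \<nu>] nonneg[OF m(2), of \<nu>]
      by (cases "\<nu> = 0") auto
    then have "(cmod (q \<nu>))\<^sup>2 \<le> 2\<^sup>2" by simp
    then show ?thesis by (rule power2_le_imp_le) simp
  qed
  have l_out': "l1 \<mu> \<nu> = 0 \<and> l2 \<mu> \<nu> = 0" if "\<mu> \<notin> quadrant \<or> \<nu> \<notin> quadrant" for \<mu> \<nu>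
    using that ll[of \<mu> \<nu>] k_out[of \<mu> \<mu>] l_out[of \<mu> \<nu>] by auto
  have "Agler_data \<Xi> f k1 k2 m1 m2 l1 l2 q"
    unfolding Agler_data_def
  proof (intro conjI)
    show "\<forall>\<mu> \<nu>. \<forall>x\<in>{k1 \<mu> \<nu>, k2 \<mu> \<nu>, m1 \<mu> \<nu>, m2 \<mu> \<nu>, l1 \<mu> \<nu>, l2 \<mu> \<nu>, q \<nu>}. cmod x \<le> 2"
      using bk bm bl bq by simp
    show "\<forall>\<mu> \<nu>. \<mu> \<notin> quadrant \<or> \<nu> \<notin> quadrant \<longrightarrow>
        (\<forall>x\<in>{k1 \<mu> \<nu>, k2 \<mu> \<nu>, m1 \<mu> \<nu>, m2 \<mu> \<nu>, l1 \<mu> \<nu>, l2 \<mu> \<nu>}. x = 0)"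
      by (intro allI impI) (simp add: k_out m_out l_out')
    show "\<forall>\<mu> \<nu>. delta \<mu> \<nu> - f \<mu> * cnj (f \<nu>)
            = diag_diff e1 k1 \<mu> \<nu> + diag_diff e2 k2 \<mu> \<nu>"
      by (intro allI agler)
    show "\<forall>\<mu>\<in>\<Xi>. \<forall>\<nu>. f \<mu> * of_bool (\<nu> = 0) - of_bool (\<mu> = 0) * q \<nu>
       = cross_diff e1 l1 \<mu> \<nu> + cross_diff e2 l2 \<mu> \<nu>"
      by (intro ballI allI l_eq)
    show "dominated \<Xi> k1 m1 l1" "dominated \<Xi> k2 m2 l2"
      by (simp_all add: dominated_def cs1 cs2)
  qed (use k m N q_out in simp_all)
  then show "\<exists>k1 k2 m1 m2 l1 l2 q. Agler_data \<Xi> f k1 k2 m1 m2 l1 l2 q" by blast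
  qed
qed

text \<open>
  All entries are bounded by $2$, so a diagonal subsequence converges entrywise, and each clause of
  the definition is a closed condition on finitely many entries.
\<close>

lemma Agler_data_limit:
  assumes data: "\<And>n. Agler_data (\<Xi> n) (f n) (k1 n) (k2 n) (m1 n) (m2 n) (l1 n) (l2 n) (q n)"
    and exhaust: "\<And>X. finite X \<Longrightarrow> \<forall>\<^sub>F n in sequentially. X \<subseteq> \<Xi> n"
    and f: "\<And>\<xi>. (\<lambda>n. f n \<xi>) \<longlonglongrightarrow> c \<xi>"
  shows "\<exists>k1 k2 m1 m2 l1 l2 q. Agler_data UNIV c k1 k2 m1 m2 l1 l2 q"
proof -
  \<comment> \<open>The seven families are merged into one, tagged by a number, to extract a common subsequence.\<close>
  define F where "F n x = (case x of (i, \<mu>, \<nu>) \<Rightarrow>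
      if i = 0 then k1 n \<mu> \<nu> else if i = 1 then k2 n \<mu> \<nu> else if i = 2 then m1 n \<mu> \<nu> else if i = 3 then m2 n \<mu> \<nu>
      else if i = 4 then l1 n \<mu> \<nu> else if i = 5 then l2 n \<mu> \<nu> else q n \<nu>)"
    for n and x :: "nat \<times> idx \<times> idx"
  have F2: "cmod (F n x) \<le> 2" for n x
    by (cases x) (simp add: F_def Agler_dataD(6-12)[OF data])
  obtain s where s: "strict_mono s" and lim: "\<And>x. \<exists>l. (\<lambda>n. F (s n) x) \<longlonglongrightarrow> l"
    by (rule function_convergent_subsequence[of UNIV F 2, OF _ F2]) (blast intro: countableI_type)+
  obtain G where G: "\<And>x. (\<lambda>n. F (s n) x) \<longlonglongrightarrow> G x" using lim by metis
  define K1 where "K1 \<mu> \<nu> = G (0, \<mu>, \<nu>)" for \<mu> \<nu>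
  define K2 where "K2 \<mu> \<nu> = G (1, \<mu>, \<nu>)" for \<mu> \<nu>
  define M1 where "M1 \<mu> \<nu> = G (2, \<mu>, \<nu>)" for \<mu> \<nu>
  define M2 where "M2 \<mu> \<nu> = G (3, \<mu>, \<nu>)" for \<mu> \<nu>
  define L1 where "L1 \<mu> \<nu> = G (4, \<mu>, \<nu>)" for \<mu> \<nu>
  define L2 where "L2 \<mu> \<nu> = G (5, \<mu>, \<nu>)" for \<mu> \<nu>
  define Q where "Q \<nu> = G (6, 0, \<nu>)" for \<nu>
  have lims: "(\<lambda>n. k1 (s n) \<mu> \<nu>) \<longlonglongrightarrow> K1 \<mu> \<nu>" "(\<lambda>n. k2 (s n) \<mu> \<nu>) \<longlonglongrightarrow> K2 \<mu> \<nu>"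
    "(\<lambda>n. m1 (s n) \<mu> \<nu>) \<longlonglongrightarrow> M1 \<mu> \<nu>" "(\<lambda>n. m2 (s n) \<mu> \<nu>) \<longlonglongrightarrow> M2 \<mu> \<nu>"
    "(\<lambda>n. l1 (s n) \<mu> \<nu>) \<longlonglongrightarrow> L1 \<mu> \<nu>" "(\<lambda>n. l2 (s n) \<mu> \<nu>) \<longlonglongrightarrow> L2 \<mu> \<nu>"
    "(\<lambda>n. q (s n) \<nu>) \<longlonglongrightarrow> Q \<nu>" for \<mu> \<nu>
    using G[of "(0, \<mu>, \<nu>)"] G[of "(1, \<mu>, \<nu>)"] G[of "(2, \<mu>, \<nu>)"] G[of "(3, \<mu>, \<nu>)"]
      G[of "(4, \<mu>, \<nu>)"] G[of "(5, \<mu>, \<nu>)"] G[of "(6, 0, \<nu>)"]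
    by (simp_all add: F_def K1_def K2_def M1_def M2_def L1_def L2_def Q_def)
  have limf: "(\<lambda>n. f (s n) \<xi>) \<longlonglongrightarrow> c \<xi>" for \<xi>
    using LIMSEQ_subseq_LIMSEQ[OF f s] by (simp add: o_def)
  note data' = Agler_dataD[OF data[of "s _"]]
  have bound: "cmod x \<le> 2" if "(\<lambda>n. y n) \<longlonglongrightarrow> x" "\<And>n. cmod (y n) \<le> 2" for x and y :: "nat \<Rightarrow> complex"
    using Lim_bounded[OF tendsto_norm[OF that(1)], of 0 2] that(2) by simp
  have zero: "x = 0" if "(\<lambda>n. y n) \<longlonglongrightarrow> x" "\<And>n. y n = 0" for x and y :: "nat \<Rightarrow> complex"
    using LIMSEQ_unique[OF that(1)] that(2) by simp
  have in\<Xi>: "\<forall>\<^sub>F n in sequentially. X \<subseteq> \<Xi> (s n)" if "finite X" for X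
    using exhaust[OF that] filterlim_subseq[OF s] by (auto simp: filterlim_iff)
  have "Agler_data UNIV c K1 K2 M1 M2 L1 L2 Q"
    unfolding Agler_data_def
  proof (intro conjI)
    show "psd K1" by (rule psd_kernel_limit[of _ "\<lambda>n. k1 (s n)"]) (rule data' lims)+
    show "psd K2" by (rule psd_kernel_limit[of _ "\<lambda>n. k2 (s n)"]) (rule data' lims)+
    show "psd M1" by (rule psd_kernel_limit[of _ "\<lambda>n. m1 (s n)"]) (rule data' lims)+
    show "psd M2" by (rule psd_kernel_limit[of _ "\<lambda>n. m2 (s n)"]) (rule data' lims)+
    show "psd (\<lambda>\<mu> \<nu>. delta \<mu> \<nu> - Q \<mu> * cnj (Q \<nu>)
        - diag_diff e1 M1 \<mu> \<nu> - diag_diff e2 M2 \<mu> \<nu>)"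
      by (rule psd_kernel_limit[where R = "\<lambda>n \<mu> \<nu>. delta \<mu> \<nu> - q (s n) \<mu> * cnj (q (s n) \<nu>)
        - diag_diff e1 (m1 (s n)) \<mu> \<nu> - diag_diff e2 (m2 (s n)) \<mu> \<nu>", OF data'(5)])
        (intro tendsto_intros lims)
    show "\<forall>\<mu> \<nu>. \<forall>x\<in>{K1 \<mu> \<nu>, K2 \<mu> \<nu>, M1 \<mu> \<nu>, M2 \<mu> \<nu>, L1 \<mu> \<nu>, L2 \<mu> \<nu>, Q \<nu>}. cmod x \<le> 2"
      by (simp add: bound[OF lims(1) data'(6)] bound[OF lims(2) data'(7)] bound[OF lims(3) data'(8)]
        bound[OF lims(4) data'(9)] bound[OF lims(5) data'(10)] bound[OF lims(6) data'(11)] bound[OF lims(7) data'(12)])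
    show "\<forall>\<mu> \<nu>. \<mu> \<notin> quadrant \<or> \<nu> \<notin> quadrant \<longrightarrow>
        (\<forall>x\<in>{K1 \<mu> \<nu>, K2 \<mu> \<nu>, M1 \<mu> \<nu>, M2 \<mu> \<nu>, L1 \<mu> \<nu>, L2 \<mu> \<nu>}. x = 0)"
    proof (intro allI impI)
      fix \<mu> \<nu> :: idx assume ab: "\<mu> \<notin> quadrant \<or> \<nu> \<notin> quadrant"
      show "\<forall>x\<in>{K1 \<mu> \<nu>, K2 \<mu> \<nu>, M1 \<mu> \<nu>, M2 \<mu> \<nu>, L1 \<mu> \<nu>, L2 \<mu> \<nu>}. x = 0"
        using lims(1-6)[of \<mu> \<nu>, THEN zero] data'(13)[OF ab] by simp
    qed
    show "\<forall>\<nu>. \<nu> \<notin> quadrant \<longrightarrow> Q \<nu> = 0" using lims(7)[THEN zero] data'(14) by simp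
    show "\<forall>\<mu> \<nu>. delta \<mu> \<nu> - c \<mu> * cnj (c \<nu>)
            = diag_diff e1 K1 \<mu> \<nu> + diag_diff e2 K2 \<mu> \<nu>"
    proof (intro allI)
      fix \<mu> \<nu>
      have "(\<lambda>n. delta \<mu> \<nu> - f (s n) \<mu> * cnj (f (s n) \<nu>)) \<longlonglongrightarrow> delta \<mu> \<nu> - c \<mu> * cnj (c \<nu>)"
        by (intro tendsto_intros limf)
      moreover have "(\<lambda>n. diag_diff e1 (k1 (s n)) \<mu> \<nu> + diag_diff e2 (k2 (s n)) \<mu> \<nu>)
         \<longlonglongrightarrow> diag_diff e1 K1 \<mu> \<nu> + diag_diff e2 K2 \<mu> \<nu>"
        by (intro tendsto_intros lims)
      moreover have "delta \<mu> \<nu> - f (s n) \<mu> * cnj (f (s n) \<nu>)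
        = diag_diff e1 (k1 (s n)) \<mu> \<nu> + diag_diff e2 (k2 (s n)) \<mu> \<nu>" for n
        by (rule data')
      ultimately show "delta \<mu> \<nu> - c \<mu> * cnj (c \<nu>)
            = diag_diff e1 K1 \<mu> \<nu> + diag_diff e2 K2 \<mu> \<nu>"
        by (simp add: LIMSEQ_unique)
    qed
    show "\<forall>\<mu>\<in>UNIV. \<forall>\<nu>. c \<mu> * of_bool (\<nu> = 0) - of_bool (\<mu> = 0) * Q \<nu>
       = cross_diff e1 L1 \<mu> \<nu> + cross_diff e2 L2 \<mu> \<nu>"
    proof (intro ballI allI)
      fix \<mu> \<nu>
      have 1: "(\<lambda>n. f (s n) \<mu> * of_bool (\<nu> = 0) - of_bool (\<mu> = 0) * q (s n) \<nu>) \<longlonglongrightarrow> c \<mu> * of_bool (\<nu> = 0) - of_bool (\<mu> = 0) * Q \<nu>"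
        by (intro tendsto_intros limf lims)
      have 2: "(\<lambda>n. cross_diff e1 (l1 (s n)) \<mu> \<nu> + cross_diff e2 (l2 (s n)) \<mu> \<nu>)
         \<longlonglongrightarrow> cross_diff e1 L1 \<mu> \<nu> + cross_diff e2 L2 \<mu> \<nu>"
        by (intro tendsto_intros lims)
      have "\<forall>\<^sub>F n in sequentially. f (s n) \<mu> * of_bool (\<nu> = 0) - of_bool (\<mu> = 0) * q (s n) \<nu>
        = cross_diff e1 (l1 (s n)) \<mu> \<nu> + cross_diff e2 (l2 (s n)) \<mu> \<nu>"
      proof -
        have "\<forall>\<^sub>F n in sequentially. {\<mu>} \<subseteq> \<Xi> (s n)" by (rule in\<Xi>) simp
        then show ?thesis by (rule eventually_mono) (rule data'(16), simp)
      qed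
      from tendsto_unique[OF _ Lim_transform_eventually[OF 1 this] 2]
      show "c \<mu> * of_bool (\<nu> = 0) - of_bool (\<mu> = 0) * Q \<nu>
         = cross_diff e1 L1 \<mu> \<nu> + cross_diff e2 L2 \<mu> \<nu>" by simp
    qed
    have CS: "(cmod (\<Sum>\<mu>\<in>X. \<Sum>\<nu>\<in>Y. a \<mu> * b \<nu> * L \<mu> \<nu>))\<^sup>2 \<le> Re (sform X K a a) * Re (sform Y M b b)"
      if lim: "\<And>\<mu> \<nu>. (\<lambda>n. k n \<mu> \<nu>) \<longlonglongrightarrow> K \<mu> \<nu>" "\<And>\<mu> \<nu>. (\<lambda>n. m n \<mu> \<nu>) \<longlonglongrightarrow> M \<mu> \<nu>" "\<And>\<mu> \<nu>. (\<lambda>n. l n \<mu> \<nu>) \<longlonglongrightarrow> L \<mu> \<nu>"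
        and le: "\<And>n. X \<subseteq> \<Xi> (s n) \<Longrightarrow> (cmod (\<Sum>\<mu>\<in>X. \<Sum>\<nu>\<in>Y. a \<mu> * b \<nu> * l n \<mu> \<nu>))\<^sup>2 \<le> Re (sform X (k n) a a) * Re (sform Y (m n) b b)"
        and X: "finite X"
      for K M L :: "idx \<Rightarrow> idx \<Rightarrow> complex" and k m l X Y a b
    proof (rule tendsto_le[OF sequentially_bot])
      show "(\<lambda>n. (cmod (\<Sum>\<mu>\<in>X. \<Sum>\<nu>\<in>Y. a \<mu> * b \<nu> * l n \<mu> \<nu>))\<^sup>2) \<longlonglongrightarrow> (cmod (\<Sum>\<mu>\<in>X. \<Sum>\<nu>\<in>Y. a \<mu> * b \<nu> * L \<mu> \<nu>))\<^sup>2"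
        by (intro tendsto_intros lim)
      show "(\<lambda>n. Re (sform X (k n) a a) * Re (sform Y (m n) b b)) \<longlonglongrightarrow> Re (sform X K a a) * Re (sform Y M b b)"
        unfolding sform_def by (intro tendsto_intros lim)
      show "\<forall>\<^sub>F n in sequentially. (cmod (\<Sum>\<mu>\<in>X. \<Sum>\<nu>\<in>Y. a \<mu> * b \<nu> * l n \<mu> \<nu>))\<^sup>2 \<le> Re (sform X (k n) a a) * Re (sform Y (m n) b b)"
        using in\<Xi>[OF X] by (rule eventually_mono) (rule le)
    qed
    show "dominated UNIV K1 M1 L1" unfolding dominated_def
      by (intro allI impI, rule CS[OF lims(1) lims(3) lims(5)]) (use data'(17) in \<open>simp_all add: dominated_def\<close>)
    show "dominated UNIV K2 M2 L2" unfolding dominated_def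
      by (intro allI impI, rule CS[OF lims(2) lims(4) lims(6)]) (use data'(18) in \<open>simp_all add: dominated_def\<close>)
  qed
  then show ?thesis by blast
qed

section \<open>Generating functions of coefficient kernels\<close>

definition idx_box :: "nat \<Rightarrow> idx set" where "idx_box n = {- int n..int n} \<times> {- int n..int n}"

abbreviation box_pairs where "box_pairs n \<equiv> idx_box n \<times> idx_box n"

lemma finite_idx_box [simp]: "finite (idx_box n)" by (simp add: idx_box_def)

lemma eventually_subset_idx_box:
  assumes "finite X"
  shows "\<forall>\<^sub>F n in sequentially. X \<subseteq> idx_box n"
proof -
  have "\<forall>x\<in>X. \<forall>\<^sub>F n in sequentially. x \<in> idx_box n"
  proof
    fix x :: idx
    show "\<forall>\<^sub>F n in sequentially. x \<in> idx_box n"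
      using eventually_ge_at_top[of "nat \<bar>fst x\<bar> + nat \<bar>snd x\<bar>"]
      by (rule eventually_mono) (auto simp: idx_box_def mem_Times_iff)
  qed
  then show ?thesis using assms by (simp add: subset_eq eventually_ball_finite)
qed

lemma filterlim_idx_box: "filterlim idx_box (finite_subsets_at_top UNIV) sequentially"
  unfolding filterlim_finite_subsets_at_top using eventually_subset_idx_box by auto

lemma filterlim_idx_box_Times: "filterlim (\<lambda>n. box_pairs n) (finite_subsets_at_top UNIV) sequentially"
  unfolding filterlim_finite_subsets_at_top
proof (intro allI impI)
  fix X :: "(idx \<times> idx) set" assume X: "finite X \<and> X \<subseteq> UNIV"
  have "\<forall>\<^sub>F n in sequentially. fst ` X \<union> snd ` X \<subseteq> idx_box n"
    using X by (intro eventually_subset_idx_box) auto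
  then show "\<forall>\<^sub>F n in sequentially. finite (idx_box n \<times> idx_box n) \<and> X \<subseteq> box_pairs n \<and> box_pairs n \<subseteq> UNIV"
    by (rule eventually_mono) (auto simp: image_subset_iff mem_Times_iff)
qed

definition gen :: "(idx \<Rightarrow> idx \<Rightarrow> complex) \<Rightarrow> complex \<times> complex \<Rightarrow> complex \<times> complex \<Rightarrow> complex"
  where "gen C z w = (\<Sum>\<^sub>\<infinity>p. C (fst p) (snd p) * (mon (fst p) z * mon (snd p) w))"

lemma mon_product_summable:
  assumes "z \<in> bidisc" "w \<in> bidisc"
  shows "(\<lambda>p. norm (mon (fst p) z) * norm (mon (snd p) w)) summable_on UNIV"
proof -
  obtain s t where s: "((\<lambda>\<xi>. norm (mon \<xi> z)) has_sum s) UNIV" and t: "((\<lambda>\<xi>. norm (mon \<xi> w)) has_sum t) UNIV"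
    using mon_summable assms by (meson summable_on_def)
  have "(\<lambda>p. norm (mon (fst p) z) * norm (mon (snd p) w)) summable_on UNIV \<times> UNIV"
  proof (rule summable_on_SigmaI)
    show "((\<lambda>\<nu>. norm (mon (fst (\<mu>, \<nu>)) z) * norm (mon (snd (\<mu>, \<nu>)) w)) has_sum norm (mon \<mu> z) * t) UNIV" for \<mu>
      using has_sum_cmult_right[OF t] by simp
    show "(\<lambda>\<mu>. norm (mon \<mu> z) * t) summable_on UNIV"
      using has_sum_cmult_left[OF s] by (auto simp: summable_on_def)
  qed auto
  then show ?thesis by simp
qed

lemma gen_has_sum:
  assumes C: "\<And>\<mu> \<nu>. cmod (C \<mu> \<nu>) \<le> B" and zw: "z \<in> bidisc" "w \<in> bidisc"
  shows "((\<lambda>p. C (fst p) (snd p) * (mon (fst p) z * mon (snd p) w)) has_sum gen C z w) UNIV"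
proof -
  have "(\<lambda>p. norm (C (fst p) (snd p) * (mon (fst p) z * mon (snd p) w))) summable_on UNIV"
  proof (rule summable_on_comparison_test)
    show "(\<lambda>p. B * (norm (mon (fst p) z) * norm (mon (snd p) w))) summable_on UNIV"
      by (intro summable_on_cmult_right mon_product_summable zw)
    show "norm (C (fst p) (snd p) * (mon (fst p) z * mon (snd p) w)) \<le> B * (norm (mon (fst p) z) * norm (mon (snd p) w))" for p
      unfolding norm_mult by (intro mult_right_mono C) auto
  qed auto
  then have "(\<lambda>p. C (fst p) (snd p) * (mon (fst p) z * mon (snd p) w)) summable_on UNIV"
    by (rule abs_summable_summable)
  then show ?thesis unfolding gen_def by simp
qed

lemma gen_LIMSEQ:
  assumes C: "\<And>\<mu> \<nu>. cmod (C \<mu> \<nu>) \<le> B" and zw: "z \<in> bidisc" "w \<in> bidisc"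
  shows "(\<lambda>n. \<Sum>\<mu>\<in>idx_box n. \<Sum>\<nu>\<in>idx_box n. C \<mu> \<nu> * (mon \<mu> z * mon \<nu> w)) \<longlonglongrightarrow> gen C z w"
proof -
  have "(\<lambda>n. \<Sum>p\<in>box_pairs n. C (fst p) (snd p) * (mon (fst p) z * mon (snd p) w)) \<longlonglongrightarrow> gen C z w"
    using gen_has_sum[OF assms] filterlim_idx_box_Times unfolding has_sum_def by (rule filterlim_compose)
  then show ?thesis by (simp add: sum.cartesian_product split_def)
qed

lemma has_sum_LIMSEQ_idx_box:
  assumes "(g has_sum s) (UNIV :: idx set)"
  shows "(\<lambda>n. \<Sum>\<mu>\<in>idx_box n. g \<mu>) \<longlonglongrightarrow> s"
  using assms filterlim_idx_box unfolding has_sum_def by (rule filterlim_compose)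

lemma gen_linear:
  assumes "\<And>\<mu> \<nu>. cmod (C \<mu> \<nu>) \<le> B" "\<And>\<mu> \<nu>. cmod (D \<mu> \<nu>) \<le> B'" and zw: "z \<in> bidisc" "w \<in> bidisc"
  shows "gen (\<lambda>\<mu> \<nu>. C \<mu> \<nu> + D \<mu> \<nu>) z w = gen C z w + gen D z w"
    and "gen (\<lambda>\<mu> \<nu>. C \<mu> \<nu> - D \<mu> \<nu>) z w = gen C z w - gen D z w"
proof -
  note h = gen_has_sum[OF assms(1) zw] gen_has_sum[OF assms(2) zw]
  show "gen (\<lambda>\<mu> \<nu>. C \<mu> \<nu> + D \<mu> \<nu>) z w = gen C z w + gen D z w"
    using infsumI[OF has_sum_add[OF h]] by (simp add: gen_def distrib_right)
  show "gen (\<lambda>\<mu> \<nu>. C \<mu> \<nu> - D \<mu> \<nu>) z w = gen C z w - gen D z w"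
    using infsumI[OF has_sum_add[OF h(1) has_sum_cmult_right[OF h(2), of "-1"]]] by (simp add: gen_def left_diff_distrib)
qed

lemma gen_product:
  assumes ab: "\<And>\<mu>. cmod (a \<mu>) \<le> 2" "\<And>\<nu>. cmod (b \<nu>) \<le> 2" and zw: "z \<in> bidisc" "w \<in> bidisc"
    and s: "((\<lambda>\<mu>. a \<mu> * mon \<mu> z) has_sum s) UNIV" and t: "((\<lambda>\<nu>. b \<nu> * mon \<nu> w) has_sum t) UNIV"
  shows "gen (\<lambda>\<mu> \<nu>. a \<mu> * b \<nu>) z w = s * t"
proof (rule LIMSEQ_unique)
  show "(\<lambda>n. \<Sum>\<mu>\<in>idx_box n. \<Sum>\<nu>\<in>idx_box n. a \<mu> * b \<nu> * (mon \<mu> z * mon \<nu> w)) \<longlonglongrightarrow> gen (\<lambda>\<mu> \<nu>. a \<mu> * b \<nu>) z w"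
  proof (rule gen_LIMSEQ[OF _ zw])
    show "cmod (a \<mu> * b \<nu>) \<le> 2 * 2" for \<mu> \<nu> unfolding norm_mult by (intro mult_mono ab) auto
  qed
  have "(\<lambda>n. (\<Sum>\<mu>\<in>idx_box n. a \<mu> * mon \<mu> z) * (\<Sum>\<nu>\<in>idx_box n. b \<nu> * mon \<nu> w)) \<longlonglongrightarrow> s * t"
    by (intro tendsto_mult has_sum_LIMSEQ_idx_box s t)
  then show "(\<lambda>n. \<Sum>\<mu>\<in>idx_box n. \<Sum>\<nu>\<in>idx_box n. a \<mu> * b \<nu> * (mon \<mu> z * mon \<nu> w)) \<longlonglongrightarrow> s * t"
    by (simp add: sum_product mult_ac)
qed

lemma gen_transpose:
  assumes C: "\<And>\<mu> \<nu>. cmod (C \<mu> \<nu>) \<le> B" and zw: "z \<in> bidisc" "w \<in> bidisc"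
  shows "gen (\<lambda>\<mu> \<nu>. C \<nu> \<mu>) z w = gen C w z"
proof (rule LIMSEQ_unique)
  show "(\<lambda>n. \<Sum>\<mu>\<in>idx_box n. \<Sum>\<nu>\<in>idx_box n. C \<nu> \<mu> * (mon \<mu> z * mon \<nu> w)) \<longlonglongrightarrow> gen (\<lambda>\<mu> \<nu>. C \<nu> \<mu>) z w"
    using C by (intro gen_LIMSEQ zw)
  have "(\<Sum>\<mu>\<in>idx_box n. \<Sum>\<nu>\<in>idx_box n. C \<nu> \<mu> * (mon \<mu> z * mon \<nu> w)) = (\<Sum>\<mu>\<in>idx_box n. \<Sum>\<nu>\<in>idx_box n. C \<mu> \<nu> * (mon \<mu> w * mon \<nu> z))" for n
    by (subst sum.swap) (simp add: mult_ac)
  then show "(\<lambda>n. \<Sum>\<mu>\<in>idx_box n. \<Sum>\<nu>\<in>idx_box n. C \<nu> \<mu> * (mon \<mu> z * mon \<nu> w)) \<longlonglongrightarrow> gen C w z"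
    using gen_LIMSEQ[OF C zw(2,1)] by simp
qed

lemma mon_add: "\<mu> \<in> quadrant \<Longrightarrow> \<xi> \<in> quadrant \<Longrightarrow> mon (\<mu> + \<xi>) z = mon \<mu> z * mon \<xi> z"
  by (auto simp: mon_def quadrant_def nat_add_distrib power_add)

text \<open>
  Multiplication by monomials is translation of coefficients. Since $C$ vanishes outside the quadrant,
  the translation brings no new coefficients into the range of summation.
\<close>

lemma gen_shift:
  assumes C: "\<And>\<mu> \<nu>. cmod (C \<mu> \<nu>) \<le> B" and out: "\<And>\<mu> \<nu>. \<mu> \<notin> quadrant \<or> \<nu> \<notin> quadrant \<Longrightarrow> C \<mu> \<nu> = 0"
    and zw: "z \<in> bidisc" "w \<in> bidisc" and ab: "a \<in> quadrant" "b \<in> quadrant"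
  shows "gen (\<lambda>\<mu> \<nu>. C (\<mu> - a) (\<nu> - b)) z w = mon a z * mon b w * gen C z w"
proof -
  define F where "F p = C (fst p - a) (snd p - b) * (mon (fst p) z * mon (snd p) w)" for p
  have "bij_betw (\<lambda>p :: idx \<times> idx. (fst p + a, snd p + b)) UNIV UNIV"
    by (rule bij_betwI[of _ _ _ "\<lambda>p. (fst p - a, snd p - b)"]) auto
  then have "(F has_sum s) UNIV \<longleftrightarrow> ((\<lambda>p. F (fst p + a, snd p + b)) has_sum s) UNIV" for s
    by (rule has_sum_reindex_bij_betw[symmetric])
  moreover have "F (fst p + a, snd p + b) = mon a z * mon b w * (C (fst p) (snd p) * (mon (fst p) z * mon (snd p) w))" for p
    using out[of "fst p" "snd p"] ab by (cases "fst p \<in> quadrant \<and> snd p \<in> quadrant") (auto simp: F_def mon_add)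
  ultimately have "(F has_sum (mon a z * mon b w * gen C z w)) UNIV"
    using has_sum_cmult_right[OF gen_has_sum[OF C zw]] by simp
  then show ?thesis unfolding gen_def F_def by (rule infsumI)
qed

abbreviation mons where "mons z \<equiv> \<lambda>\<mu>. mon \<mu> z"

definition cnj2 :: "complex \<times> complex \<Rightarrow> complex \<times> complex"
  where "cnj2 w = (cnj (fst w), cnj (snd w))"

lemma cnj2_bidisc: "w \<in> bidisc \<Longrightarrow> cnj2 w \<in> bidisc"
  by (auto simp: cnj2_def bidisc_def)

lemma mon_cnj2: "mon \<nu> (cnj2 w) = cnj (mon \<nu> w)"
  by (simp add: mon_def cnj2_def)

lemma gen_sform_LIMSEQ:
  assumes C: "\<And>\<mu> \<nu>. cmod (C \<mu> \<nu>) \<le> B" and zw: "z \<in> bidisc" "w \<in> bidisc"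
  shows "(\<lambda>n. sform (idx_box n) C (mons z) (mons w)) \<longlonglongrightarrow> gen C z (cnj2 w)"
  using gen_LIMSEQ[of C B z "cnj2 w", OF C zw(1) cnj2_bidisc[OF zw(2)]] by (simp add: sform_def mon_cnj2 mult_ac)

lemma gen_psd:
  assumes C: "\<And>\<mu> \<nu>. cmod (C \<mu> \<nu>) \<le> B" and psd: "psd C"
  shows "psd_kernel_on bidisc (\<lambda>z w. gen C z (cnj2 w))"
proof (rule psd_kernel_limit)
  fix n
  have "psd (\<lambda>z w. sform (idx_box n) C (mons z) (mons w))"
    by (rule psd_pullback[OF psd_sform[OF psd]]) auto
  then show "psd_kernel_on bidisc (\<lambda>z w. sform (idx_box n) C (mons z) (mons w))"
    by (simp add: psd_kernel_on_def)
qed (rule gen_sform_LIMSEQ[OF C])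

lemma gen_dominated:
  assumes b: "\<And>\<mu> \<nu>. cmod (k \<mu> \<nu>) \<le> B" "\<And>\<mu> \<nu>. cmod (m \<mu> \<nu>) \<le> B" "\<And>\<mu> \<nu>. cmod (l \<mu> \<nu>) \<le> B"
    and dom: "dominated UNIV k m l" and zw: "z \<in> bidisc" "w \<in> bidisc"
  shows "(cmod (gen l z w))\<^sup>2 \<le> Re (gen k z (cnj2 z)) * Re (gen m w (cnj2 w))"
proof (rule LIMSEQ_le)
  show "(\<lambda>n. (cmod (\<Sum>\<mu>\<in>idx_box n. \<Sum>\<nu>\<in>idx_box n. l \<mu> \<nu> * (mon \<mu> z * mon \<nu> w)))\<^sup>2) \<longlonglongrightarrow> (cmod (gen l z w))\<^sup>2"
    by (intro tendsto_intros gen_LIMSEQ[OF b(3) zw])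
  show "(\<lambda>n. Re (sform (idx_box n) k (mons z) (mons z)) * Re (sform (idx_box n) m (mons w) (mons w)))
     \<longlonglongrightarrow> Re (gen k z (cnj2 z)) * Re (gen m w (cnj2 w))"
    by (intro tendsto_intros gen_sform_LIMSEQ[OF b(1) zw(1) zw(1)] gen_sform_LIMSEQ[OF b(2) zw(2) zw(2)])
  have "(cmod (\<Sum>\<mu>\<in>idx_box n. \<Sum>\<nu>\<in>idx_box n. l \<mu> \<nu> * (mon \<mu> z * mon \<nu> w)))\<^sup>2
    \<le> Re (sform (idx_box n) k (mons z) (mons z)) * Re (sform (idx_box n) m (mons w) (mons w))" for n
  proof -
    have "(cmod (\<Sum>\<mu>\<in>idx_box n. \<Sum>\<nu>\<in>idx_box n. mon \<mu> z * mon \<nu> w * l \<mu> \<nu>))\<^sup>2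
    \<le> Re (sform (idx_box n) k (mons z) (mons z)) * Re (sform (idx_box n) m (mons w) (mons w))"
      using dom unfolding dominated_def by simp
    then show ?thesis by (simp add: mult_ac)
  qed
  then show "\<exists>N. \<forall>n\<ge>N. (cmod (\<Sum>\<mu>\<in>idx_box n. \<Sum>\<nu>\<in>idx_box n. l \<mu> \<nu> * (mon \<mu> z * mon \<nu> w)))\<^sup>2
    \<le> Re (sform (idx_box n) k (mons z) (mons z)) * Re (sform (idx_box n) m (mons w) (mons w))" by blast
qed

text \<open>
  The mean value estimate $(\rho - r)\, n r^{n-1} \le \rho^n - r^n$, weakened to what a majorant of the
  derived series requires.
\<close>

lemma power_deriv_bound:
  fixes r \<rho> :: real
  assumes "0 \<le> r" "r < \<rho>"
  shows "real n * r ^ (n - 1) \<le> \<rho> ^ n / (\<rho> - r)"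
proof -
  have "real n * (\<rho> - r) * r ^ (n - 1) \<le> \<rho> ^ n"
  proof (induction n)
    case (Suc n)
    have "real (Suc n) * (\<rho> - r) * r ^ n = r * (real n * (\<rho> - r) * r ^ (n - 1)) + (\<rho> - r) * r ^ n"
      by (cases n) (simp_all add: algebra_simps)
    also have "\<dots> \<le> r * \<rho> ^ n + (\<rho> - r) * \<rho> ^ n"
      using Suc assms by (intro add_mono mult_left_mono power_mono) auto
    finally show ?case by (simp add: algebra_simps)
  qed simp
  then show ?thesis using assms by (simp add: pos_le_divide_eq mult_ac)
qed

definition dmon1 where "dmon1 \<xi> z = (if \<xi> \<in> quadrant then of_nat (nat (fst \<xi>)) * fst z ^ (nat (fst \<xi>) - 1) * snd z ^ nat (snd \<xi>) else 0)"
definition dmon2 where "dmon2 \<xi> z = (if \<xi> \<in> quadrant then fst z ^ nat (fst \<xi>) * (of_nat (nat (snd \<xi>)) * snd z ^ (nat (snd \<xi>) - 1)) else 0)"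

lemma mon_has_derivative:
  "(mon \<xi> has_derivative (\<lambda>h. dmon1 \<xi> z * fst h + dmon2 \<xi> z * snd h)) (at z within S)"
proof (cases "\<xi> \<in> quadrant")
  case True
  have "((\<lambda>z. fst z ^ nat (fst \<xi>) * snd z ^ nat (snd \<xi>)) has_derivative (\<lambda>h. dmon1 \<xi> z * fst h + dmon2 \<xi> z * snd h)) (at z within S)"
    using True by (auto intro!: derivative_eq_intros simp: dmon1_def dmon2_def fun_eq_iff algebra_simps)
  moreover have "mon \<xi> = (\<lambda>z. fst z ^ nat (fst \<xi>) * snd z ^ nat (snd \<xi>))" using True by (simp add: mon_def fun_eq_iff)
  ultimately show ?thesis by simp
next
  case False
  then have "mon \<xi> = (\<lambda>_. 0)" by (simp add: mon_def fun_eq_iff)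
  then show ?thesis using False by (simp add: dmon1_def dmon2_def)
qed

lemma mon_bounds:
  assumes r: "0 \<le> r" "r < \<rho>" and z: "cmod (fst z) \<le> r" "cmod (snd z) \<le> r"
  shows "cmod (mon \<xi> z) \<le> norm (mon \<xi> (of_real \<rho>, of_real \<rho>))"
    "cmod (dmon1 \<xi> z) \<le> norm (mon \<xi> (of_real \<rho>, of_real \<rho>)) / (\<rho> - r)"
    "cmod (dmon2 \<xi> z) \<le> norm (mon \<xi> (of_real \<rho>, of_real \<rho>)) / (\<rho> - r)"
proof -
  have p: "cmod (fst z) ^ n \<le> \<rho> ^ n" "cmod (snd z) ^ n \<le> \<rho> ^ n" for n
    using assms by (auto intro!: power_mono)
  have d: "real n * cmod (fst z) ^ (n - 1) \<le> \<rho> ^ n / (\<rho> - r)" "real n * cmod (snd z) ^ (n - 1) \<le> \<rho> ^ n / (\<rho> - r)" for n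
  proof -
    have "real n * cmod (fst z) ^ (n - 1) \<le> real n * r ^ (n - 1)" "real n * cmod (snd z) ^ (n - 1) \<le> real n * r ^ (n - 1)"
      using z by (auto intro!: mult_left_mono power_mono)
    then show "real n * cmod (fst z) ^ (n - 1) \<le> \<rho> ^ n / (\<rho> - r)" "real n * cmod (snd z) ^ (n - 1) \<le> \<rho> ^ n / (\<rho> - r)"
      using power_deriv_bound[OF r, of n] by linarith+
  qed
  have \<rho>: "0 \<le> \<rho>" "0 < \<rho> - r" using r by auto
  show "cmod (mon \<xi> z) \<le> norm (mon \<xi> (of_real \<rho>, of_real \<rho>))"
    using \<rho> by (auto simp: mon_def norm_mult norm_power intro!: mult_mono p)
  show "cmod (dmon1 \<xi> z) \<le> norm (mon \<xi> (of_real \<rho>, of_real \<rho>)) / (\<rho> - r)"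
    using \<rho> mult_mono[OF d(1)[of "nat (fst \<xi>)"] p(2)[of "nat (snd \<xi>)"]]
    by (simp add: dmon1_def mon_def norm_mult norm_power)
  show "cmod (dmon2 \<xi> z) \<le> norm (mon \<xi> (of_real \<rho>, of_real \<rho>)) / (\<rho> - r)"
    using \<rho> mult_mono[OF p(1)[of "nat (fst \<xi>)"] d(2)[of "nat (snd \<xi>)"]]
    by (simp add: dmon2_def mon_def norm_mult norm_power)
qed

text \<open>
  Termwise differentiation: on the polydisc of radius $r$ the partial sums and their four partial
  derivatives are dominated by a multiple of the convergent series of monomials at a radius
  $\rho \in (r, 1)$.
\<close>

lemma gen_holomorphic:
  assumes C: "\<And>\<mu> \<nu>. cmod (C \<mu> \<nu>) \<le> B"
  shows "holomorphic4_on (\<lambda>(z, w). gen C z w) (bidisc \<times> bidisc)"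
  unfolding holomorphic4_on_def
proof
  fix p :: "(complex \<times> complex) \<times> (complex \<times> complex)" assume p: "p \<in> bidisc \<times> bidisc"
  define r0 where "r0 = Max {cmod (fst (fst p)), cmod (snd (fst p)), cmod (fst (snd p)), cmod (snd (snd p))}"
  have r0: "cmod (fst (fst p)) \<le> r0" "cmod (snd (fst p)) \<le> r0" "cmod (fst (snd p)) \<le> r0" "cmod (snd (snd p)) \<le> r0"
    by (auto simp: r0_def)
  have "r0 < 1" using p by (auto simp: r0_def bidisc_def)
  then obtain r where r: "r0 < r" "r < 1" using dense by blast
  then obtain \<rho> where \<rho>: "r < \<rho>" "\<rho> < 1" using dense by blast
  have r_pos: "0 \<le> r" using r0(1) r(1) norm_ge_zero[of "fst (fst p)"] by linarith
  define S :: "((complex \<times> complex) \<times> (complex \<times> complex)) set"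
    where "S = (ball 0 r \<times> ball 0 r) \<times> (ball 0 r \<times> ball 0 r)"
  have S: "open S" "convex S" "p \<in> S" using r0 r
    by (auto simp: S_def open_Times convex_Times mem_Times_iff)
  have Sb: "S \<subseteq> bidisc \<times> bidisc" using r by (auto simp: S_def bidisc_def)
  define M where "M \<xi> = norm (mon \<xi> (of_real \<rho>, of_real \<rho>))" for \<xi>
  have mb: "cmod (mon \<xi> z) \<le> M \<xi>" "cmod (dmon1 \<xi> z) \<le> M \<xi> / (\<rho> - r)" "cmod (dmon2 \<xi> z) \<le> M \<xi> / (\<rho> - r)"
    if "z \<in> ball 0 r \<times> ball 0 r" for \<xi> z
    unfolding M_def using that by (auto intro!: mon_bounds[OF r_pos \<rho>(1)])
  have M_sum: "(\<lambda>p. M (fst p) * M (snd p)) summable_on UNIV"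
    unfolding M_def using r_pos \<rho> by (intro mon_product_summable) (auto simp: bidisc_def)
  define A1 where "A1 q x = C (fst q) (snd q) * (dmon1 (fst q) (fst x) * mon (snd q) (snd x))" for q x
  define A2 where "A2 q x = C (fst q) (snd q) * (dmon2 (fst q) (fst x) * mon (snd q) (snd x))" for q x
  define A3 where "A3 q x = C (fst q) (snd q) * (mon (fst q) (fst x) * dmon1 (snd q) (snd x))" for q x
  define A4 where "A4 q x = C (fst q) (snd q) * (mon (fst q) (fst x) * dmon2 (snd q) (snd x))" for q x
  have ul: "uniform_limit S (\<lambda>n x. \<Sum>q\<in>box_pairs n. A q x) (\<lambda>x. \<Sum>\<^sub>\<infinity>q. A q x) sequentially"
    if A: "\<And>q x. x \<in> S \<Longrightarrow> norm (A q x) \<le> B / (\<rho> - r) * (M (fst q) * M (snd q))" for A :: "idx \<times> idx \<Rightarrow> _ \<Rightarrow> complex"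
  proof -
    have "uniform_limit S (\<lambda>X x. \<Sum>q\<in>X. A q x) (\<lambda>x. \<Sum>\<^sub>\<infinity>q. A q x) (finite_subsets_at_top UNIV)"
      by (rule Weierstrass_m_test_general[OF A summable_on_cmult_right[OF M_sum]])
    from filterlim_compose[OF this filterlim_idx_box_Times] show ?thesis by simp
  qed
  have bnd: "norm (C \<mu> \<nu> * (s * t)) \<le> B / (\<rho> - r) * (M \<mu> * M \<nu>)"
    if "cmod s * cmod t \<le> M \<mu> * M \<nu> / (\<rho> - r)" for \<mu> \<nu> s t
  proof -
    have "norm (C \<mu> \<nu> * (s * t)) \<le> B * (M \<mu> * M \<nu> / (\<rho> - r))"
      unfolding norm_mult using that C[of \<mu> \<nu>] order_trans[OF norm_ge_zero C] by (intro mult_mono) auto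
    then show ?thesis by simp
  qed
  have prod: "cmod s * cmod t \<le> M \<mu> * M \<nu> / (\<rho> - r)"
    if "cmod s \<le> M \<mu> / (\<rho> - r) \<and> cmod t \<le> M \<nu> \<or> cmod s \<le> M \<mu> \<and> cmod t \<le> M \<nu> / (\<rho> - r)" for s t \<mu> \<nu>
  proof -
    have pos: "0 \<le> M \<xi>" "0 \<le> M \<xi> / (\<rho> - r)" for \<xi> using \<rho>(1) by (auto simp: M_def)
    show ?thesis using that mult_mono[of "cmod s" "M \<mu> / (\<rho> - r)" "cmod t" "M \<nu>"]
        mult_mono[of "cmod s" "M \<mu>" "cmod t" "M \<nu> / (\<rho> - r)"] pos by auto
  qed
  have in1: "fst x \<in> ball 0 r \<times> ball 0 r" "snd x \<in> ball 0 r \<times> ball 0 r" if "x \<in> S" for x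
    using that by (auto simp: S_def)
  have u1: "uniform_limit S (\<lambda>n x. \<Sum>q\<in>box_pairs n. A1 q x) (\<lambda>x. \<Sum>\<^sub>\<infinity>q. A1 q x) sequentially"
    by (rule ul, unfold A1_def, rule bnd, rule prod) (use mb in1 in blast)
  have u2: "uniform_limit S (\<lambda>n x. \<Sum>q\<in>box_pairs n. A2 q x) (\<lambda>x. \<Sum>\<^sub>\<infinity>q. A2 q x) sequentially"
    by (rule ul, unfold A2_def, rule bnd, rule prod) (use mb in1 in blast)
  have u3: "uniform_limit S (\<lambda>n x. \<Sum>q\<in>box_pairs n. A3 q x) (\<lambda>x. \<Sum>\<^sub>\<infinity>q. A3 q x) sequentially"
    by (rule ul, unfold A3_def, rule bnd, rule prod) (use mb in1 in blast)
  have u4: "uniform_limit S (\<lambda>n x. \<Sum>q\<in>box_pairs n. A4 q x) (\<lambda>x. \<Sum>\<^sub>\<infinity>q. A4 q x) sequentially"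
    by (rule ul, unfold A4_def, rule bnd, rule prod) (use mb in1 in blast)
  define a1 where "a1 x = (\<Sum>\<^sub>\<infinity>q. A1 q x)" for x
  define a2 where "a2 x = (\<Sum>\<^sub>\<infinity>q. A2 q x)" for x
  define a3 where "a3 x = (\<Sum>\<^sub>\<infinity>q. A3 q x)" for x
  define a4 where "a4 x = (\<Sum>\<^sub>\<infinity>q. A4 q x)" for x
  define fn where "fn n x = (\<Sum>q\<in>box_pairs n. C (fst q) (snd q) * (mon (fst q) (fst x) * mon (snd q) (snd x)))" for n and x :: "(complex \<times> complex) \<times> (complex \<times> complex)"
  define fn' where "fn' n x h = (\<Sum>q\<in>box_pairs n. A1 q x) * fst (fst h) + (\<Sum>q\<in>box_pairs n. A2 q x) * snd (fst h)
      + (\<Sum>q\<in>box_pairs n. A3 q x) * fst (snd h) + (\<Sum>q\<in>box_pairs n. A4 q x) * snd (snd h)" for n x and h :: "(complex \<times> complex) \<times> (complex \<times> complex)"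
  define g' where "g' x h = a1 x * fst (fst h) + a2 x * snd (fst h) + a3 x * fst (snd h) + a4 x * snd (snd h)"
    for x and h :: "(complex \<times> complex) \<times> (complex \<times> complex)"
  have lim: "(\<lambda>n. fn n x) \<longlonglongrightarrow> gen C (fst x) (snd x)" if "x \<in> S" for x
    using gen_LIMSEQ[of C B "fst x" "snd x", OF C] Sb that
    by (auto simp: fn_def sum.cartesian_product split_def)
  have unif: "\<forall>\<^sub>F n in sequentially. \<forall>x\<in>S. \<forall>h. norm (fn' n x h - g' x h) \<le> e * norm h" if e: "e > 0" for e :: real
  proof -
    from e have e4: "e / 4 > 0" by simp
    note elims = uniform_limitD[OF u1 e4] uniform_limitD[OF u2 e4] uniform_limitD[OF u3 e4] uniform_limitD[OF u4 e4]
    have small: "norm (d * h) \<le> e / 4 * N" if "norm d < e / 4" "norm h \<le> N" for d h :: complex and N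
    proof -
      have "norm d * norm h \<le> e / 4 * N"
        using that e by (intro mult_mono norm_ge_zero) linarith+
      then show ?thesis by (simp only: norm_mult)
    qed
    show "\<forall>\<^sub>F n in sequentially. \<forall>x\<in>S. \<forall>h. norm (fn' n x h - g' x h) \<le> e * norm h"
    proof (rule eventually_mono[OF eventually_conj[OF eventually_conj[OF elims(1,2)] eventually_conj[OF elims(3,4)]]])
      fix n
      assume elim: "((\<forall>x\<in>S. dist (\<Sum>q\<in>box_pairs n. A1 q x) (\<Sum>\<^sub>\<infinity>q. A1 q x) < e / 4)
        \<and> (\<forall>x\<in>S. dist (\<Sum>q\<in>box_pairs n. A2 q x) (\<Sum>\<^sub>\<infinity>q. A2 q x) < e / 4))
        \<and> (\<forall>x\<in>S. dist (\<Sum>q\<in>box_pairs n. A3 q x) (\<Sum>\<^sub>\<infinity>q. A3 q x) < e / 4)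
        \<and> (\<forall>x\<in>S. dist (\<Sum>q\<in>box_pairs n. A4 q x) (\<Sum>\<^sub>\<infinity>q. A4 q x) < e / 4)"
      show "\<forall>x\<in>S. \<forall>h. norm (fn' n x h - g' x h) \<le> e * norm h"
      proof (intro ballI allI)
        fix x h assume x: "x \<in> S"
        have hn: "norm (fst (fst h)) \<le> norm h" "norm (snd (fst h)) \<le> norm h" "norm (fst (snd h)) \<le> norm h" "norm (snd (snd h)) \<le> norm h"
          for h :: "(complex \<times> complex) \<times> (complex \<times> complex)"
        proof -
          have 1: "norm (fst z) \<le> norm z" "norm (snd z) \<le> norm z" for z :: "'a::real_normed_vector \<times> 'b::real_normed_vector"
            using norm_fst_le[of "fst z" "snd z"] norm_snd_le[of "snd z" "fst z"] by simp_all
          show "norm (fst (fst h)) \<le> norm h" "norm (snd (fst h)) \<le> norm h" "norm (fst (snd h)) \<le> norm h" "norm (snd (snd h)) \<le> norm h"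
            by (rule order_trans[OF 1(1) 1(1)] order_trans[OF 1(2) 1(1)] order_trans[OF 1(1) 1(2)] order_trans[OF 1(2) 1(2)])+
        qed
        have "fn' n x h - g' x h = ((\<Sum>q\<in>box_pairs n. A1 q x) - a1 x) * fst (fst h) + ((\<Sum>q\<in>box_pairs n. A2 q x) - a2 x) * snd (fst h)
            + ((\<Sum>q\<in>box_pairs n. A3 q x) - a3 x) * fst (snd h) + ((\<Sum>q\<in>box_pairs n. A4 q x) - a4 x) * snd (snd h)"
          by (simp add: fn'_def g'_def algebra_simps)
        also have "norm \<dots> \<le> e / 4 * norm h + e / 4 * norm h + e / 4 * norm h + e / 4 * norm h"
        proof -
          have "norm ((\<Sum>q\<in>box_pairs n. A1 q x) - a1 x) < e / 4" "norm ((\<Sum>q\<in>box_pairs n. A2 q x) - a2 x) < e / 4"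
            "norm ((\<Sum>q\<in>box_pairs n. A3 q x) - a3 x) < e / 4" "norm ((\<Sum>q\<in>box_pairs n. A4 q x) - a4 x) < e / 4"
            using elim x unfolding a1_def a2_def a3_def a4_def dist_norm by blast+
          then show ?thesis
            by (intro order_trans[OF norm_triangle_ineq] add_mono small hn)
        qed
        finally show "norm (fn' n x h - g' x h) \<le> e * norm h" by simp
      qed
    qed
  qed
  have "\<exists>g. \<forall>x\<in>S. (\<lambda>n. fn n x) \<longlonglongrightarrow> g x \<and> (g has_derivative g' x) (at x within S)"
  proof (rule has_derivative_sequence[where f = fn and f' = fn' and g' = g', OF S(2) _ unif S(3) lim[OF S(3)]])
    fix n x assume "x \<in> S"
    have "((\<lambda>x. C (fst q) (snd q) * (mon (fst q) (fst x) * mon (snd q) (snd x))) has_derivative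
       (\<lambda>h. A1 q x * fst (fst h) + A2 q x * snd (fst h) + A3 q x * fst (snd h) + A4 q x * snd (snd h))) (at x within S)" for q
    proof -
      have d1: "((\<lambda>x. mon (fst q) (fst x)) has_derivative (\<lambda>h. dmon1 (fst q) (fst x) * fst (fst h) + dmon2 (fst q) (fst x) * snd (fst h))) (at x within S)"
        by (rule has_derivative_compose[OF has_derivative_fst[OF has_derivative_ident] mon_has_derivative])
      have d2: "((\<lambda>x. mon (snd q) (snd x)) has_derivative (\<lambda>h. dmon1 (snd q) (snd x) * fst (snd h) + dmon2 (snd q) (snd x) * snd (snd h))) (at x within S)"
        by (rule has_derivative_compose[OF has_derivative_snd[OF has_derivative_ident] mon_has_derivative])
      show ?thesis
        by (rule has_derivative_eq_rhs[OF has_derivative_mult_right[OF has_derivative_mult[OF d1 d2]]])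
           (simp add: A1_def A2_def A3_def A4_def fun_eq_iff algebra_simps)
    qed
    then have "(fn n has_derivative (\<lambda>h. \<Sum>q\<in>box_pairs n. A1 q x * fst (fst h) + A2 q x * snd (fst h) + A3 q x * fst (snd h) + A4 q x * snd (snd h))) (at x within S)"
      unfolding fn_def[abs_def] by (intro has_derivative_sum)
    then show "(fn n has_derivative fn' n x) (at x within S)"
      by (rule has_derivative_eq_rhs) (simp add: fn'_def fun_eq_iff sum.distrib sum_distrib_right)
  qed
  then obtain g where g: "\<And>x. x \<in> S \<Longrightarrow> (\<lambda>n. fn n x) \<longlonglongrightarrow> g x" "\<And>x. x \<in> S \<Longrightarrow> (g has_derivative g' x) (at x within S)" by blast
  have eq: "g x = gen C (fst x) (snd x)" if "x \<in> S" for x using LIMSEQ_unique[OF g(1) lim] that by blast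
  have "(g has_derivative g' p) (at p)" using g(2)[OF S(3)] at_within_open[OF S(3,1)] by simp
  then have "((\<lambda>(z, w). gen C z w) has_derivative g' p) (at p)"
    by (rule has_derivative_transform_within_open[OF _ S(1) S(3)]) (simp add: eq split_def)
  moreover have "g' p = (\<lambda>((h1, h2), (k1, k2)). a1 p * h1 + a2 p * h2 + a3 p * k1 + a4 p * k2)"
    by (auto simp: g'_def fun_eq_iff)
  ultimately show "\<exists>a b c d. ((\<lambda>(z, w). gen C z w) has_derivative (\<lambda>((h\<^sub>1, h\<^sub>2), k\<^sub>1, k\<^sub>2). a * h\<^sub>1 + b * h\<^sub>2 + c * k\<^sub>1 + d * k\<^sub>2)) (at p)"
    by metis
qed

section \<open>The symmetric Agler decomposition\<close>

text \<open>
  The approximants with $r \to 1$ and $e \to 0$ contain all exponents of growing boxes, so that their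
  coefficients converge to those of $f$.
\<close>

lemma Agler_data_exists:
  assumes c: "\<And>\<xi>. cmod (c \<xi>) \<le> 1" "\<And>\<xi>. \<xi> \<notin> quadrant \<Longrightarrow> c \<xi> = 0"
    and s: "\<And>z. z \<in> bidisc \<Longrightarrow> ((\<lambda>\<xi>. c \<xi> * mon \<xi> z) has_sum f z) UNIV"
    and f: "f ` bidisc \<subseteq> ball 0 1"
  shows "\<exists>k1 k2 m1 m2 l1 l2 q. Agler_data UNIV c k1 k2 m1 m2 l1 l2 q"
proof -
  define r where "r n = 1 - 1 / real (n + 2)" for n
  define e where "e n = 1 / real (Suc n)" for n
  have r: "0 < r n" "r n < 1" for n by (auto simp: r_def)
  have e: "0 < e n" for n by (simp add: e_def)
  define a where "a n \<xi> = c \<xi> * mon \<xi> (of_real (r n), of_real (r n)) / of_real (1 + e n)" for n \<xi>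
  define good where "good n \<Gamma> \<longleftrightarrow> finite \<Gamma> \<and> idx_box n \<subseteq> \<Gamma> \<and> (\<forall>u v. cmod u = 1 \<longrightarrow> cmod v = 1 \<longrightarrow>
       cmod (\<Sum>\<xi>\<in>\<Gamma>. a n \<xi> * (u powi fst \<xi> * v powi snd \<xi>)) \<le> 1)"
    for n \<Gamma>
  have "\<exists>\<Gamma>. good n \<Gamma>" for n
  proof (rule polynomial_approximant[OF c s f r[of n] e[of n] finite_idx_box[of n], folded a_def])
    fix \<Gamma> assume "finite \<Gamma>" "idx_box n \<subseteq> \<Gamma>" and "\<And>u v. cmod u = 1 \<Longrightarrow> cmod v = 1 \<Longrightarrow>
       cmod (\<Sum>\<xi>\<in>\<Gamma>. a n \<xi> * (u powi fst \<xi> * v powi snd \<xi>)) \<le> 1"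
    then show "\<exists>\<Gamma>. good n \<Gamma>" unfolding good_def by (intro exI[of _ \<Gamma>] conjI allI impI)
  qed
  then obtain \<Gamma> where "\<And>n. good n (\<Gamma> n)" by metis
  then have \<Gamma>: "finite (\<Gamma> n)" "idx_box n \<subseteq> \<Gamma> n"
    "cmod u = 1 \<Longrightarrow> cmod v = 1 \<Longrightarrow>
       cmod (\<Sum>\<xi>\<in>\<Gamma> n. a n \<xi> * (u powi fst \<xi> * v powi snd \<xi>)) \<le> 1"
    for n u v unfolding good_def by blast+
  define P where "P n \<xi> = (if \<xi> \<in> \<Gamma> n then a n \<xi> else 0)" for n \<xi>
  have "\<exists>k1 k2 m1 m2 l1 l2 q. Agler_data (idx_box n) (P n) k1 k2 m1 m2 l1 l2 q" for n
  proof (rule Agler_data_polynomial[OF \<Gamma>(1)[of n]])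
    show "P n \<xi> = 0" if "\<xi> \<notin> \<Gamma> n" for \<xi> using that by (simp add: P_def)
    show "P n \<xi> = 0" if "\<xi> \<notin> quadrant" for \<xi> using that by (simp add: P_def a_def c)
    show "cmod (\<Sum>\<xi>\<in>\<Gamma> n. P n \<xi> * (u powi fst \<xi> * v powi snd \<xi>)) \<le> 1" if "cmod u = 1" "cmod v = 1" for u v
      using \<Gamma>(3)[OF that, of n] by (simp add: P_def cong: sum.cong)
    show "\<mu> - d \<in> idx_box n" if "\<mu> \<in> idx_box n" "d \<in> {e1, e2}" "\<mu> - d \<in> quadrant" for \<mu> d
      using that by (auto simp: idx_box_def quadrant_def)
  qed simp
  then obtain k1 k2 m1 m2 l1 l2 q where
    "\<And>n. Agler_data (idx_box n) (P n) (k1 n) (k2 n) (m1 n) (m2 n) (l1 n) (l2 n) (q n)"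
    by metis
  then show ?thesis
  proof (rule Agler_data_limit)
    show "\<forall>\<^sub>F n in sequentially. X \<subseteq> idx_box n" if "finite X" for X using that by (rule eventually_subset_idx_box)
    fix \<xi>
    have r1: "r \<longlonglongrightarrow> 1 - 0" unfolding r_def[abs_def]
      by (intro tendsto_intros LIMSEQ_ignore_initial_segment[OF lim_1_over_n])
    have e0: "e \<longlonglongrightarrow> 0" unfolding e_def[abs_def] by (rule LIMSEQ_Suc[OF lim_1_over_n])
    have "(\<lambda>n. mon \<xi> (of_real (r n), of_real (r n))) \<longlonglongrightarrow> (if \<xi> \<in> quadrant then 1 else 0)"
    proof (cases "\<xi> \<in> quadrant")
      case True
      have "(\<lambda>n. of_real (r n) ^ nat (fst \<xi>) * of_real (r n) ^ nat (snd \<xi>)) \<longlonglongrightarrow> (of_real (1 - 0) ^ nat (fst \<xi>) * of_real (1 - 0) ^ nat (snd \<xi>) :: complex)"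
        by (intro tendsto_intros r1)
      then show ?thesis using True by (simp add: mon_def)
    qed (simp add: mon_def)
    then have lim: "(\<lambda>n. a n \<xi>)
        \<longlonglongrightarrow> c \<xi> * (if \<xi> \<in> quadrant then 1 else 0) / of_real (1 + 0)"
      unfolding a_def by (intro tendsto_intros e0) auto
    have c_eq: "c \<xi> * (if \<xi> \<in> quadrant then 1 else 0) / of_real (1 + 0) = c \<xi>" using c(2)[of \<xi>] by auto
    have ev: "\<forall>\<^sub>F n in sequentially. a n \<xi> = P n \<xi>"
    proof -
      have "\<forall>\<^sub>F n in sequentially. {\<xi>} \<subseteq> idx_box n" by (rule eventually_subset_idx_box) simp
      then show ?thesis by (rule eventually_mono) (use \<Gamma>(2) in \<open>auto simp: P_def\<close>)
    qed
    show "(\<lambda>n. P n \<xi>) \<longlonglongrightarrow> c \<xi>" by (rule Lim_transform_eventually[OF lim[unfolded c_eq] ev])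
  qed
qed

lemma psd_multiply_rank_one:
  assumes "psd_kernel_on \<Omega> N"
  shows "psd_kernel_on \<Omega> (\<lambda>i j. g i * N i j * cnj (g j))"
  unfolding psd_kernel_on_def psd_matrix_on_def
proof (intro allI impI)
  fix F v assume "finite F \<and> F \<subseteq> \<Omega>"
  then have "(\<Sum>i\<in>F. \<Sum>j\<in>F. cnj (cnj (g i) * v i) * N i j * (cnj (g j) * v j)) \<in> \<real>\<^sub>\<ge>\<^sub>0"
    using assms unfolding psd_kernel_on_def psd_matrix_on_def by (elim allE[of _ F]) (auto elim!: allE[of _ "\<lambda>i. cnj (g i) * v i"])
  then show "(\<Sum>z\<in>F. \<Sum>\<zeta>\<in>F. cnj (v z) * (g z * N z \<zeta> * cnj (g \<zeta>)) * v \<zeta>) \<in> \<real>\<^sub>\<ge>\<^sub>0"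
    by (simp add: mult_ac)
qed

lemma psd_scale:
  assumes "psd_kernel_on \<Omega> N" "0 \<le> a"
  shows "psd_kernel_on \<Omega> (\<lambda>i j. of_real a * N i j)"
  using psd_multiply_rank_one[OF assms(1), of "\<lambda>_. of_real (sqrt a)"] assms(2)
  by (simp add: mult_ac flip: of_real_mult mult.assoc)

text \<open>
  The Szego kernel is a sum of kernels of rank one, so multiplying by it preserves positivity. This
  absorbs a positive defect into the first term of an Agler decomposition.
\<close>

lemma psd_Szego_multiply:
  assumes N: "psd_kernel_on \<Omega> N" and g: "\<And>i. i \<in> \<Omega> \<Longrightarrow> cmod (g i) < 1"
  shows "psd_kernel_on \<Omega> (\<lambda>i j. N i j / (1 - g i * cnj (g j)))"
proof (rule psd_kernel_limit)
  show "psd_kernel_on \<Omega> (\<lambda>i j. \<Sum>t<n. g i ^ t * N i j * cnj (g j ^ t))" for n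
  proof (induction n)
    case 0
    then show ?case by (simp add: psd_kernel_on_def psd_matrix_on_def)
  next
    case (Suc n)
    from psd_add[OF Suc psd_multiply_rank_one[OF N, of "\<lambda>i. g i ^ n"]] show ?case by simp
  qed
  fix i j assume ij: "i \<in> \<Omega>" "j \<in> \<Omega>"
  have "cmod (g i) * cmod (g j) < 1 * 1" using g[OF ij(1)] g[OF ij(2)] by (intro mult_strict_mono') auto
  then have "(\<lambda>t. (g i * cnj (g j)) ^ t) sums (1 / (1 - g i * cnj (g j)))"
    by (intro geometric_sums) (simp add: norm_mult)
  from sums_mult[OF this, of "N i j"] have "(\<lambda>t. g i ^ t * N i j * cnj (g j ^ t)) sums (N i j / (1 - g i * cnj (g j)))"
    by (simp add: power_mult_distrib mult_ac)
  then show "(\<lambda>n. \<Sum>t<n. g i ^ t * N i j * cnj (g j ^ t)) \<longlonglongrightarrow> N i j / (1 - g i * cnj (g j))"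
    by (simp add: sums_def)
qed

text \<open>
  The Cauchy--Schwarz inequality for the direct sum of a right and a left space: it is what lets the
  average of two kernels dominate the average of two mixed kernels.
\<close>

lemma sum_squares_bound:
  fixes x y a b a' b' :: real
  assumes "x\<^sup>2 \<le> a * b'" "y\<^sup>2 \<le> a' * b" and nonneg: "0 \<le> a" "0 \<le> b" "0 \<le> a'" "0 \<le> b'"
  shows "(x + y)\<^sup>2 \<le> (a + b) * (a' + b')"
proof -
  have "(x * y)\<^sup>2 \<le> (a * b') * (a' * b)"
    unfolding power_mult_distrib using assms by (intro mult_mono) auto
  also have "\<dots> = (a * a') * (b * b')" by simp
  also have "\<dots> \<le> ((a * a' + b * b') / 2)\<^sup>2"
    using zero_le_power2[of "a * a' - b * b'"] by (simp add: power2_eq_square field_simps)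
  finally have sq: "(x * y)\<^sup>2 \<le> ((a * a' + b * b') / 2)\<^sup>2" .
  have "0 \<le> (a * a' + b * b') / 2" using nonneg by (simp add: add_nonneg_nonneg)
  from power2_le_imp_le[OF sq this] have "2 * (x * y) \<le> a * a' + b * b'" by simp
  then show ?thesis using assms(1,2) by (simp add: power2_sum algebra_simps)
qed

lemma psd_on_diag:
  assumes "psd_kernel_on \<Omega> K" "i \<in> \<Omega>"
  shows "K i i \<in> \<real>\<^sub>\<ge>\<^sub>0"
  using psd_kernelD[OF assms(1), of "{i}" "\<lambda>_. 1"] assms(2) by (simp add: sform_def)

theorem theorem1p1:
  fixes f :: "complex \<times> complex \<Rightarrow> complex"
  assumes "holomorphic2_on f bidisc"
    and "f ` bidisc \<subseteq> \<bbbD>"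
  shows "\<exists>(K\<^sub>1 :: complex \<times> complex \<Rightarrow> complex \<times> complex \<Rightarrow> complex) K\<^sub>2
            (L\<^sub>1 :: complex \<times> complex \<Rightarrow> complex \<times> complex \<Rightarrow> complex) L\<^sub>2.
      psd_kernel_on bidisc K\<^sub>1 \<and> psd_kernel_on bidisc K\<^sub>2 \<and>
      holomorphic4_on (\<lambda>(z, \<zeta>). L\<^sub>1 z \<zeta>) (bidisc \<times> bidisc) \<and>
      holomorphic4_on (\<lambda>(z, \<zeta>). L\<^sub>2 z \<zeta>) (bidisc \<times> bidisc) \<and>
      (\<forall>z\<in>bidisc. \<forall>\<zeta>\<in>bidisc.
        1 - f z * cnj (f \<zeta>) =
          (1 - fst z * cnj (fst \<zeta>)) * K\<^sub>1 z \<zeta> + (1 - snd z * cnj (snd \<zeta>)) * K\<^sub>2 z \<zeta> \<and>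
        f z - f \<zeta> = (fst z - fst \<zeta>) * L\<^sub>1 z \<zeta> + (snd z - snd \<zeta>) * L\<^sub>2 z \<zeta> \<and>
        (cmod (L\<^sub>1 z \<zeta>))\<^sup>2 \<le> Re (K\<^sub>1 z z * K\<^sub>1 \<zeta> \<zeta>) \<and>
        (cmod (L\<^sub>2 z \<zeta>))\<^sup>2 \<le> Re (K\<^sub>2 z z * K\<^sub>2 \<zeta> \<zeta>))"
proof -
  obtain c where c: "\<And>\<xi>. cmod (c \<xi>) \<le> 1" "\<And>\<xi>. \<xi> \<notin> quadrant \<Longrightarrow> c \<xi> = 0"
    and fs: "\<And>z. z \<in> bidisc \<Longrightarrow> ((\<lambda>\<xi>. c \<xi> * mon \<xi> z) has_sum f z) UNIV"
    using bidisc_power_series[OF assms] by blast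
  obtain k1 k2 m1 m2 l1 l2 q where data: "Agler_data UNIV c k1 k2 m1 m2 l1 l2 q"
    using Agler_data_exists[OF c fs assms(2)] by blast
  note D = Agler_dataD[OF data]
  note psd = D(1-5) and q_bd = D(12) and out = D(13) and agler = D(15) and l_eq = D(16)[OF UNIV_I] and dom = D(17,18)
  have c2: "cmod (c \<xi>) \<le> 2" for \<xi> using c(1)[of \<xi>] by simp
  have e_quad: "e1 \<in> quadrant" "e2 \<in> quadrant" "0 \<in> quadrant" by (auto simp: quadrant_def)
  have mon_e: "mon e1 z = fst z" "mon e2 z = snd z" "mon 0 z = 1" for z
    by (simp_all add: mon_def quadrant_def)
  have one: "((\<lambda>\<xi>. of_bool (\<xi> = 0) * mon \<xi> z) has_sum 1) UNIV" for z
  proof -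
    have "((\<lambda>\<xi>. of_bool (\<xi> = 0) * mon \<xi> z) has_sum 1) {0}" by (rule has_sum_finiteI) (auto simp: mon_e)
    moreover have "((\<lambda>\<xi>. of_bool (\<xi> = 0) * mon \<xi> z) has_sum 1) {0} \<longleftrightarrow> ((\<lambda>\<xi>. of_bool (\<xi> = 0) * mon \<xi> z) has_sum 1) UNIV"
      by (rule has_sum_cong_neutral) auto
    ultimately show ?thesis by blast
  qed
  have one_bd: "cmod (of_bool P) \<le> 2" for P by simp
  define qf where "qf z = (\<Sum>\<^sub>\<infinity>\<xi>. q \<xi> * mon \<xi> z)" for z
  have qs: "((\<lambda>\<xi>. q \<xi> * mon \<xi> z) has_sum qf z) UNIV" if z: "z \<in> bidisc" for z
  proof -
    have "(\<lambda>\<xi>. norm (q \<xi> * mon \<xi> z)) summable_on UNIV"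
    proof (rule summable_on_comparison_test)
      show "(\<lambda>\<xi>. 2 * norm (mon \<xi> z)) summable_on UNIV" by (intro summable_on_cmult_right mon_summable z)
      show "norm (q \<xi> * mon \<xi> z) \<le> 2 * norm (mon \<xi> z)" for \<xi>
        unfolding norm_mult by (intro mult_right_mono q_bd) auto
    qed auto
    from abs_summable_summable[OF this] show ?thesis unfolding qf_def by (rule has_sum_infsum)
  qed
  have conj_sum: "((\<lambda>\<xi>. cnj (a \<xi>) * mon \<xi> (cnj2 w)) has_sum cnj s) UNIV"
    if "((\<lambda>\<xi>. a \<xi> * mon \<xi> w) has_sum s) UNIV" for a s w
  proof -
    have "((\<lambda>\<xi>. cnj (a \<xi> * mon \<xi> w)) has_sum cnj s) UNIV" using that by (simp only: has_sum_cnj_iff)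
    then show ?thesis by (simp add: mon_cnj2)
  qed
  have shift_bd: "cmod (C \<mu> \<nu> - C (\<mu> - a) (\<nu> - b)) \<le> 4" if "\<And>\<mu> \<nu>. cmod (C \<mu> \<nu>) \<le> 2" for C :: "idx \<Rightarrow> idx \<Rightarrow> complex" and \<mu> \<nu> a b
    using norm_triangle_ineq4[of "C \<mu> \<nu>" "C (\<mu> - a) (\<nu> - b)"] that[of \<mu> \<nu>] that[of "\<mu> - a" "\<nu> - b"] by linarith
  have gen_diff_shift: "gen (\<lambda>\<mu> \<nu>. C \<mu> \<nu> - C (\<mu> - a) (\<nu> - a)) z w = (1 - mon a z * mon a w) * gen C z w"
    if C: "\<And>\<mu> \<nu>. cmod (C \<mu> \<nu>) \<le> 2" "\<And>\<mu> \<nu>. \<mu> \<notin> quadrant \<or> \<nu> \<notin> quadrant \<Longrightarrow> C \<mu> \<nu> = 0"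
      and "a \<in> quadrant" "z \<in> bidisc" "w \<in> bidisc" for C a z w
    using gen_linear(2)[of C 2 "\<lambda>\<mu> \<nu>. C (\<mu> - a) (\<nu> - a)" 2 z w] gen_shift[of C 2 z w a a] that
    by (simp add: algebra_simps)
  have gen_one: "gen (\<lambda>\<mu> \<nu>. delta \<mu> \<nu>) z w = 1" if "z \<in> bidisc" "w \<in> bidisc" for z w
    using gen_product[of "\<lambda>\<xi>. of_bool (\<xi> = 0)" "\<lambda>\<xi>. of_bool (\<xi> = 0)", OF one_bd one_bd that one one]
    by (simp add: of_bool_conj)
  have norm_prod: "cmod (a * cnj b) \<le> 4" if "cmod a \<le> 2" "cmod b \<le> 2" for a b
    using mult_mono[OF that] by (simp add: norm_mult)
  have right: "1 - f z * cnj (f w) = (1 - fst z * cnj (fst w)) * gen k1 z (cnj2 w) + (1 - snd z * cnj (snd w)) * gen k2 z (cnj2 w)"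
    if zw: "z \<in> bidisc" "w \<in> bidisc" for z w
  proof -
    note w' = cnj2_bidisc[OF zw(2)]
    have "gen (\<lambda>\<mu> \<nu>. delta \<mu> \<nu> - c \<mu> * cnj (c \<nu>)) z (cnj2 w) = 1 - f z * cnj (f w)"
    proof -
      have "gen (\<lambda>\<mu> \<nu>. c \<mu> * cnj (c \<nu>)) z (cnj2 w) = f z * cnj (f w)"
        by (rule gen_product[OF c2 _ zw(1) w' fs[OF zw(1)] conj_sum[OF fs[OF zw(2)]]]) (simp add: c2)
      then show ?thesis
        using gen_linear(2)[of "\<lambda>\<mu> \<nu>. delta \<mu> \<nu>" 2 "\<lambda>\<mu> \<nu>. c \<mu> * cnj (c \<nu>)" 4, OF one_bd norm_prod[OF c2 c2] zw(1) w'] gen_one[OF zw(1) w']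
        by simp
    qed
    moreover have "gen (\<lambda>\<mu> \<nu>. diag_diff e1 k1 \<mu> \<nu> + diag_diff e2 k2 \<mu> \<nu>) z (cnj2 w)
       = (1 - fst z * cnj (fst w)) * gen k1 z (cnj2 w) + (1 - snd z * cnj (snd w)) * gen k2 z (cnj2 w)"
      using gen_linear(1)[of "\<lambda>\<mu> \<nu>. k1 \<mu> \<nu> - k1 (\<mu> - e1) (\<nu> - e1)" 4 "\<lambda>\<mu> \<nu>. k2 \<mu> \<nu> - k2 (\<mu> - e2) (\<nu> - e2)" 4,
          OF shift_bd[of k1, OF D(6)] shift_bd[of k2, OF D(7)] zw(1) w']
        gen_diff_shift[of k1 e1, OF D(6) _ e_quad(1) zw(1) w'] gen_diff_shift[of k2 e2, OF D(7) _ e_quad(2) zw(1) w'] out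
      by (simp add: mon_e mon_cnj2)
    ultimately show ?thesis unfolding agler by simp
  qed
  define Nc where "Nc \<mu> \<nu> = delta \<mu> \<nu> - q \<mu> * cnj (q \<nu>)
        - diag_diff e1 m1 \<mu> \<nu> - diag_diff e2 m2 \<mu> \<nu>" for \<mu> \<nu>
  define N where "N z w = gen Nc z (cnj2 w)" for z w
  have b1: "cmod (delta \<mu> \<nu> - q \<mu> * cnj (q \<nu>)) \<le> 6" for \<mu> \<nu> :: idx
    using norm_triangle_ineq4[of "delta \<mu> \<nu>" "q \<mu> * cnj (q \<nu>)"] norm_prod[OF q_bd q_bd, of \<mu> \<nu>] one_bd[of "\<mu> = 0 \<and> \<nu> = 0"] by linarith
  have b2: "cmod (delta \<mu> \<nu> - q \<mu> * cnj (q \<nu>) - diag_diff e1 m1 \<mu> \<nu>) \<le> 10" for \<mu> \<nu> :: idx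
    using norm_triangle_ineq4[of "delta \<mu> \<nu> - q \<mu> * cnj (q \<nu>)" "m1 \<mu> \<nu> - m1 (\<mu> - e1) (\<nu> - e1)"]
      b1[of \<mu> \<nu>] shift_bd[of m1 \<mu> \<nu> e1 e1, OF D(8)] by linarith
  have b3: "cmod (Nc \<mu> \<nu>) \<le> 14" for \<mu> \<nu>
    using norm_triangle_ineq4[of "delta \<mu> \<nu> - q \<mu> * cnj (q \<nu>) - diag_diff e1 m1 \<mu> \<nu>" "m2 \<mu> \<nu> - m2 (\<mu> - e2) (\<nu> - e2)"]
      b2[of \<mu> \<nu>] shift_bd[of m2 \<mu> \<nu> e2 e2, OF D(9)] unfolding Nc_def by linarith
  have N_psd: "psd_kernel_on bidisc N"
    unfolding N_def[abs_def] by (rule gen_psd[OF b3]) (use psd(5) in \<open>simp add: Nc_def[abs_def]\<close>)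
  have left: "1 - qf z * cnj (qf w) = (1 - fst z * cnj (fst w)) * gen m1 z (cnj2 w) + (1 - snd z * cnj (snd w)) * gen m2 z (cnj2 w) + N z w"
    if zw: "z \<in> bidisc" "w \<in> bidisc" for z w
  proof -
    note w' = cnj2_bidisc[OF zw(2)]
    have "gen (\<lambda>\<mu> \<nu>. q \<mu> * cnj (q \<nu>)) z (cnj2 w) = qf z * cnj (qf w)"
      by (rule gen_product[OF q_bd _ zw(1) w' qs[OF zw(1)] conj_sum[OF qs[OF zw(2)]]]) (simp add: q_bd)
    then have "gen (\<lambda>\<mu> \<nu>. delta \<mu> \<nu> - q \<mu> * cnj (q \<nu>)) z (cnj2 w) = 1 - qf z * cnj (qf w)"
      using gen_linear(2)[of "\<lambda>\<mu> \<nu>. delta \<mu> \<nu>" 2 "\<lambda>\<mu> \<nu>. q \<mu> * cnj (q \<nu>)" 4, OF one_bd norm_prod[OF q_bd q_bd] zw(1) w'] gen_one[OF zw(1) w']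
      by simp
    moreover have "gen (\<lambda>\<mu> \<nu>. m1 \<mu> \<nu> - m1 (\<mu> - e1) (\<nu> - e1)) z (cnj2 w) = (1 - fst z * cnj (fst w)) * gen m1 z (cnj2 w)"
      using gen_diff_shift[of m1 e1, OF D(8) _ e_quad(1) zw(1) w'] out by (simp add: mon_e mon_cnj2)
    moreover have "gen (\<lambda>\<mu> \<nu>. m2 \<mu> \<nu> - m2 (\<mu> - e2) (\<nu> - e2)) z (cnj2 w) = (1 - snd z * cnj (snd w)) * gen m2 z (cnj2 w)"
      using gen_diff_shift[of m2 e2, OF D(9) _ e_quad(2) zw(1) w'] out by (simp add: mon_e mon_cnj2)
    ultimately show ?thesis
      unfolding N_def Nc_def[abs_def] gen_linear(2)[OF b2 shift_bd[of m2, OF D(9)] zw(1) w'] gen_linear(2)[OF b1 shift_bd[of m1, OF D(8)] zw(1) w']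
      by simp
  qed
  have diff: "f z - qf w = (fst z - fst w) * gen l1 z w + (snd z - snd w) * gen l2 z w"
    if zw: "z \<in> bidisc" "w \<in> bidisc" for z w
  proof -
    have p1: "gen (\<lambda>\<mu> \<nu>. c \<mu> * of_bool (\<nu> = 0)) z w = f z * 1"
      by (rule gen_product[OF c2 one_bd zw fs[OF zw(1)] one])
    have p2: "gen (\<lambda>\<mu> \<nu>. of_bool (\<mu> = 0) * q \<nu>) z w = 1 * qf w"
      by (rule gen_product[OF one_bd q_bd zw one qs[OF zw(2)]])
    have bp: "cmod (c \<mu> * of_bool P) \<le> 2" "cmod (of_bool P * q \<mu>) \<le> 2" for \<mu> P
      using c2[of \<mu>] q_bd[of \<mu>] by auto
    have sh: "gen (\<lambda>\<mu> \<nu>. l (\<mu> - a) \<nu> - l \<mu> (\<nu> - a)) z w = (mon a z - mon a w) * gen l z w"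
      if l: "\<And>\<mu> \<nu>. cmod (l \<mu> \<nu>) \<le> 2" "\<And>\<mu> \<nu>. \<mu> \<notin> quadrant \<or> \<nu> \<notin> quadrant \<Longrightarrow> l \<mu> \<nu> = 0" and a: "a \<in> quadrant" for l a
      using gen_linear(2)[of "\<lambda>\<mu> \<nu>. l (\<mu> - a) \<nu>" 2 "\<lambda>\<mu> \<nu>. l \<mu> (\<nu> - a)" 2, OF l(1) l(1) zw]
        gen_shift[of l 2, OF l zw a e_quad(3)] gen_shift[of l 2, OF l zw e_quad(3) a]
      by (simp add: mon_e algebra_simps)
    have bl: "cmod (l (\<mu> - a) \<nu> - l \<mu> (\<nu> - a)) \<le> 4" if "\<And>\<mu> \<nu>. cmod (l \<mu> \<nu>) \<le> 2" for l :: "idx \<Rightarrow> idx \<Rightarrow> complex" and a \<mu> \<nu>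
      using norm_triangle_ineq4[of "l (\<mu> - a) \<nu>" "l \<mu> (\<nu> - a)"] that[of "\<mu> - a" \<nu>] that[of \<mu> "\<nu> - a"] by linarith
    have "gen (\<lambda>\<mu> \<nu>. c \<mu> * of_bool (\<nu> = 0) - of_bool (\<mu> = 0) * q \<nu>) z w = f z - qf w"
      using gen_linear(2)[of "\<lambda>\<mu> \<nu>. c \<mu> * of_bool (\<nu> = 0)" 2 "\<lambda>\<mu> \<nu>. of_bool (\<mu> = 0) * q \<nu>" 2, OF bp zw] p1 p2 by simp
    moreover have "gen (\<lambda>\<mu> \<nu>. cross_diff e1 l1 \<mu> \<nu> + cross_diff e2 l2 \<mu> \<nu>) z w
        = (fst z - fst w) * gen l1 z w + (snd z - snd w) * gen l2 z w"
      using gen_linear(1)[of "\<lambda>\<mu> \<nu>. l1 (\<mu> - e1) \<nu> - l1 \<mu> (\<nu> - e1)" 4 "\<lambda>\<mu> \<nu>. l2 (\<mu> - e2) \<nu> - l2 \<mu> (\<nu> - e2)" 4,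
          OF bl[of l1, OF D(10)] bl[of l2, OF D(11)] zw]
        sh[of l1 e1, OF D(10) _ e_quad(1)] sh[of l2 e2, OF D(11) _ e_quad(2)] out
      by (simp add: mon_e)
    ultimately show ?thesis unfolding l_eq by simp
  qed
  \<comment> \<open>On the diagonal both factors z_j - w_j vanish.\<close>
  have qf: "qf z = f z" if "z \<in> bidisc" for z using diff[OF that that] by simp
  \<comment> \<open>The right kernels dominate L in one variable and the left kernels in the other; only the averages treat z and w alike.\<close>
  define K1 where "K1 z w = of_real (1/2) * (gen k1 z (cnj2 w) + (gen m1 z (cnj2 w) + N z w / (1 - fst z * cnj (fst w))))" for z w
  define K2 where "K2 z w = of_real (1/2) * (gen k2 z (cnj2 w) + gen m2 z (cnj2 w))" for z w
  define L1 where "L1 = gen (\<lambda>\<mu> \<nu>. 1/2 * (l1 \<mu> \<nu> + l1 \<nu> \<mu>))"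
  define L2 where "L2 = gen (\<lambda>\<mu> \<nu>. 1/2 * (l2 \<mu> \<nu> + l2 \<nu> \<mu>))"
  have kp: "psd_kernel_on bidisc (\<lambda>z w. gen k1 z (cnj2 w))" "psd_kernel_on bidisc (\<lambda>z w. gen k2 z (cnj2 w))"
    and mp: "psd_kernel_on bidisc (\<lambda>z w. gen m1 z (cnj2 w))" "psd_kernel_on bidisc (\<lambda>z w. gen m2 z (cnj2 w))"
    by (rule gen_psd[OF D(6) D(1)] gen_psd[OF D(7) D(2)] gen_psd[OF D(8) D(3)] gen_psd[OF D(9) D(4)])+
  have Np: "psd_kernel_on bidisc (\<lambda>z w. N z w / (1 - fst z * cnj (fst w)))"
    by (rule psd_Szego_multiply[OF N_psd]) (auto simp: bidisc_def)
  have sym_bd: "cmod (1/2 * (l \<mu> \<nu> + l \<nu> \<mu>)) \<le> 2" if "\<And>\<mu> \<nu>. cmod (l \<mu> \<nu>) \<le> 2" for l :: "idx \<Rightarrow> idx \<Rightarrow> complex" and \<mu> \<nu>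
    using norm_triangle_ineq[of "l \<mu> \<nu>" "l \<nu> \<mu>"] that[of \<mu> \<nu>] that[of \<nu> \<mu>] by (simp add: norm_mult)
  have sym: "gen (\<lambda>\<mu> \<nu>. 1/2 * (l \<mu> \<nu> + l \<nu> \<mu>)) z w = 1/2 * (gen l z w + gen l w z)"
    if l: "\<And>\<mu> \<nu>. cmod (l \<mu> \<nu>) \<le> 2" and zw: "z \<in> bidisc" "w \<in> bidisc" for l z w
  proof -
    have "gen (\<lambda>\<mu> \<nu>. 1/2 * (l \<mu> \<nu> + l \<nu> \<mu>)) z w = 1/2 * gen (\<lambda>\<mu> \<nu>. l \<mu> \<nu> + l \<nu> \<mu>) z w"
      unfolding gen_def mult.assoc by (rule infsum_cmult_right')
    then show ?thesis
      using gen_linear(1)[of l 2 "\<lambda>\<mu> \<nu>. l \<nu> \<mu>" 2 z w] gen_transpose[of l 2 z w] l zw by simp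
  qed
  have half: "(cmod (1/2 * (x + y)))\<^sup>2 \<le> Re (K * K')"
    if "(cmod x)\<^sup>2 \<le> a * b'" "(cmod y)\<^sup>2 \<le> a' * b" "0 \<le> a" "0 \<le> b" "0 \<le> a'" "0 \<le> b'"
      "K \<in> \<real>\<^sub>\<ge>\<^sub>0" "K' \<in> \<real>\<^sub>\<ge>\<^sub>0" "(a + b) / 2 \<le> Re K" "(a' + b') / 2 \<le> Re K'" for x y K K' a b a' b'
  proof -
    have "(cmod (x + y))\<^sup>2 \<le> (cmod x + cmod y)\<^sup>2" by (intro power_mono norm_triangle_ineq) auto
    also have "\<dots> \<le> (a + b) * (a' + b')" using that by (intro sum_squares_bound) auto
    finally have "(cmod (x + y))\<^sup>2 / 4 \<le> ((a + b) / 2) * ((a' + b') / 2)" by simp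
    also have "\<dots> \<le> Re K * Re K'" using that by (intro mult_mono) (auto simp: complex_nonneg_Reals_iff)
    also have "\<dots> = Re (K * K')" using that by (simp add: complex_nonneg_Reals_iff)
    finally show ?thesis by (simp add: norm_mult power_mult_distrib power_divide)
  qed
  show ?thesis
  proof (intro exI conjI ballI)
    show K1p: "psd_kernel_on bidisc K1" unfolding K1_def[abs_def]
      by (intro psd_scale psd_add kp mp Np) auto
    show K2p: "psd_kernel_on bidisc K2" unfolding K2_def[abs_def]
      by (intro psd_scale psd_add kp mp) auto
    show "holomorphic4_on (\<lambda>(z, \<zeta>). L1 z \<zeta>) (bidisc \<times> bidisc)"
      unfolding L1_def by (rule gen_holomorphic[OF sym_bd[of l1, OF D(10)]])
    show "holomorphic4_on (\<lambda>(z, \<zeta>). L2 z \<zeta>) (bidisc \<times> bidisc)"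
      unfolding L2_def by (rule gen_holomorphic[OF sym_bd[of l2, OF D(11)]])
    fix z w assume zw: "z \<in> bidisc" "w \<in> bidisc"
    have "cmod (fst z) * cmod (fst w) < 1 * 1"
      using zw by (intro mult_strict_mono') (auto simp: bidisc_def)
    then have nz: "1 - fst z * cnj (fst w) \<noteq> 0"
      by (metis complex_mod_cnj less_irrefl mult_1 norm_mult norm_one right_minus_eq)
    have "1 - f z * cnj (f w) = 1/2 * ((1 - f z * cnj (f w)) + (1 - qf z * cnj (qf w)))" using qf zw by simp
    also have "\<dots> = (1 - fst z * cnj (fst w)) * K1 z w + (1 - snd z * cnj (snd w)) * K2 z w"
      unfolding right[OF zw] left[OF zw] K1_def K2_def using nz by (simp add: field_simps)
    finally show "1 - f z * cnj (f w) = (1 - fst z * cnj (fst w)) * K1 z w + (1 - snd z * cnj (snd w)) * K2 z w" .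
    have L: "L1 z w = 1/2 * (gen l1 z w + gen l1 w z)" "L2 z w = 1/2 * (gen l2 z w + gen l2 w z)"
      unfolding L1_def L2_def using sym[of l1, OF D(10) zw] sym[of l2, OF D(11) zw] by auto
    have "f z - f w = 1/2 * ((f z - qf w) - (f w - qf z))" using qf zw by simp
    also have "\<dots> = (fst z - fst w) * L1 z w + (snd z - snd w) * L2 z w"
      unfolding diff[OF zw] diff[OF zw(2,1)] L by (simp add: field_simps)
    finally show "f z - f w = (fst z - fst w) * L1 z w + (snd z - snd w) * L2 z w" .
    have nn: "0 \<le> Re (K z z)" if "psd_kernel_on bidisc K" "z \<in> bidisc" for K z
      using psd_on_diag[OF that] by (simp add: complex_nonneg_Reals_iff)
    note kn = nn[OF kp(1)] nn[OF kp(2)] nn[OF mp(1)] nn[OF mp(2)] nn[OF Np]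
    show "(cmod (L1 z w))\<^sup>2 \<le> Re (K1 z z * K1 w w)"
      unfolding L
    proof (rule half)
      show "(cmod (gen l1 z w))\<^sup>2 \<le> Re (gen k1 z (cnj2 z)) * Re (gen m1 w (cnj2 w))"
        by (rule gen_dominated[OF D(6) D(8) D(10) dom(1) zw])
      show "(cmod (gen l1 w z))\<^sup>2 \<le> Re (gen k1 w (cnj2 w)) * Re (gen m1 z (cnj2 z))"
        by (rule gen_dominated[OF D(6) D(8) D(10) dom(1) zw(2,1)])
      show "(Re (gen k1 z (cnj2 z)) + Re (gen m1 z (cnj2 z))) / 2 \<le> Re (K1 z z)"
        "(Re (gen k1 w (cnj2 w)) + Re (gen m1 w (cnj2 w))) / 2 \<le> Re (K1 w w)"
        using kn(5)[OF zw(1)] kn(5)[OF zw(2)] by (simp_all add: K1_def del: Re_divide)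
    qed (use kn zw psd_on_diag[OF K1p] in auto)
    show "(cmod (L2 z w))\<^sup>2 \<le> Re (K2 z z * K2 w w)"
      unfolding L
    proof (rule half)
      show "(cmod (gen l2 z w))\<^sup>2 \<le> Re (gen k2 z (cnj2 z)) * Re (gen m2 w (cnj2 w))"
        by (rule gen_dominated[OF D(7) D(9) D(11) dom(2) zw])
      show "(cmod (gen l2 w z))\<^sup>2 \<le> Re (gen k2 w (cnj2 w)) * Re (gen m2 z (cnj2 z))"
        by (rule gen_dominated[OF D(7) D(9) D(11) dom(2) zw(2,1)])
      show "(Re (gen k2 z (cnj2 z)) + Re (gen m2 z (cnj2 z))) / 2 \<le> Re (K2 z z)"
        "(Re (gen k2 w (cnj2 w)) + Re (gen m2 w (cnj2 w))) / 2 \<le> Re (K2 w w)"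
        by (simp_all add: K2_def)
    qed (use kn zw psd_on_diag[OF K2p] in auto)
  qed
qed

end
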